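(* Let $n\ge1$, let $M$ be a number with $M^2\in\mathbb{R}\setminus\{0\}$, put $m=|M|$, and let $(x_0,t_0)\in\mathbb{R}^n\times\mathbb{R}$. Define the distributions, for $x\in\mathbb{R}^n$, $t\in\mathbb{R}$, $$\mathcal{E}_{\mathcal Re}(x,t;x_0,t_0)=H(t-t_0)\int_0^{t-t_0}J_0\!\left(m\sqrt{(t-t_0)^2-r^2}\right)\mathcal{E}^{wave}(x-x_0,r)\,dr,$$ $$\mathcal{E}_{\mathcal Im}(x,t;x_0,t_0)=H(t-t_0)\int_0^{t-t_0}I_0\!\left(m\sqrt{(t-t_0)^2-r^2}\right)\mathcal{E}^{wave}(x-x_0,r)\,dr .$$ Then $\mathcal{E}_{\mathcal Re}$ if $M^2>0$, and $\mathcal{E}_{\mathcal Im}$ if $M^2<0$, is a forward fundamental solution of the Klein–Gordon operator $\partial_t^2-\Delta+M^2$ in $\mathbb{R}^{n+1}$; that is, denoting it by $\mathcal{E}$, $$(\partial_t^2-\Delta+M^2)\,\mathcal{E}(x,t;x_0,t_0)=\delta(x-x_0)\,\delta(t-t_0)\ \text{ in }\mathcal{D}'(\mathbb{R}^{n+1}),\qquad \operatorname{supp}\mathcal{E}\subseteq D(x_0,t_0).$$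
   Context: $H$ is the Heaviside step function; $J_0$ and $I_0$ are the Bessel function and the modified Bessel function of the first kind of order $0$. $M$ is real when $M^2>0$ and purely imaginary when $M^2<0$. $\mathcal{E}^{wave}(x,t)\in C^\infty(\mathbb{R}_t;\mathcal{D}'(\mathbb{R}^n_x))$ is the fundamental solution of the Cauchy problem for the wave equation corresponding to the first datum with support at the origin: $\mathcal{E}^{wave}_{tt}-\Delta\mathcal{E}^{wave}=0$, $\mathcal{E}^{wave}(x,0)=\delta(x)$, $\mathcal{E}^{wave}_t(x,0)=0$. The integrals in $r$ are integrals of $\mathcal{D}'(\mathbb{R}^n)$-valued functions. $D(x_0,t_0)=\{(x,t)\in\mathbb{R}^{n+1} : |x-x_0|\le t-t_0\}$ is the forward light cone. *)

theory Defs
  imports "HOL-Analysis.Analysis"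
begin

section \<open>Test functions\<close>

definition dir_deriv :: "'a::euclidean_space \<Rightarrow> ('a \<Rightarrow> 'b::real_normed_vector) \<Rightarrow> 'a \<Rightarrow> 'b" where
  "dir_deriv v f = (\<lambda>x. frechet_derivative f (at x) v)"

fun iter_deriv :: "'a::euclidean_space list \<Rightarrow> ('a \<Rightarrow> 'b::real_normed_vector) \<Rightarrow> 'a \<Rightarrow> 'b" where
  "iter_deriv [] f = f"
| "iter_deriv (v # vs) f = dir_deriv v (iter_deriv vs f)"

text \<open>\<open>C\<^sup>\<infinity>\<close>: every iterated partial derivative is (totally) differentiable everywhere, so
  that all partial derivatives of all orders exist and are continuous.\<close>
definition smooth :: "('a::euclidean_space \<Rightarrow> 'b::real_normed_vector) \<Rightarrow> bool" where
  "smooth f \<longleftrightarrow> (\<forall>vs. set vs \<subseteq> Basis \<longrightarrow> iter_deriv vs f differentiable_on UNIV)"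

definition fun_support :: "('a::euclidean_space \<Rightarrow> complex) \<Rightarrow> 'a set" where
  "fun_support \<phi> = closure {x. \<phi> x \<noteq> 0}"

definition test_function :: "('a::euclidean_space \<Rightarrow> complex) \<Rightarrow> bool" where
  "test_function \<phi> \<longleftrightarrow> smooth \<phi> \<and> compact (fun_support \<phi>)"

section \<open>Distributions on a Euclidean space\<close>

text \<open>A distribution is represented by a total functional of which only the values on test
  functions are meaningful; equality in \<open>\<D>'\<close> is therefore \<open>distr_eq\<close>, not HOL equality.\<close>
type_synonym 'a distr = "('a \<Rightarrow> complex) \<Rightarrow> complex"

text \<open>The seminorm sums over ordered lists of basis directions rather than over multi-indices;
  this merely repeats some of the summands.\<close>
definition distribution :: "'a::euclidean_space distr \<Rightarrow> bool" where
  "distribution u \<longleftrightarrow>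
     (\<forall>\<phi> \<psi> a b. test_function \<phi> \<longrightarrow> test_function \<psi> \<longrightarrow>
        u (\<lambda>x. a * \<phi> x + b * \<psi> x) = a * u \<phi> + b * u \<psi>) \<and>
     (\<forall>K. compact K \<longrightarrow> (\<exists>C N. \<forall>\<phi>. test_function \<phi> \<and> fun_support \<phi> \<subseteq> K \<longrightarrow>
        cmod (u \<phi>) \<le>
          C * (\<Sum>vs | set vs \<subseteq> Basis \<and> length vs \<le> N. SUP x. cmod (iter_deriv vs \<phi> x))))"

definition distr_eq :: "'a::euclidean_space distr \<Rightarrow> 'a distr \<Rightarrow> bool" where
  "distr_eq u v \<longleftrightarrow> (\<forall>\<phi>. test_function \<phi> \<longrightarrow> u \<phi> = v \<phi>)"

definition distr_support :: "'a::euclidean_space distr \<Rightarrow> 'a set" where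
  "distr_support u =
     - \<Union>{U. open U \<and> (\<forall>\<phi>. test_function \<phi> \<and> fun_support \<phi> \<subseteq> U \<longrightarrow> u \<phi> = 0)}"

definition distr_deriv :: "'a::euclidean_space \<Rightarrow> 'a distr \<Rightarrow> 'a distr" where
  "distr_deriv v u = (\<lambda>\<phi>. - u (dir_deriv v \<phi>))"

definition distr_laplacian :: "'a::euclidean_space distr \<Rightarrow> 'a distr" where
  "distr_laplacian u = (\<lambda>\<phi>. \<Sum>b\<in>Basis. distr_deriv b (distr_deriv b u) \<phi>)"

text \<open>\<open>u(x - a)\<close>\<close>
definition distr_translate :: "'a::euclidean_space \<Rightarrow> 'a distr \<Rightarrow> 'a distr" where
  "distr_translate a u = (\<lambda>\<phi>. u (\<lambda>x. \<phi> (x + a)))"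

text \<open>\<open>\<delta>(x - a)\<close>\<close>
definition dirac :: "'a::euclidean_space \<Rightarrow> 'a distr" where
  "dirac a = (\<lambda>\<phi>. \<phi> a)"

definition distr_tensor ::
  "'a::euclidean_space distr \<Rightarrow> 'b::euclidean_space distr \<Rightarrow> ('a \<times> 'b) distr" where
  "distr_tensor u v = (\<lambda>\<phi>. u (\<lambda>x. v (\<lambda>y. \<phi> (x, y))))"

section \<open>Distribution-valued functions of a real variable\<close>

text \<open>Smoothness, derivative and integral of a \<open>\<D>'\<close>-valued function are taken in the weak
  sense, that is, after pairing with each fixed test function.\<close>

definition smooth_distr_family :: "(real \<Rightarrow> 'a::euclidean_space distr) \<Rightarrow> bool" where
  "smooth_distr_family F \<longleftrightarrow>
     (\<forall>t. distribution (F t)) \<and> (\<forall>\<psi>. test_function \<psi> \<longrightarrow> smooth (\<lambda>t. F t \<psi>))"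

definition family_deriv :: "(real \<Rightarrow> 'a::euclidean_space distr) \<Rightarrow> real \<Rightarrow> 'a distr" where
  "family_deriv F t = (\<lambda>\<psi>. vector_derivative (\<lambda>s. F s \<psi>) (at t))"

definition distr_integral ::
  "real \<Rightarrow> real \<Rightarrow> (real \<Rightarrow> 'a::euclidean_space distr) \<Rightarrow> 'a distr" where
  "distr_integral a b F = (\<lambda>\<psi>. LBINT r:{a..b}. F r \<psi>)"

text \<open>The distribution on space-time determined by a function of time with values in the
  distributions on space.\<close>
definition distr_of_family ::
  "(real \<Rightarrow> 'a::euclidean_space distr) \<Rightarrow> ('a \<times> real) distr" where
  "distr_of_family F = (\<lambda>\<phi>. LBINT t. F t (\<lambda>x. \<phi> (x, t)))"

section \<open>The wave and Klein-Gordon equations\<close>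

definition wave_fundamental_solution :: "(real \<Rightarrow> (real ^ 'n) distr) \<Rightarrow> bool" where
  "wave_fundamental_solution E \<longleftrightarrow>
     smooth_distr_family E \<and>
     (\<forall>t. distr_eq (\<lambda>\<psi>. family_deriv (family_deriv E) t \<psi> - distr_laplacian (E t) \<psi>) (\<lambda>\<psi>. 0)) \<and>
     distr_eq (E 0) (dirac 0) \<and>
     distr_eq (family_deriv E 0) (\<lambda>\<psi>. 0)"

text \<open>\<open>(\<partial>\<^sub>t\<^sup>2 - \<Delta> + M\<^sup>2) u\<close>, with \<open>\<Delta>\<close> acting in the space variables only.\<close>
definition klein_gordon :: "complex \<Rightarrow> ((real ^ 'n) \<times> real) distr \<Rightarrow> ((real ^ 'n) \<times> real) distr" where
  "klein_gordon M u = (\<lambda>\<phi>.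
     distr_deriv (0, 1) (distr_deriv (0, 1) u) \<phi>
     - (\<Sum>i\<in>UNIV. distr_deriv (axis i 1, 0) (distr_deriv (axis i 1, 0) u) \<phi>)
     + M\<^sup>2 * u \<phi>)"

definition forward_light_cone :: "real ^ 'n \<Rightarrow> real \<Rightarrow> ((real ^ 'n) \<times> real) set" where
  "forward_light_cone x0 t0 = {(x, t). norm (x - x0) \<le> t - t0}"

definition forward_fundamental_solution ::
  "complex \<Rightarrow> real ^ 'n \<Rightarrow> real \<Rightarrow> ((real ^ 'n) \<times> real) distr \<Rightarrow> bool" where
  "forward_fundamental_solution M x0 t0 E \<longleftrightarrow>
     distribution E \<and>
     distr_eq (klein_gordon M E) (distr_tensor (dirac x0) (dirac t0)) \<and>
     distr_support E \<subseteq> forward_light_cone x0 t0"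

definition heaviside :: "real \<Rightarrow> real" where
  "heaviside s = (if s < 0 then 0 else 1)"

definition bessel_J0 :: "real \<Rightarrow> real" where
  "bessel_J0 z = (\<Sum>k. (-1) ^ k / (fact k)\<^sup>2 * (z / 2) ^ (2 * k))"

definition bessel_I0 :: "real \<Rightarrow> real" where
  "bessel_I0 z = (\<Sum>k. 1 / (fact k)\<^sup>2 * (z / 2) ^ (2 * k))"

text \<open>In the next two definitions the argument \<open>Ew\<close> is the family \<open>r \<mapsto> \<E>\<^sup>w\<^sup>a\<^sup>v\<^sup>e(\<cdot>, r)\<close>.\<close>

definition E_Re ::
  "(real \<Rightarrow> (real ^ 'n) distr) \<Rightarrow> real \<Rightarrow> real ^ 'n \<Rightarrow> real \<Rightarrow> ((real ^ 'n) \<times> real) distr" where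
  "E_Re Ew m x0 t0 = distr_of_family (\<lambda>t \<psi>.
     of_real (heaviside (t - t0)) *
     distr_integral 0 (t - t0)
       (\<lambda>r \<eta>. of_real (bessel_J0 (m * sqrt ((t - t0)\<^sup>2 - r\<^sup>2))) * distr_translate x0 (Ew r) \<eta>) \<psi>)"

definition E_Im ::
  "(real \<Rightarrow> (real ^ 'n) distr) \<Rightarrow> real \<Rightarrow> real ^ 'n \<Rightarrow> real \<Rightarrow> ((real ^ 'n) \<times> real) distr" where
  "E_Im Ew m x0 t0 = distr_of_family (\<lambda>t \<psi>.
     of_real (heaviside (t - t0)) *
     distr_integral 0 (t - t0)
       (\<lambda>r \<eta>. of_real (bessel_I0 (m * sqrt ((t - t0)\<^sup>2 - r\<^sup>2))) * distr_translate x0 (Ew r) \<eta>) \<psi>)"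

end

theory Submission
  imports Defs
begin

text \<open>
  Pairing the equation with a test function \<open>\<phi>\<close> reduces it to one space dimension: with
  \<open>a(t, r) = \<langle>\<E>\<^sup>w\<^sup>a\<^sup>v\<^sup>e(\<cdot>, r), \<phi>(\<cdot>, t)\<rangle>\<close> the wave equation gives
  \<open>a\<^sub>r\<^sub>r = \<langle>\<E>\<^sup>w\<^sup>a\<^sup>v\<^sup>e(\<cdot>, r), \<Delta>\<phi>(\<cdot>, t)\<rangle>\<close>, and the Bessel kernel \<open>K(t, r)\<close> is the Riemann function
  of \<open>\<partial>\<^sub>t\<^sup>2 - \<partial>\<^sub>r\<^sup>2 + M\<^sup>2\<close>: it solves this equation, equals \<open>1\<close> on the characteristic \<open>r = t\<close>, and is
  even in \<open>r\<close>. Hence \<open>K (a\<^sub>t\<^sub>t - a\<^sub>r\<^sub>r + M\<^sup>2 a)\<close> integrates over the triangle \<open>0 \<le> r \<le> t\<close> to \<open>a(0, 0) = \<phi>(0, 0)\<close>.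

  The wave family is smooth only in the weak sense, so the joint continuity of \<open>a\<close> and the continuity of the
  resulting functional on test functions rest on the uniform boundedness principle for distributions.
  The support statement follows from finite speed of propagation, that is, from an energy estimate for the
  functions \<open>(t, x) \<mapsto> \<langle>\<E>\<^sup>w\<^sup>a\<^sup>v\<^sup>e(\<cdot>, t), \<psi>(\<cdot> + x)\<rangle>\<close>.
\<close>

section \<open>Iterated directional derivatives\<close>

text \<open>Weak smoothness of \<open>E\<close> does not directly give seminorm bounds for
  \<open>family_deriv E t\<close>. It is therefore rewritten, by the wave equation and the vanishing
  second datum, as a time integral of \<open>E s\<close> applied to second derivatives; continuity
  and spatial derivatives of the velocity field come from that formula. The energy argument cannot
  be run on \<open>E\<close> itself, only on the classical solutions obtained by pairing
  \<open>E\<close> with translates of a test function. A translation argument replaces the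
  divergence theorem there, since the weighted flux has compact support.

  In the triangle, \<open>t\<close> is both a limit of integration and a parameter. Such integrals
  are treated as functions of two independent variables and restricted to the diagonal at the end.
  No singularity of the square root is met: \<open>J\<^sub>0\<close> and \<open>I\<^sub>0\<close>
  are even, so both kernels are one entire function of \<open>l (t\<^sup>2 - r\<^sup>2)\<close> with
  \<open>l = M\<^sup>2\<close> of either sign. The terms left over on the characteristic form the
  derivative of the kernel along it, which is 0; on \<open>r = 0\<close> they vanish because of the
  second datum and the evenness of the kernel.\<close>

lemma dir_deriv_eq: "(f has_derivative f') (at x) \<Longrightarrow> dir_deriv v f x = f' v"
  unfolding dir_deriv_def by (metis frechet_derivative_at)

lemma iter_deriv_append: "iter_deriv (vs @ ws) f = iter_deriv vs (iter_deriv ws f)"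
  by (induction vs) auto

lemma smooth_differentiable:
  "smooth f \<Longrightarrow> set vs \<subseteq> Basis \<Longrightarrow> iter_deriv vs f differentiable (at x)"
  unfolding smooth_def by (simp add: differentiable_on_def)

lemma smooth_has_derivative:
  assumes "smooth f"
  shows "(f has_derivative (\<lambda>h. dir_deriv h f x)) (at x)"
  using smooth_differentiable[OF assms, of "[]" x]
  by (simp add: dir_deriv_def frechet_derivative_works)

lemma smooth_iter_deriv:
  assumes "smooth f" "set ws \<subseteq> Basis"
  shows "smooth (iter_deriv ws f)"
  unfolding smooth_def
proof (intro allI impI)
  fix vs :: "'a list" assume "set vs \<subseteq> Basis"
  then show "iter_deriv vs (iter_deriv ws f) differentiable_on UNIV"
    using assms by (metis iter_deriv_append smooth_def set_append Un_least)
qed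

lemma smooth_dir_deriv: "smooth f \<Longrightarrow> b \<in> Basis \<Longrightarrow> smooth (dir_deriv b f)"
  using smooth_iter_deriv[of f "[b]"] by simp

lemma smooth_continuous_on: "smooth f \<Longrightarrow> continuous_on S f"
  by (auto intro!: continuous_at_imp_continuous_on has_derivative_continuous[OF smooth_has_derivative])

lemma smooth_has_vector_derivative_line:
  assumes "smooth f"
  shows "((\<lambda>s. f (x + s *\<^sub>R v)) has_vector_derivative dir_deriv v f (x + s *\<^sub>R v)) (at s within S)"
proof -
  have "((\<lambda>s. x + s *\<^sub>R v) has_derivative (\<lambda>h. h *\<^sub>R v)) (at s within S)"
    by (auto intro!: derivative_eq_intros)
  from has_derivative_compose[OF this smooth_has_derivative[OF assms]]
  have "((\<lambda>s. f (x + s *\<^sub>R v)) has_derivative (\<lambda>h. dir_deriv (h *\<^sub>R v) f (x + s *\<^sub>R v))) (at s within S)" .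
  moreover have "linear (\<lambda>h. dir_deriv h f (x + s *\<^sub>R v))"
    using smooth_has_derivative[OF assms] by (rule has_derivative_linear)
  then have "dir_deriv (h *\<^sub>R v) f (x + s *\<^sub>R v) = h *\<^sub>R dir_deriv v f (x + s *\<^sub>R v)" for h
    by (rule linear_cmul)
  ultimately show ?thesis by (simp add: has_vector_derivative_def)
qed

lemma smooth_dir_deriv_expand:
  assumes "smooth f"
  shows "dir_deriv h f x = (\<Sum>b\<in>Basis. (h \<bullet> b) *\<^sub>R dir_deriv b f x)"
proof -
  have l: "linear (\<lambda>h. dir_deriv h f x)"
    using smooth_has_derivative[OF assms] by (rule has_derivative_linear)
  have "dir_deriv h f x = dir_deriv (\<Sum>b\<in>Basis. (h \<bullet> b) *\<^sub>R b) f x"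
    by (simp add: euclidean_representation)
  also have "\<dots> = (\<Sum>b\<in>Basis. (h \<bullet> b) *\<^sub>R dir_deriv b f x)"
    by (simp add: linear_sum[OF l] linear_cmul[OF l])
  finally show ?thesis .
qed

text \<open>The chain rule stays free of sums because \<open>L\<close> sends basis vectors to basis
  vectors: a derivative along \<open>v\<close> becomes one along \<open>L v\<close>. Translations,
  slices \<open>x \<mapsto> (x, p)\<close> and the maps \<open>(x, p) \<mapsto> x + p\<close> and
  \<open>(x, s) \<mapsto> x + s b\<close> all have this form up to a constant.\<close>

lemma iter_deriv_affine:
  assumes "smooth f" "linear L" "L ` Basis \<subseteq> Basis" "set vs \<subseteq> Basis"
  shows "iter_deriv vs (\<lambda>x. f (L x + c)) = (\<lambda>x. iter_deriv (map L vs) f (L x + c))"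
  using assms(4)
proof (induction vs)
  case (Cons v vs)
  have s: "set (map L vs) \<subseteq> Basis" using Cons.prems assms(3) by auto
  have bl: "bounded_linear L" using assms(2) by (simp add: linear_conv_bounded_linear)
  show ?case
  proof
    fix x
    have "((\<lambda>x. L x + c) has_derivative L) (at x)"
      by (auto intro!: derivative_eq_intros bounded_linear_imp_has_derivative bl)
    from has_derivative_compose[OF this smooth_has_derivative[OF smooth_iter_deriv[OF assms(1) s]]]
    show "iter_deriv (v # vs) (\<lambda>x. f (L x + c)) x = iter_deriv (map L (v # vs)) f (L x + c)"
      using Cons by (simp add: dir_deriv_eq)
  qed
qed simp

lemma smooth_affine:
  fixes f :: "'b::euclidean_space \<Rightarrow> 'c::real_normed_vector" and L :: "'a::euclidean_space \<Rightarrow> 'b"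
  assumes "smooth f" "linear L" "L ` Basis \<subseteq> Basis"
  shows "smooth (\<lambda>x. f (L x + c))"
  unfolding smooth_def
proof (intro allI impI)
  fix vs :: "'a list" assume vs: "set vs \<subseteq> Basis"
  have s: "set (map L vs) \<subseteq> Basis" using vs assms(3) by auto
  have bl: "bounded_linear L" using assms(2) by (simp add: linear_conv_bounded_linear)
  have "(\<lambda>x. iter_deriv (map L vs) f (L x + c)) differentiable (at x)" for x
  proof -
    have "((\<lambda>x. L x + c) has_derivative L) (at x)"
      by (auto intro!: derivative_eq_intros bounded_linear_imp_has_derivative bl)
    from has_derivative_compose[OF this smooth_has_derivative[OF smooth_iter_deriv[OF assms(1) s]]]
    show ?thesis by (rule differentiableI)
  qed
  then show "iter_deriv vs (\<lambda>x. f (L x + c)) differentiable_on UNIV"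
    by (simp add: iter_deriv_affine[OF assms vs] differentiable_on_def)
qed

lemma iter_deriv_lincomb:
  fixes f g :: "'a::euclidean_space \<Rightarrow> complex"
  assumes "smooth f" "smooth g" "set vs \<subseteq> Basis"
  shows "iter_deriv vs (\<lambda>x. a * f x + b * g x) = (\<lambda>x. a * iter_deriv vs f x + b * iter_deriv vs g x)"
  using assms(3)
proof (induction vs)
  case (Cons v vs)
  show ?case
  proof
    fix x
    have "((\<lambda>x. a * iter_deriv vs f x + b * iter_deriv vs g x) has_derivative
      (\<lambda>h. a * dir_deriv h (iter_deriv vs f) x + b * dir_deriv h (iter_deriv vs g) x)) (at x)"
      using Cons.prems assms
      by (auto intro!: derivative_eq_intros smooth_has_derivative smooth_iter_deriv)
    then show "iter_deriv (v # vs) (\<lambda>x. a * f x + b * g x) x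
        = a * iter_deriv (v # vs) f x + b * iter_deriv (v # vs) g x"
      using Cons by (simp add: dir_deriv_eq)
  qed
qed simp

lemma smooth_lincomb:
  fixes f g :: "'a::euclidean_space \<Rightarrow> complex"
  assumes "smooth f" "smooth g"
  shows "smooth (\<lambda>x. a * f x + b * g x)"
  unfolding smooth_def
proof (intro allI impI)
  fix vs :: "'a list" assume "set vs \<subseteq> Basis"
  then show "iter_deriv vs (\<lambda>x. a * f x + b * g x) differentiable_on UNIV"
    using assms by (auto simp: iter_deriv_lincomb differentiable_on_def
      intro!: derivative_intros smooth_differentiable)
qed

text \<open>The increment of \<open>f\<close> along \<open>w\<close> is the integral of
  \<open>dir_deriv w f\<close>. Differentiating this identity along \<open>v\<close> under the
  integral sign, and then once more along \<open>w\<close>, produces the two orders of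
  differentiation.\<close>

lemma dir_deriv_commute:
  fixes f :: "'a::euclidean_space \<Rightarrow> 'b::banach"
  assumes f: "smooth f" and b: "v \<in> Basis" "w \<in> Basis"
  shows "dir_deriv v (dir_deriv w f) = dir_deriv w (dir_deriv v f)"
proof
  fix x
  have sv: "smooth (dir_deriv v f)" and sw: "smooth (dir_deriv w f)"
    and svw: "smooth (dir_deriv v (dir_deriv w f))"
    using f b by (auto intro: smooth_dir_deriv)
  let ?p = "\<lambda>s t. x + s *\<^sub>R v + t *\<^sub>R w"
  have cont: "continuous_on S (\<lambda>z. g (?p (h z) (k z)))"
    if "smooth g" "continuous_on S h" "continuous_on S k" for g :: "'a \<Rightarrow> 'b" and S :: "'c::topological_space set" and h k
    by (rule continuous_on_compose2[OF smooth_continuous_on[OF that(1), of UNIV]])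
       (auto intro!: continuous_intros that)
  have cont2: "continuous_on S (\<lambda>(s,t). g (?p s t))"
    if "smooth g" for g :: "'a \<Rightarrow> 'b" and S :: "(real\<times>real) set"
    unfolding split_beta by (intro cont that continuous_intros)
  have eq: "integral {0..t} (\<lambda>t. dir_deriv v (dir_deriv w f) (?p 0 t))
      = dir_deriv v f (?p 0 t) - dir_deriv v f x" if t: "t \<in> {0..1}" for t
  proof -
    have "((\<lambda>s. integral (cbox 0 t) (\<lambda>t. dir_deriv w f (?p s t))) has_vector_derivative
        integral (cbox 0 t) (\<lambda>t. dir_deriv v (dir_deriv w f) (?p 0 t))) (at 0 within UNIV)"
    proof (rule leibniz_rule_vector_derivative)
      fix s \<tau> :: real
      show "((\<lambda>s. dir_deriv w f (?p s \<tau>)) has_vector_derivative dir_deriv v (dir_deriv w f) (?p s \<tau>)) (at s within UNIV)"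
        using smooth_has_vector_derivative_line[OF sw, of "x + \<tau> *\<^sub>R w" v s UNIV] by (simp add: algebra_simps)
      show "(\<lambda>t. dir_deriv w f (?p s t)) integrable_on cbox 0 t"
        by (rule integrable_continuous) (intro cont sw continuous_intros)
    qed (auto intro!: cont2 svw)
    moreover have "integral (cbox 0 t) (\<lambda>t. dir_deriv w f (?p s t)) = f (?p s t) - f (?p s 0)" for s
    proof (rule integral_unique)
      show "((\<lambda>t. dir_deriv w f (?p s t)) has_integral f (?p s t) - f (?p s 0)) (cbox 0 t)"
        using fundamental_theorem_of_calculus[of 0 t "\<lambda>t. f (?p s t)" "\<lambda>t. dir_deriv w f (?p s t)"] t
          smooth_has_vector_derivative_line[OF f] by simp
    qed
    ultimately have "((\<lambda>s. f (?p s t) - f (?p s 0)) has_vector_derivative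
        integral (cbox 0 t) (\<lambda>t. dir_deriv v (dir_deriv w f) (?p 0 t))) (at 0)" by simp
    moreover have "((\<lambda>s. f (?p s t) - f (?p s 0)) has_vector_derivative
        dir_deriv v f (?p 0 t) - dir_deriv v f (?p 0 0)) (at 0)"
      using smooth_has_vector_derivative_line[OF f, of "x + t *\<^sub>R w" v 0 UNIV]
         smooth_has_vector_derivative_line[OF f, of x v 0 UNIV]
      by (intro has_vector_derivative_diff) (simp_all add: algebra_simps)
    ultimately show ?thesis using vector_derivative_unique_at by fastforce
  qed
  \<comment> \<open>The identity \<open>eq\<close> is available for \<open>t\<close> in
    \<open>{0..1}\<close> only, so both derivatives at 0 are one-sided; they agree because 0 is a
    limit point of the interval.\<close>
  have 1: "((\<lambda>t. dir_deriv v f (?p 0 t) - dir_deriv v f x) has_vector_derivative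
      dir_deriv v (dir_deriv w f) (?p 0 0)) (at 0 within {0..1})"
  proof (rule has_vector_derivative_transform)
    show "((\<lambda>t. integral {0..t} (\<lambda>t. dir_deriv v (dir_deriv w f) (?p 0 t))) has_vector_derivative
        dir_deriv v (dir_deriv w f) (?p 0 0)) (at 0 within {0..1})"
      by (rule integral_has_vector_derivative)
         (use cont[OF svw continuous_on_const[of _ 0] continuous_on_id] in auto)
    show "dir_deriv v f (?p 0 t) - dir_deriv v f x
        = integral {0..t} (\<lambda>t. dir_deriv v (dir_deriv w f) (?p 0 t))" if "t \<in> {0..1}" for t
      using eq[OF that] by (rule sym)
  qed simp
  have 2: "((\<lambda>t. dir_deriv v f (?p 0 t) - dir_deriv v f x) has_vector_derivative
      dir_deriv w (dir_deriv v f) x - 0) (at 0 within {0..1})"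
    using smooth_has_vector_derivative_line[OF sv, of x w 0 "{0..1}"]
    by (intro has_vector_derivative_diff has_vector_derivative_const) simp
  have "at (0::real) within {0..1} \<noteq> bot"
    by (simp add: trivial_limit_within islimpt_Icc)
  from vector_derivative_unique_within[OF this 1 2]
  show "dir_deriv v (dir_deriv w f) x = dir_deriv w (dir_deriv v f) x" by simp
qed

lemma iter_deriv_dir_deriv_commute:
  fixes f :: "'a::euclidean_space \<Rightarrow> 'b::banach"
  assumes "smooth f" "v \<in> Basis" "set vs \<subseteq> Basis"
  shows "iter_deriv vs (dir_deriv v f) = dir_deriv v (iter_deriv vs f)"
  using assms(3)
  by (induction vs) (use assms in \<open>auto intro!: dir_deriv_commute smooth_iter_deriv\<close>)

lemma iter_deriv_vanish:
  assumes "open U" "\<And>x. x \<in> U \<Longrightarrow> f x = 0" "x \<in> U"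
  shows "iter_deriv vs f x = 0"
  using assms(3)
proof (induction vs arbitrary: x)
  case (Cons v vs)
  have "((\<lambda>x. 0) has_derivative (\<lambda>x. 0)) (at x)" by simp
  then have "(iter_deriv vs f has_derivative (\<lambda>x. 0)) (at x)"
    by (rule has_derivative_transform_within_open[OF _ assms(1) Cons.prems]) (simp add: Cons)
  then show ?case by (simp add: dir_deriv_eq)
qed (use assms in auto)

section \<open>Test functions\<close>

lemma fun_support_subset:
  assumes "closed K"
  shows "fun_support \<phi> \<subseteq> K \<longleftrightarrow> (\<forall>x. x \<notin> K \<longrightarrow> \<phi> x = 0)"
  unfolding fun_support_def using closure_subset[of "{x. \<phi> x \<noteq> 0}"] closure_minimal[OF _ assms, of "{x. \<phi> x \<noteq> 0}"]
  by auto

lemma test_functionI: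
  assumes "smooth \<phi>" "compact K" "\<And>x. x \<notin> K \<Longrightarrow> \<phi> x = 0"
  shows "test_function \<phi>"
proof -
  have "fun_support \<phi> \<subseteq> K" using fun_support_subset[OF compact_imp_closed[OF assms(2)]] assms(3) by blast
  then have "compact (fun_support \<phi>)"
    by (metis assms(2) closed_closure compact_Int_closed fun_support_def inf.absorb_iff2)
  then show ?thesis using assms by (simp add: test_function_def)
qed

lemma test_functionE:
  assumes "test_function \<phi>"
  obtains K where "compact K" "\<And>x. x \<notin> K \<Longrightarrow> \<phi> x = 0"
  using assms fun_support_subset[of "fun_support \<phi>" \<phi>] compact_imp_closed
  unfolding test_function_def by blast

lemma test_function_smooth: "test_function \<phi> \<Longrightarrow> smooth \<phi>"
  by (simp add: test_function_def)

lemma iter_deriv_support: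
  assumes "closed K" "\<And>x. x \<notin> K \<Longrightarrow> \<phi> x = 0" "x \<notin> K"
  shows "iter_deriv vs \<phi> x = 0"
  by (rule iter_deriv_vanish[of "- K"]) (use assms in auto)

lemma test_function_iter_deriv:
  assumes "test_function \<phi>" "set vs \<subseteq> Basis"
  shows "test_function (iter_deriv vs \<phi>)"
proof -
  obtain K where K: "compact K" "\<And>x. x \<notin> K \<Longrightarrow> \<phi> x = 0" using test_functionE[OF assms(1)] by blast
  show ?thesis
    by (rule test_functionI[OF smooth_iter_deriv[OF test_function_smooth[OF assms(1)] assms(2)] K(1)])
       (use iter_deriv_support[OF compact_imp_closed] K in blast)
qed

lemma test_function_dir_deriv: "test_function \<phi> \<Longrightarrow> b \<in> Basis \<Longrightarrow> test_function (dir_deriv b \<phi>)"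
  using test_function_iter_deriv[of \<phi> "[b]"] by simp

lemma test_function_lincomb:
  assumes "test_function f" "test_function g"
  shows "test_function (\<lambda>x. a * f x + b * g x)"
proof -
  obtain K where K: "compact K" "\<And>x. x \<notin> K \<Longrightarrow> f x = 0" using test_functionE[OF assms(1)] by blast
  obtain L where L: "compact L" "\<And>x. x \<notin> L \<Longrightarrow> g x = 0" using test_functionE[OF assms(2)] by blast
  show ?thesis
    by (rule test_functionI[of _ "K \<union> L"])
       (use K L assms in \<open>auto intro: smooth_lincomb test_function_smooth\<close>)
qed

lemma test_function_bounded:
  assumes "test_function \<phi>"
  shows "bdd_above (range (\<lambda>x. cmod (\<phi> x)))"
proof -
  obtain K where K: "compact K" "\<And>x. x \<notin> K \<Longrightarrow> \<phi> x = 0" using test_functionE[OF assms(1)] by blast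
  have "compact (\<phi> ` K)" using K assms
    by (intro compact_continuous_image smooth_continuous_on test_function_smooth)
  then obtain B where "\<forall>x\<in>\<phi> ` K. cmod x \<le> B" using compact_imp_bounded bounded_iff by metis
  then have "cmod (\<phi> x) \<le> max B 0" for x using K(2)[of x] by (cases "x \<in> K") (auto simp: le_max_iff_disj)
  then show ?thesis by (intro bdd_aboveI2)
qed

section \<open>The seminorms that occur in the continuity clause of
  \<open>distribution\<close>\<close>

definition test_norm :: "nat \<Rightarrow> ('a::euclidean_space \<Rightarrow> complex) \<Rightarrow> real" where
  "test_norm N \<phi> = (\<Sum>vs | set vs \<subseteq> Basis \<and> length vs \<le> N. SUP x. cmod (iter_deriv vs \<phi> x))"

lemma finite_index_lists: "finite {vs. set vs \<subseteq> (Basis::'a::euclidean_space set) \<and> length vs \<le> N}"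
  using finite_lists_length_le[OF finite_Basis] .

lemma test_norm_le:
  fixes e :: real
  assumes "\<And>vs x. set vs \<subseteq> Basis \<Longrightarrow> length vs \<le> N \<Longrightarrow> cmod (iter_deriv vs \<phi> x) \<le> e"
  shows "test_norm N (\<phi> :: 'a::euclidean_space \<Rightarrow> complex)
    \<le> card {vs. set vs \<subseteq> (Basis::'a set) \<and> length vs \<le> N} * e"
proof -
  have "(SUP x. cmod (iter_deriv vs \<phi> x)) \<le> e" if "set vs \<subseteq> Basis \<and> length vs \<le> N" for vs
    using that assms by (intro cSUP_least) auto
  then show ?thesis unfolding test_norm_def
    by (intro sum_bounded_above) auto
qed

lemma SUP_iter_deriv_nonneg:
  assumes "test_function \<phi>" "set vs \<subseteq> Basis"
  shows "0 \<le> (SUP x. cmod (iter_deriv vs \<phi> x))"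
  by (rule cSUP_upper2[OF test_function_bounded[OF test_function_iter_deriv[OF assms]]]) auto

lemma test_norm_nonneg: "test_function \<phi> \<Longrightarrow> 0 \<le> test_norm N \<phi>"
  unfolding test_norm_def by (intro sum_nonneg) (auto intro: SUP_iter_deriv_nonneg)

lemma test_norm_mono: "test_function \<phi> \<Longrightarrow> M \<le> N \<Longrightarrow> test_norm M \<phi> \<le> test_norm N \<phi>"
  unfolding test_norm_def
  by (intro sum_mono2 finite_index_lists) (auto intro: SUP_iter_deriv_nonneg)

lemma norm_iter_deriv_le:
  assumes "test_function \<phi>" "set vs \<subseteq> Basis" "length vs \<le> N"
  shows "cmod (iter_deriv vs \<phi> x) \<le> test_norm N \<phi>"
proof -
  have "cmod (iter_deriv vs \<phi> x) \<le> (SUP x. cmod (iter_deriv vs \<phi> x))"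
    by (rule cSUP_upper[OF _ test_function_bounded[OF test_function_iter_deriv[OF assms(1,2)]]]) auto
  also have "\<dots> \<le> test_norm N \<phi>"
    unfolding test_norm_def using assms
    by (intro member_le_sum finite_index_lists) (auto intro: SUP_iter_deriv_nonneg)
  finally show ?thesis .
qed

lemma test_norm_scale:
  assumes "test_function \<phi>"
  shows "test_norm N (\<lambda>x. c * \<phi> x) = cmod c * test_norm N \<phi>"
proof -
  have "(SUP x. cmod (iter_deriv vs (\<lambda>x. c * \<phi> x) x)) = cmod c * (SUP x. cmod (iter_deriv vs \<phi> x))"
    if "set vs \<subseteq> Basis" for vs
  proof -
    have "iter_deriv vs (\<lambda>x. c * \<phi> x) = (\<lambda>x. c * iter_deriv vs \<phi> x)"
      using iter_deriv_lincomb[of \<phi> \<phi> vs c 0] assms that by (simp add: test_function_smooth)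
    then have "range (\<lambda>x. cmod (iter_deriv vs (\<lambda>x. c * \<phi> x) x)) = (*) (cmod c) ` range (\<lambda>x. cmod (iter_deriv vs \<phi> x))"
      by (simp add: norm_mult image_image)
    moreover have "continuous (at_left (SUP x. cmod (iter_deriv vs \<phi> x))) ((*) (cmod c))"
      by (intro continuous_intros)
    ultimately show ?thesis
      using continuous_at_Sup_mono[of "(*) (cmod c)" "range (\<lambda>x. cmod (iter_deriv vs \<phi> x))"]
        test_function_bounded[OF test_function_iter_deriv[OF assms that]]
      by (simp add: mono_def mult_left_mono)
  qed
  then show ?thesis unfolding test_norm_def by (simp add: sum_distrib_left)
qed

section \<open>Uniform boundedness for distributions\<close>

lemma distribution_lincomb:
  "distribution u \<Longrightarrow> test_function \<phi> \<Longrightarrow> test_function \<psi> \<Longrightarrow>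
    u (\<lambda>x. a * \<phi> x + b * \<psi> x) = a * u \<phi> + b * u \<psi>"
  unfolding distribution_def by blast

lemma distribution_scale:
  "distribution u \<Longrightarrow> test_function \<phi> \<Longrightarrow> u (\<lambda>x. a * \<phi> x) = a * u \<phi>"
  using distribution_lincomb[of u \<phi> \<phi> a 0] by simp

lemma distribution_diff:
  "distribution u \<Longrightarrow> test_function \<phi> \<Longrightarrow> test_function \<psi> \<Longrightarrow>
    u (\<lambda>x. \<phi> x - \<psi> x) = u \<phi> - u \<psi>"
  using distribution_lincomb[of u \<phi> \<psi> 1 "-1"] by simp

lemma test_function_scale: "test_function \<phi> \<Longrightarrow> test_function (\<lambda>x. a * \<phi> x)"
  using test_function_lincomb[of \<phi> \<phi> a 0] by simp

lemma test_function_diff: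
  "test_function \<phi> \<Longrightarrow> test_function \<psi> \<Longrightarrow> test_function (\<lambda>x. \<phi> x - \<psi> x)"
  using test_function_lincomb[of \<phi> \<psi> 1 "-1"] by simp

lemma iter_deriv_diff:
  fixes f g :: "'a::euclidean_space \<Rightarrow> complex"
  assumes "smooth f" "smooth g" "set vs \<subseteq> Basis"
  shows "iter_deriv vs (\<lambda>x. f x - g x) = (\<lambda>x. iter_deriv vs f x - iter_deriv vs g x)"
  using iter_deriv_lincomb[OF assms, of 1 "-1"] by simp

lemma iter_deriv_zero: "iter_deriv vs (\<lambda>x. 0) x = 0"
  by (rule iter_deriv_vanish[of UNIV]) auto

lemma test_function_zero: "test_function (\<lambda>x::'a::euclidean_space. 0)"
proof (rule test_functionI)
  have "iter_deriv vs (\<lambda>x. 0) = (\<lambda>x. 0 :: complex)" for vs :: "'a list"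
    using iter_deriv_zero by blast
  then show "smooth (\<lambda>x::'a. 0 :: complex)"
    unfolding smooth_def by simp
qed auto

lemma distribution_zero: "distribution u \<Longrightarrow> u (\<lambda>x. 0) = 0"
  using distribution_scale[of u "\<lambda>x. 0" 0] test_function_zero by auto

lemma
  assumes "finite A" "\<And>k. k \<in> A \<Longrightarrow> test_function (\<phi> k)"
  shows test_function_sum: "test_function (\<lambda>x. \<Sum>k\<in>A. \<phi> k x)"
    and iter_deriv_sum: "set vs \<subseteq> Basis \<Longrightarrow>
      iter_deriv vs (\<lambda>x. \<Sum>k\<in>A. \<phi> k x) = (\<lambda>x. \<Sum>k\<in>A. iter_deriv vs (\<phi> k) x)"
    and distribution_sum: "distribution u \<Longrightarrow> u (\<lambda>x. \<Sum>k\<in>A. \<phi> k x) = (\<Sum>k\<in>A. u (\<phi> k))"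
proof -
  have "test_function (\<lambda>x. \<Sum>k\<in>A. \<phi> k x) \<and>
    (set vs \<subseteq> Basis \<longrightarrow> iter_deriv vs (\<lambda>x. \<Sum>k\<in>A. \<phi> k x) = (\<lambda>x. \<Sum>k\<in>A. iter_deriv vs (\<phi> k) x)) \<and>
    (distribution u \<longrightarrow> u (\<lambda>x. \<Sum>k\<in>A. \<phi> k x) = (\<Sum>k\<in>A. u (\<phi> k)))"
    using assms
  proof (induction A rule: finite_induct)
    case empty
    then show ?case using test_function_zero distribution_zero iter_deriv_zero by auto
  next
    case (insert k A)
    have t: "test_function (\<phi> k)" "test_function (\<lambda>x. \<Sum>k\<in>A. \<phi> k x)" using insert by auto
    show ?case
      using insert test_function_lincomb[OF t, of 1 1] distribution_lincomb[OF _ t, of u 1 1]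
        iter_deriv_lincomb[OF t[THEN test_function_smooth], of vs 1 1] by auto
  qed
  then show "test_function (\<lambda>x. \<Sum>k\<in>A. \<phi> k x)"
    "set vs \<subseteq> Basis \<Longrightarrow> iter_deriv vs (\<lambda>x. \<Sum>k\<in>A. \<phi> k x) = (\<lambda>x. \<Sum>k\<in>A. iter_deriv vs (\<phi> k) x)"
    "distribution u \<Longrightarrow> u (\<lambda>x. \<Sum>k\<in>A. \<phi> k x) = (\<Sum>k\<in>A. u (\<phi> k))"
    by auto
qed

lemma distribution_bound:
  assumes "distribution u" "compact K"
  obtains C N where "C \<ge> 0"
    "\<And>\<phi>. test_function \<phi> \<Longrightarrow> (\<And>x. x \<notin> K \<Longrightarrow> \<phi> x = 0) \<Longrightarrow> cmod (u \<phi>) \<le> C * test_norm N \<phi>"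
proof -
  have "\<exists>C N. \<forall>\<phi>. test_function \<phi> \<and> fun_support \<phi> \<subseteq> K \<longrightarrow> cmod (u \<phi>) \<le> C * test_norm N \<phi>"
    using assms unfolding distribution_def test_norm_def by simp
  then obtain C N where
    CN: "\<And>\<phi>. test_function \<phi> \<Longrightarrow> fun_support \<phi> \<subseteq> K \<Longrightarrow> cmod (u \<phi>) \<le> C * test_norm N \<phi>"
    by blast
  have "cmod (u \<phi>) \<le> \<bar>C\<bar> * test_norm N \<phi>" if "test_function \<phi>" "\<And>x. x \<notin> K \<Longrightarrow> \<phi> x = 0" for \<phi>
  proof -
    have "cmod (u \<phi>) \<le> C * test_norm N \<phi>"
      using CN that fun_support_subset[OF compact_imp_closed[OF assms(2)]] by blast
    also have "\<dots> \<le> \<bar>C\<bar> * test_norm N \<phi>"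
      using test_norm_nonneg[OF that(1)] by (intro mult_right_mono) auto
    finally show ?thesis .
  qed
  then show ?thesis using that[of "\<bar>C\<bar>"] by auto
qed

text \<open>Stands in for the completeness of the space of test functions supported in
  \<open>K\<close>. Bounding the k-th term in the k-th seminorm controls every fixed derivative from
  some index on, so all differentiated series converge uniformly.\<close>

locale fast_series =
  fixes \<phi> :: "nat \<Rightarrow> 'a::euclidean_space \<Rightarrow> complex" and K :: "'a set"
  assumes test: "\<And>k. test_function (\<phi> k)"
    and K: "compact K" and supp: "\<And>k x. x \<notin> K \<Longrightarrow> \<phi> k x = 0"
    and small: "\<And>k. test_norm k (\<phi> k) \<le> (1 / 2) ^ k"
begin

definition S :: "'a list \<Rightarrow> 'a \<Rightarrow> complex" where
  "S vs x = (\<Sum>k. iter_deriv vs (\<phi> k) x)"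

text \<open>The bound \<open>small\<close> reaches derivatives of order \<open>n\<close> only from
  index \<open>n\<close> on; the finitely many earlier terms are bounded by their own
  seminorms.\<close>

definition majorant :: "nat \<Rightarrow> nat \<Rightarrow> real" where
  "majorant n k = (if k < n then test_norm n (\<phi> k) else (1 / 2) ^ k)"

lemma summable_majorant: "summable (majorant n)"
proof -
  have "summable (\<lambda>k. majorant n (k + n))"
    unfolding majorant_def by (simp add: power_add summable_geometric summable_mult2)
  then show ?thesis by (simp add: summable_iff_shift)
qed

lemma norm_le_majorant:
  assumes "set vs \<subseteq> Basis"
  shows "cmod (iter_deriv vs (\<phi> k) x) \<le> majorant (length vs) k"
proof (cases "k < length vs")
  case True
  then show ?thesis
    using norm_iter_deriv_le[OF test assms order_refl] by (simp add: majorant_def)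
next
  case False
  have "cmod (iter_deriv vs (\<phi> k) x) \<le> test_norm k (\<phi> k)"
    by (rule norm_iter_deriv_le[OF test assms]) (use False in auto)
  then show ?thesis using False small[of k] by (simp add: majorant_def)
qed

lemma uniform_limit_S:
  assumes "set vs \<subseteq> Basis"
  shows "uniform_limit UNIV (\<lambda>n x. \<Sum>k<n. iter_deriv vs (\<phi> k) x) (S vs) sequentially"
  unfolding S_def
  by (rule Weierstrass_m_test[OF _ summable_majorant]) (rule norm_le_majorant[OF assms])

lemma sums_S:
  assumes "set vs \<subseteq> Basis"
  shows "(\<lambda>k. iter_deriv vs (\<phi> k) x) sums S vs x"
  unfolding S_def
  by (intro summable_sums summable_comparison_test[OF _ summable_majorant[of "length vs"]]
        exI[of _ 0] allI impI norm_le_majorant[OF assms])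

lemma S_has_derivative:
  assumes vs: "set vs \<subseteq> Basis"
  shows "(S vs has_derivative (\<lambda>h. \<Sum>b\<in>Basis. (h \<bullet> b) *\<^sub>R S (b # vs) x)) (at x)"
proof -
  have bvs: "set (b # vs) \<subseteq> Basis" if "b \<in> Basis" for b using that vs by auto
  have "\<exists>g. \<forall>x\<in>UNIV. (\<lambda>n. iter_deriv vs (\<phi> n) x) sums g x \<and>
    (g has_derivative (\<lambda>h. \<Sum>b\<in>Basis. (h \<bullet> b) *\<^sub>R S (b # vs) x)) (at x within UNIV)"
  proof (rule has_derivative_series)
    fix n x
    have sm: "smooth (iter_deriv vs (\<phi> n))" using smooth_iter_deriv[OF test_function_smooth[OF test] vs] .
    show "(iter_deriv vs (\<phi> n) has_derivative (\<lambda>h. \<Sum>b\<in>Basis. (h \<bullet> b) *\<^sub>R iter_deriv (b # vs) (\<phi> n) x)) (at x within UNIV)"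
      unfolding iter_deriv.simps smooth_dir_deriv_expand[OF sm, of _ x, symmetric]
      by (simp add: smooth_has_derivative[OF sm])
  next
    fix e :: real assume e: "e > 0"
    \<comment> \<open>The total derivative is assembled from \<open>DIM('a)\<close> partial
      derivatives, each of which receives an equal share of \<open>e\<close>.\<close>
    define e' where "e' = e / DIM('a)"
    have e': "e' > 0" using e by (simp add: e'_def)
    have "\<forall>\<^sub>F n in sequentially. \<forall>b\<in>Basis. \<forall>x\<in>UNIV.
        dist (\<Sum>k<n. iter_deriv (b # vs) (\<phi> k) x) (S (b # vs) x) < e'"
      using uniform_limit_S[OF bvs] e' unfolding uniform_limit_iff
      by (intro eventually_ball_finite) auto
    then show "\<forall>\<^sub>F n in sequentially. \<forall>x\<in>UNIV. \<forall>h. norm ((\<Sum>i<n. \<Sum>b\<in>Basis. (h \<bullet> b) *\<^sub>R iter_deriv (b # vs) (\<phi> i) x)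
        - (\<Sum>b\<in>Basis. (h \<bullet> b) *\<^sub>R S (b # vs) x)) \<le> e * norm h"
    proof eventually_elim
      case (elim n)
      show ?case
      proof (intro ballI allI)
        fix x h :: 'a
        have "(\<Sum>i<n. \<Sum>b\<in>Basis. (h \<bullet> b) *\<^sub>R iter_deriv (b # vs) (\<phi> i) x) - (\<Sum>b\<in>Basis. (h \<bullet> b) *\<^sub>R S (b # vs) x)
          = (\<Sum>b\<in>Basis. (h \<bullet> b) *\<^sub>R ((\<Sum>i<n. iter_deriv (b # vs) (\<phi> i) x) - S (b # vs) x))"
          by (subst sum.swap) (simp add: scaleR_right_diff_distrib sum_subtractf scaleR_sum_right)
        also have "norm \<dots> \<le> (\<Sum>b\<in>(Basis::'a set). norm h * e')"
        proof (rule sum_norm_le)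
          fix b :: 'a assume b: "b \<in> Basis"
          have "norm ((\<Sum>i<n. iter_deriv (b # vs) (\<phi> i) x) - S (b # vs) x) \<le> e'"
            using elim b by (auto simp: dist_norm less_imp_le)
          then show "norm ((h \<bullet> b) *\<^sub>R ((\<Sum>i<n. iter_deriv (b # vs) (\<phi> i) x) - S (b # vs) x)) \<le> norm h * e'"
            using Basis_le_norm[OF b, of h] by (simp add: mult_mono)
        qed
        also have "\<dots> = e * norm h" by (simp add: e'_def)
        finally show "norm ((\<Sum>i<n. \<Sum>b\<in>Basis. (h \<bullet> b) *\<^sub>R iter_deriv (b # vs) (\<phi> i) x)
            - (\<Sum>b\<in>Basis. (h \<bullet> b) *\<^sub>R S (b # vs) x)) \<le> e * norm h" .
      qed
    qed
  qed (use sums_S[OF vs] in auto)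
  then obtain g where g: "\<And>x. (\<lambda>n. iter_deriv vs (\<phi> n) x) sums g x"
    "\<And>x. (g has_derivative (\<lambda>h. \<Sum>b\<in>Basis. (h \<bullet> b) *\<^sub>R S (b # vs) x)) (at x)" by auto
  have "g = S vs" using g(1) sums_S[OF vs] sums_unique2 by blast
  then show ?thesis using g(2) by simp
qed

lemma iter_deriv_S: "set vs \<subseteq> Basis \<Longrightarrow> iter_deriv vs (S []) = S vs"
proof (induction vs)
  case (Cons v vs)
  show ?case
  proof
    fix x
    have "dir_deriv v (S vs) x = (\<Sum>b\<in>Basis. (v \<bullet> b) *\<^sub>R S (b # vs) x)"
      by (rule dir_deriv_eq[OF S_has_derivative]) (use Cons.prems in auto)
    also have "\<dots> = (\<Sum>b\<in>Basis. if b = v then S (b # vs) x else 0)"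
      using Cons.prems by (intro sum.cong) (auto simp: inner_Basis)
    finally show "iter_deriv (v # vs) (S []) x = S (v # vs) x"
      using Cons by simp
  qed
qed simp

lemma S_support: "x \<notin> K \<Longrightarrow> S [] x = 0"
  by (simp add: S_def supp)

lemma test_function_S: "test_function (S [])"
proof (rule test_functionI[OF _ K S_support])
  show "smooth (S [])"
    unfolding smooth_def differentiable_on_def
    using S_has_derivative by (auto simp: iter_deriv_S intro: differentiableI)
qed

text \<open>The partial sums converge to \<open>S []\<close> in the one seminorm that bounds
  \<open>u\<close> on \<open>K\<close>, and on partial sums \<open>u\<close> is linear.\<close>

lemma distribution_sums:
  assumes u: "distribution u"
  shows "(\<lambda>k. u (\<phi> k)) sums u (S [])"
  unfolding sums_def
proof (rule tendstoI)
  fix e :: real assume e: "e > 0"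
  obtain C N where C: "C \<ge> 0" and CN: "\<And>\<phi>. test_function \<phi> \<Longrightarrow> (\<And>x. x \<notin> K \<Longrightarrow> \<phi> x = 0) \<Longrightarrow> cmod (u \<phi>) \<le> C * test_norm N \<phi>"
    using distribution_bound[OF u K] by blast
  define L where "L = {vs. set vs \<subseteq> (Basis::'a set) \<and> length vs \<le> N}"
  \<comment> \<open>The summands 1 keep the denominator positive, and the factor 2 leaves a margin
    for the strict inequality \<open>lt\<close>.\<close>
  define e' where "e' = e / (2 * (C + 1) * (real (card L) + 1))"
  have "0 < 2 * (C + 1) * (real (card L) + 1)" using C by (intro mult_pos_pos) auto
  then have e': "e' > 0" using e unfolding e'_def by (intro divide_pos_pos) auto
  have cancel: "a \<noteq> 0 \<Longrightarrow> l \<noteq> 0 \<Longrightarrow> a * (l * (e / (2 * a * l))) = e / 2" for a l :: real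
    by (simp add: field_simps)
  have "C + 1 \<noteq> 0" "real (card L) + 1 \<noteq> 0" using C by linarith+
  then have Ce': "(C + 1) * ((real (card L) + 1) * e') = e / 2"
    using cancel unfolding e'_def by blast
  have "C * (card L * e') \<le> (C + 1) * ((real (card L) + 1) * e')"
    using C e' by (intro mult_mono) auto
  also have "\<dots> < e" using e by (simp only: Ce')
  finally have lt: "C * (card L * e') < e" .
  have "\<forall>\<^sub>F n in sequentially. \<forall>vs\<in>L. \<forall>x\<in>UNIV. dist (\<Sum>k<n. iter_deriv vs (\<phi> k) x) (S vs x) < e'"
    using uniform_limit_S e' unfolding uniform_limit_iff
    by (intro eventually_ball_finite) (auto simp: L_def finite_index_lists)
  then show "\<forall>\<^sub>F n in sequentially. dist (\<Sum>k<n. u (\<phi> k)) (u (S [])) < e"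
  proof eventually_elim
    case (elim n)
    let ?P = "\<lambda>x. \<Sum>k<n. \<phi> k x"
    have P: "test_function ?P" using test by (intro test_function_sum) auto
    have "cmod (u (\<lambda>x. ?P x - S [] x)) \<le> C * test_norm N (\<lambda>x. ?P x - S [] x)"
      using P test_function_S supp S_support by (intro CN test_function_diff) auto
    also have "test_norm N (\<lambda>x. ?P x - S [] x) \<le> card L * e'"
      unfolding L_def
    proof (rule test_norm_le)
      fix vs x assume vs: "set vs \<subseteq> (Basis::'a set)" "length vs \<le> N"
      have "iter_deriv vs (\<lambda>x. ?P x - S [] x) x = (\<Sum>k<n. iter_deriv vs (\<phi> k) x) - S vs x"
        using test vs by (subst iter_deriv_diff)
          (auto intro!: test_function_smooth P test_function_S simp: iter_deriv_sum iter_deriv_S)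
      then show "cmod (iter_deriv vs (\<lambda>x. ?P x - S [] x) x) \<le> e'"
        using elim vs by (force simp: L_def dist_norm less_imp_le)
    qed
    then have "C * test_norm N (\<lambda>x. ?P x - S [] x) \<le> C * (card L * e')" using C by (rule mult_left_mono)
    also note lt
    finally show ?case
      unfolding distribution_diff[OF u P test_function_S]
      by (subst (asm) distribution_sum) (use u test in \<open>auto simp: dist_norm\<close>)
  qed
qed

end

text \<open>The Banach--Steinhaus theorem on \<open>\<D>\<^sub>K\<close>, by a gliding hump: if it fails, one builds a
  convergent series of test functions \<open>\<phi>\<^sub>k\<close> and members \<open>u i\<^sub>k\<close> of the family such that \<open>u i\<^sub>k \<phi>\<^sub>k\<close>
  dominates the contribution of all the other terms.\<close>
lemma distribution_uniform_bound:
  fixes u :: "'i \<Rightarrow> 'a::euclidean_space distr"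
  assumes u: "\<And>i. i \<in> I \<Longrightarrow> distribution (u i)" and K: "compact K"
    and bdd: "\<And>\<phi>. test_function \<phi> \<Longrightarrow> \<exists>B. \<forall>i\<in>I. cmod (u i \<phi>) \<le> B"
  obtains C N where "C \<ge> 0"
    "\<And>i \<phi>. i \<in> I \<Longrightarrow> test_function \<phi> \<Longrightarrow> (\<And>x. x \<notin> K \<Longrightarrow> \<phi> x = 0) \<Longrightarrow> cmod (u i \<phi>) \<le> C * test_norm N \<phi>"
proof (rule ccontr)
  note conclusion = that
  assume neg: "\<not> thesis"
  define D where "D = {\<phi>. test_function \<phi> \<and> (\<forall>x. x \<notin> K \<longrightarrow> \<phi> x = 0)}"
  have bad: "\<exists>i\<in>I. \<exists>\<phi>\<in>D. cmod (u i \<phi>) > C * test_norm N \<phi>" if "C \<ge> 0" for C N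
  proof (rule ccontr)
    assume "\<not> ?thesis"
    then have le: "\<forall>i\<in>I. \<forall>\<phi>\<in>D. cmod (u i \<phi>) \<le> C * test_norm N \<phi>"
      by (auto simp: not_less)
    have "thesis"
      by (rule conclusion[OF \<open>C \<ge> 0\<close>]) (use le in \<open>auto simp: D_def\<close>)
    with neg show False ..
  qed
  obtain B where B: "\<And>\<phi> i. test_function \<phi> \<Longrightarrow> i \<in> I \<Longrightarrow> cmod (u i \<phi>) \<le> B \<phi>"
    using bdd by metis
  \<comment> \<open>What the k-th choice must satisfy, given the earlier ones. Its function is small
    in the k-th seminorm, so that the series converges; it is almost invisible to the earlier
    functionals; and its own functional takes on it a value that exceeds \<open>k\<close> even after
    the contributions of all other terms are removed.\<close>
  define good where "good = (\<lambda>(f :: nat \<Rightarrow> 'i \<times> ('a \<Rightarrow> complex)) k r.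
     fst r \<in> I \<and> snd r \<in> D \<and> test_norm k (snd r) \<le> (1/2) ^ k \<and>
     (\<forall>j<k. cmod (u (fst (f j)) (snd r)) \<le> (1/2) ^ k) \<and>
     cmod (u (fst r) (snd r)) \<ge> real k + 2 + (\<Sum>j<k. B (snd (f j))))"
  have "\<exists>f. \<forall>k. good f k (f k)"
  \<comment> \<open>\<open>good\<close> consults \<open>f\<close> only below \<open>k\<close>, which
    makes the recursive choice legitimate.\<close>
  proof (rule dependent_wf_choice[of less_than])
    fix f g :: "nat \<Rightarrow> 'i \<times> ('a \<Rightarrow> complex)" and k r
    assume "\<And>z. (z, k) \<in> less_than \<Longrightarrow> f z = g z"
    then show "good f k r = good g k r" unfolding good_def by auto
  next
    fix k and f :: "nat \<Rightarrow> 'i \<times> ('a \<Rightarrow> complex)"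
    assume "\<And>y. (y, k) \<in> less_than \<Longrightarrow> good f y (f y)"
    then have prev: "fst (f j) \<in> I" "snd (f j) \<in> D" if "j < k" for j
      using that unfolding good_def by auto
    have "\<exists>C N. C \<ge> 0 \<and> (\<forall>\<phi>\<in>D. cmod (u (fst (f j)) \<phi>) \<le> C * test_norm N \<phi>)" if jk: "j < k" for j
    proof -
      obtain C N where "C \<ge> 0"
        "\<And>\<phi>. test_function \<phi> \<Longrightarrow> (\<And>x. x \<notin> K \<Longrightarrow> \<phi> x = 0) \<Longrightarrow> cmod (u (fst (f j)) \<phi>) \<le> C * test_norm N \<phi>"
        using distribution_bound[OF u[OF prev(1)[OF jk]] K] by blast
      then show ?thesis by (intro exI[of _ C] exI[of _ N]) (auto simp: D_def)
    qed
    then obtain c n where cn: "\<And>j. j < k \<Longrightarrow> c j \<ge> (0::real)"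
      "\<And>j \<phi>. j < k \<Longrightarrow> \<phi> \<in> D \<Longrightarrow> cmod (u (fst (f j)) \<phi>) \<le> c j * test_norm (n j) \<phi>"
      by metis
    \<comment> \<open>One seminorm and one constant that dominate the bounds of all earlier
      functionals and also the k-th seminorm itself; sums serve in place of maxima.\<close>
    define N where "N = k + (\<Sum>j<k. n j)"
    define C where "C = 1 + (\<Sum>j<k. c j)"
    define L where "L = max 1 (real k + 2 + (\<Sum>j<k. B (snd (f j))))"
    have C1: "C \<ge> 1" unfolding C_def using sum_nonneg[of "{..<k}" c] cn(1) by simp
    have L1: "L \<ge> 1" by (simp add: L_def)
    \<comment> \<open>\<open>L\<close> is the size that the k-th functional has to reach. The factor
      in front of the seminorm is such that rescaling \<psi> to \<open>cmod (u i \<phi>) = L\<close>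
      pushes \<open>C * test_norm N \<phi>\<close> below \<open>(1/2) ^ k\<close>.\<close>
    obtain i \<psi> where i: "i \<in> I" "\<psi> \<in> D" "cmod (u i \<psi>) > (L * C * 2 ^ k) * test_norm N \<psi>"
      using bad[of "L * C * 2 ^ k" N] C1 L1 by auto
    define \<alpha> where "\<alpha> = cmod (u i \<psi>)"
    have t\<psi>: "test_function \<psi>" using i(2) by (simp add: D_def)
    have "0 \<le> (L * C * 2 ^ k) * test_norm N \<psi>"
      using C1 L1 test_norm_nonneg[OF t\<psi>] by simp
    then have \<alpha>: "\<alpha> > 0" using i(3) unfolding \<alpha>_def by (rule le_less_trans)
    define \<phi> where "\<phi> = (\<lambda>x. of_real (L / \<alpha>) * \<psi> x)"
    have \<phi>D: "\<phi> \<in> D" using i(2) test_function_scale[OF t\<psi>] by (auto simp: D_def \<phi>_def simp del: of_real_divide)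
    then have t\<phi>: "test_function \<phi>" by (simp add: D_def)
    have "u i \<phi> = of_real (L / \<alpha>) * u i \<psi>"
      unfolding \<phi>_def by (rule distribution_scale[OF u[OF i(1)] t\<psi>])
    then have u\<phi>: "cmod (u i \<phi>) = L" using \<alpha> L1 by (simp add: norm_mult norm_divide \<alpha>_def)
    have "test_norm N \<phi> = L / \<alpha> * test_norm N \<psi>"
      unfolding \<phi>_def by (subst test_norm_scale[OF t\<psi>]) (use \<alpha> L1 in \<open>simp add: norm_divide\<close>)
    then have "\<alpha> * test_norm N \<phi> = L * test_norm N \<psi>" using \<alpha> by simp
    then have "(\<alpha> * test_norm N \<phi>) * (C * 2 ^ k) = (L * test_norm N \<psi>) * (C * 2 ^ k)" by (rule arg_cong)
    then have "\<alpha> * (C * test_norm N \<phi> * 2 ^ k) = L * C * 2 ^ k * test_norm N \<psi>"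
      by (simp only: ac_simps)
    also have "\<dots> \<le> \<alpha> * 1" using i(3) by (simp add: \<alpha>_def)
    finally have "\<alpha> * (C * test_norm N \<phi> * 2 ^ k) \<le> \<alpha> * 1" .
    then have "C * test_norm N \<phi> * 2 ^ k \<le> 1" using \<alpha> by (simp only: mult_le_cancel_left_pos)
    then have "C * test_norm N \<phi> \<le> (1/2) ^ k"
      by (simp add: field_simps power_one_over)
    then have small: "C' * test_norm m \<phi> \<le> (1/2) ^ k" if "0 \<le> C'" "C' \<le> C" "m \<le> N" for C' m
      using mult_mono[OF that(2) test_norm_mono[OF t\<phi> that(3)]] C1 test_norm_nonneg[OF t\<phi>, of m] by linarith
    have "good f k (i, \<phi>)"
      unfolding good_def fst_conv snd_conv
    proof (intro conjI allI impI)
      show "test_norm k \<phi> \<le> (1/2) ^ k" using small[of 1 k] C1 by (simp add: N_def)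
      fix j assume j: "j < k"
      have "c j \<le> C" unfolding C_def using j cn(1) member_le_sum[of j "{..<k}" c] by simp
      moreover have "n j \<le> N" unfolding N_def using j member_le_sum[of j "{..<k}" n] by simp
      ultimately have "c j * test_norm (n j) \<phi> \<le> (1/2) ^ k" using small cn(1)[OF j] by blast
      then show "cmod (u (fst (f j)) \<phi>) \<le> (1/2) ^ k" using cn(2)[OF j \<phi>D] by linarith
    next
      show "real k + 2 + (\<Sum>j<k. B (snd (f j))) \<le> cmod (u i \<phi>)" unfolding u\<phi> L_def by simp
    qed (use i \<phi>D in auto)
    then show "\<exists>r. good f k r" by blast
  qed simp
  then obtain f where f: "\<And>k. good f k (f k)" by blast
  define i where "i k = fst (f k)" for k
  define \<phi> where "\<phi> k = snd (f k)" for k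
  have i: "i k \<in> I" and \<phi>D: "\<phi> k \<in> D" and nrm: "test_norm k (\<phi> k) \<le> (1/2) ^ k"
    and before: "\<And>j. j < k \<Longrightarrow> cmod (u (i j) (\<phi> k)) \<le> (1/2) ^ k"
    and big: "cmod (u (i k) (\<phi> k)) \<ge> real k + 2 + (\<Sum>j<k. B (\<phi> j))" for k
    using f[of k] unfolding good_def i_def \<phi>_def by auto
  interpret fast_series \<phi> K
    using \<phi>D K nrm by unfold_locales (auto simp: D_def)
  \<comment> \<open>\<open>B (S [])\<close> bounds the whole family on the sum of the series. The
    k-th functional will exceed it: of the margin 2 in \<open>good\<close>, the terms after the k-th
    use up at most 1, and the terms before it are covered by the sum of the
    \<open>B (\<phi> j)\<close>.\<close>
  obtain k :: nat where k: "B (S []) < k" using reals_Archimedean2 by blast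
  have sums: "(\<lambda>m. u (i k) (\<phi> m)) sums u (i k) (S [])" by (rule distribution_sums[OF u[OF i]])
  then have "(\<lambda>m. u (i k) (\<phi> (m + Suc k))) sums (u (i k) (S []) - (\<Sum>m<Suc k. u (i k) (\<phi> m)))"
    by (subst sums_iff_shift) simp
  then have "norm (u (i k) (S []) - (\<Sum>m<Suc k. u (i k) (\<phi> m))) \<le> (\<Sum>m. (1/2) ^ Suc m)"
  proof (subst sums_unique, assumption, intro norm_suminf_le)
    fix m :: nat
    have "cmod (u (i k) (\<phi> (m + Suc k))) \<le> (1/2) ^ (m + Suc k)" by (rule before) simp
    also have "\<dots> \<le> (1/2) ^ Suc m" by (intro power_decreasing) auto
    finally show "cmod (u (i k) (\<phi> (m + Suc k))) \<le> (1/2) ^ Suc m" .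
  qed (use power_half_series sums_summable in blast)
  also have "(\<Sum>m. (1/2 :: real) ^ Suc m) = 1" using power_half_series sums_unique by metis
  finally have tail: "norm (u (i k) (S []) - (\<Sum>m<k. u (i k) (\<phi> m)) - u (i k) (\<phi> k)) \<le> 1"
    by (simp add: algebra_simps)
  have "norm (\<Sum>m<k. u (i k) (\<phi> m)) \<le> (\<Sum>m<k. B (\<phi> m))"
    by (intro sum_norm_le B i test)
  moreover have "norm (u (i k) (S [])) \<le> B (S [])" by (intro B i test_function_S)
  moreover have "norm (u (i k) (\<phi> k)) \<le> norm (u (i k) (S []) - (\<Sum>m<k. u (i k) (\<phi> m)) - u (i k) (\<phi> k))
      + norm (u (i k) (S [])) + norm (\<Sum>m<k. u (i k) (\<phi> m))"
    by norm
  ultimately show False using tail big[of k] k by linarith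
qed

section \<open>Families of test functions and of distributions\<close>

text \<open>Test functions depending on a parameter, with supports in one compact set as long as the
  parameter stays in a compact set. Joint compact support would exclude the translates
  \<open>\<psi> (x + p)\<close>, with \<open>p\<close> ranging over the whole space.\<close>

definition test_family :: "('a::euclidean_space \<times> 'p::euclidean_space \<Rightarrow> complex) \<Rightarrow> bool" where
  "test_family \<omega> \<longleftrightarrow> smooth \<omega> \<and>
    (\<forall>P. compact P \<longrightarrow> (\<exists>K. compact K \<and> (\<forall>p\<in>P. \<forall>x. x \<notin> K \<longrightarrow> \<omega> (x, p) = 0)))"

lemma test_family_smooth: "test_family \<omega> \<Longrightarrow> smooth \<omega>"
  by (simp add: test_family_def)

lemma test_familyE:
  assumes "test_family \<omega>" "compact P"
  obtains K where "compact K" "\<And>p x. p \<in> P \<Longrightarrow> x \<notin> K \<Longrightarrow> \<omega> (x, p) = 0"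
proof -
  have "\<exists>K. compact K \<and> (\<forall>p\<in>P. \<forall>x. x \<notin> K \<longrightarrow> \<omega> (x, p) = 0)"
    using assms by (simp add: test_family_def)
  then obtain K where "compact K" "\<forall>p\<in>P. \<forall>x. x \<notin> K \<longrightarrow> \<omega> (x, p) = 0" by blast
  then show ?thesis using that[of K] by simp
qed

lemma linear_inl: "linear (\<lambda>x::'a::euclidean_space. (x, 0 :: 'p::euclidean_space))"
  by (simp add: linear_iff)

lemma inl_Basis: "(\<lambda>x. (x, 0)) ` Basis \<subseteq> (Basis :: ('a::euclidean_space \<times> 'p::euclidean_space) set)"
  by (auto simp: Basis_prod_def)

lemma iter_deriv_slice:
  fixes \<omega> :: "'a::euclidean_space \<times> 'p::euclidean_space \<Rightarrow> complex"
  assumes "smooth \<omega>" "set vs \<subseteq> Basis"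
  shows "iter_deriv vs (\<lambda>x. \<omega> (x, p)) = (\<lambda>x. iter_deriv (map (\<lambda>x. (x, 0)) vs) \<omega> (x, p))"
  using iter_deriv_affine[OF assms(1) linear_inl inl_Basis assms(2), of "(0, p)"] by simp

lemma smooth_slice:
  fixes \<omega> :: "'a::euclidean_space \<times> 'p::euclidean_space \<Rightarrow> complex"
  assumes "smooth \<omega>"
  shows "smooth (\<lambda>x. \<omega> (x, p))"
  using smooth_affine[OF assms linear_inl inl_Basis, of "(0, p)"] by simp

lemma dir_deriv_slice:
  fixes \<omega> :: "'a::euclidean_space \<times> 'p::euclidean_space \<Rightarrow> complex"
  assumes "smooth \<omega>" "b \<in> Basis"
  shows "dir_deriv b (\<lambda>x. \<omega> (x, p)) = (\<lambda>x. dir_deriv (b, 0) \<omega> (x, p))"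
  using iter_deriv_slice[OF assms(1), of "[b]" p] assms(2) by simp

lemma test_function_slice:
  assumes "test_family \<omega>"
  shows "test_function (\<lambda>x. \<omega> (x, p))"
proof -
  obtain K where "compact K" "\<And>q x. q \<in> {p} \<Longrightarrow> x \<notin> K \<Longrightarrow> \<omega> (x, q) = 0"
    using test_familyE[OF assms, of "{p}"] by auto
  then show ?thesis using assms
    by (intro test_functionI[of _ K] smooth_slice test_family_smooth) auto
qed

lemma test_family_iter_deriv:
  fixes \<omega> :: "'a::euclidean_space \<times> 'p::euclidean_space \<Rightarrow> complex"
  assumes "test_family \<omega>" "set vs \<subseteq> Basis"
  shows "test_family (iter_deriv vs \<omega>)"
  unfolding test_family_def
proof (intro conjI allI impI)
  show "smooth (iter_deriv vs \<omega>)" using assms by (intro smooth_iter_deriv test_family_smooth)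
  fix P :: "'p set" assume P: "compact P"
  \<comment> \<open>That a derivative vanishes at \<open>(x, p)\<close> is deduced from the
    vanishing of \<omega> nearby, hence also for parameters slightly outside \<open>P\<close>; the
    unit ball provides this room.\<close>
  let ?P = "{x + y | x y. x \<in> P \<and> y \<in> cball 0 1}"
  have "compact ?P" using P by (intro compact_sums) auto
  then obtain K where K: "compact K" "\<And>p x. p \<in> ?P \<Longrightarrow> x \<notin> K \<Longrightarrow> \<omega> (x, p) = 0"
    using test_familyE[OF assms(1)] by blast
  have "iter_deriv vs \<omega> (x, p) = 0" if "p \<in> P" "x \<notin> K" for x p
  proof (rule iter_deriv_vanish[of "(- K) \<times> ball p 1"])
    show "open ((- K) \<times> ball p 1)" using compact_imp_closed[OF K(1)] by (intro open_Times) auto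
    fix z assume "z \<in> (- K) \<times> ball p 1"
    then obtain y q where z: "z = (y, q)" "y \<notin> K" "dist p q < 1" by auto
    have "q = p + (q - p)" "q - p \<in> cball 0 1" using z(3) by (auto simp: dist_norm norm_minus_commute)
    then have "q \<in> ?P" using that(1) by blast
    then show "\<omega> z = 0" using K(2) z by blast
  qed (use that in auto)
  then show "\<exists>K. compact K \<and> (\<forall>p\<in>P. \<forall>x. x \<notin> K \<longrightarrow> iter_deriv vs \<omega> (x, p) = 0)"
    using K(1) by blast
qed

lemma test_family_dir_deriv: "test_family \<omega> \<Longrightarrow> b \<in> Basis \<Longrightarrow> test_family (dir_deriv b \<omega>)"
  using test_family_iter_deriv[of \<omega> "[b]"] by simp

lemma test_function_test_family:
  fixes \<phi> :: "'a::euclidean_space \<times> 'p::euclidean_space \<Rightarrow> complex"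
  assumes "test_function \<phi>"
  shows "test_family \<phi>"
  unfolding test_family_def
proof (intro conjI allI impI)
  obtain K where K: "compact K" "\<And>x. x \<notin> K \<Longrightarrow> \<phi> x = 0" using test_functionE[OF assms] by blast
  have "compact (fst ` K)" using K(1) by (intro compact_continuous_image continuous_intros)
  moreover have "\<phi> (x, p) = 0" if "x \<notin> fst ` K" for x p
    using K(2)[of "(x, p)"] that by force
  ultimately show "\<exists>K. compact K \<and> (\<forall>p\<in>P. \<forall>x. x \<notin> K \<longrightarrow> \<phi> (x, p) = 0)" for P :: "'p set"
    by blast
qed (use assms test_function_smooth in auto)

lemma test_family_translates:
  fixes \<psi> :: "'a::euclidean_space \<Rightarrow> complex"
  assumes "test_function \<psi>"
  shows "test_family (\<lambda>(x, p). \<psi> (x + p))"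
  unfolding test_family_def
proof (intro conjI allI impI)
  have "linear (\<lambda>z::'a \<times> 'a. fst z + snd z)" by (auto simp: linear_iff algebra_simps)
  moreover have "(\<lambda>z::'a \<times> 'a. fst z + snd z) ` Basis \<subseteq> Basis" by (auto simp: Basis_prod_def)
  ultimately show "smooth (\<lambda>(x::'a, p). \<psi> (x + p))"
    using smooth_affine[OF test_function_smooth[OF assms], of "\<lambda>z. fst z + snd z" 0]
    by (simp add: case_prod_unfold)
  fix P :: "'a set" assume P: "compact P"
  obtain K where K: "compact K" "\<And>x. x \<notin> K \<Longrightarrow> \<psi> x = 0" using test_functionE[OF assms] by blast
  have "compact {x - y | x y. x \<in> K \<and> y \<in> P}" using K(1) P by (rule compact_differences)
  moreover have "\<psi> (x + p) = 0" if "p \<in> P" "x \<notin> {x - y | x y. x \<in> K \<and> y \<in> P}" for x p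
  proof (rule K(2))
    have "x = (x + p) - p" by simp
    then show "x + p \<notin> K" using that by blast
  qed
  ultimately show "\<exists>K. compact K \<and> (\<forall>p\<in>P. \<forall>x. x \<notin> K \<longrightarrow> (case (x, p) of (x, p) \<Rightarrow> \<psi> (x + p)) = 0)"
    by auto
qed

lemma test_family_uniformly_close:
  fixes \<omega> :: "'a::euclidean_space \<times> 'p::euclidean_space \<Rightarrow> complex"
  assumes "test_family \<omega>" "e > 0"
  shows "\<forall>\<^sub>F p in nhds p0. \<forall>x. cmod (\<omega> (x, p) - \<omega> (x, p0)) \<le> e"
proof -
  obtain K where K: "compact K" "\<And>p x. p \<in> cball p0 1 \<Longrightarrow> x \<notin> K \<Longrightarrow> \<omega> (x, p) = 0"
    using test_familyE[OF assms(1) compact_cball] by blast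
  have "uniformly_continuous_on (K \<times> cball p0 1) \<omega>"
    using K(1) assms(1) by (intro compact_uniformly_continuous compact_Times smooth_continuous_on test_family_smooth) auto
  then obtain d where d: "d > 0"
    "\<And>z z'. z \<in> K \<times> cball p0 1 \<Longrightarrow> z' \<in> K \<times> cball p0 1 \<Longrightarrow> dist z' z < d \<Longrightarrow> dist (\<omega> z') (\<omega> z) < e"
    unfolding uniformly_continuous_on_def using assms(2) by metis
  have "cmod (\<omega> (x, p) - \<omega> (x, p0)) \<le> e" if "dist p p0 < min d 1" for p x
  proof (cases "x \<in> K")
    case True
    then have "dist (\<omega> (x, p)) (\<omega> (x, p0)) < e"
      using that by (intro d(2)) (auto simp: dist_Pair_Pair dist_commute)
    then show ?thesis by (simp add: dist_norm)
  next
    case False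
    then show ?thesis using K(2)[of p x] K(2)[of p0 x] that assms(2) by (simp add: dist_commute)
  qed
  then show ?thesis unfolding eventually_nhds_metric using d(1)
    by (intro exI[of _ "min d 1"]) auto
qed

lemma test_family_test_norm_close:
  fixes \<omega> :: "'a::euclidean_space \<times> 'p::euclidean_space \<Rightarrow> complex"
  assumes \<omega>: "test_family \<omega>" and e: "e > 0"
  shows "\<forall>\<^sub>F p in nhds p0. test_norm N (\<lambda>x. \<omega> (x, p) - \<omega> (x, p0)) \<le> e"
proof -
  define L where "L = {vs. set vs \<subseteq> (Basis::'a set) \<and> length vs \<le> N}"
  define e' where "e' = e / (card L + 1)"
  have e': "e' > 0" using e by (simp add: e'_def add_nonneg_pos)
  have le: "card L * e' \<le> e" using e by (simp add: e'_def field_simps)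
  have "\<forall>\<^sub>F p in nhds p0. \<forall>vs\<in>L. \<forall>x. cmod (iter_deriv (map (\<lambda>x. (x, 0)) vs) \<omega> (x, p)
      - iter_deriv (map (\<lambda>x. (x, 0)) vs) \<omega> (x, p0)) \<le> e'"
  proof (intro eventually_ball_finite ballI)
    fix vs assume "vs \<in> L"
    then have "set (map (\<lambda>x. (x, 0)) vs) \<subseteq> (Basis :: ('a \<times> 'p) set)" using inl_Basis by (auto simp: L_def)
    then show "\<forall>\<^sub>F p in nhds p0. \<forall>x. cmod (iter_deriv (map (\<lambda>x. (x, 0)) vs) \<omega> (x, p)
      - iter_deriv (map (\<lambda>x. (x, 0)) vs) \<omega> (x, p0)) \<le> e'"
      by (intro test_family_uniformly_close test_family_iter_deriv \<omega> e')
  qed (simp add: L_def finite_index_lists)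
  then show ?thesis
  proof eventually_elim
    case (elim p)
    have "test_norm N (\<lambda>x. \<omega> (x, p) - \<omega> (x, p0)) \<le> card L * e'"
      unfolding L_def
    proof (rule test_norm_le)
      fix vs x assume vs: "set vs \<subseteq> (Basis::'a set)" "length vs \<le> N"
      show "cmod (iter_deriv vs (\<lambda>x. \<omega> (x, p) - \<omega> (x, p0)) x) \<le> e'"
        using elim vs unfolding iter_deriv_diff[OF smooth_slice smooth_slice, OF test_family_smooth[OF \<omega>] test_family_smooth[OF \<omega>] vs(1)]
          iter_deriv_slice[OF test_family_smooth[OF \<omega>] vs(1)] by (auto simp: L_def)
    qed
    then show ?case using le by linarith
  qed
qed

text \<open>The difference quotients converge in every seminorm: by the mean value inequality, the
  linearisation error of each spatial derivative is controlled by the oscillation of its parameter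
  derivative. Continuity of \<open>u\<close> on a common compact support then transfers the
  limit.\<close>

lemma distribution_has_vector_derivative:
  fixes \<omega> :: "'a::euclidean_space \<times> real \<Rightarrow> complex"
  assumes u: "distribution u" and \<omega>: "test_family \<omega>"
  shows "((\<lambda>s. u (\<lambda>x. \<omega> (x, s))) has_vector_derivative u (\<lambda>x. dir_deriv (0, 1) \<omega> (x, s))) (at s)"
  unfolding has_vector_derivative_def has_derivative_at_alt
proof (intro conjI allI impI)
  show "bounded_linear (\<lambda>x. x *\<^sub>R u (\<lambda>x. dir_deriv (0, 1) \<omega> (x, s)))"
    by (rule bounded_linear_scaleR_left)
  fix e :: real assume e: "e > 0"
  let ?D = "dir_deriv (0, 1) \<omega>"
  have b01: "(0, 1) \<in> (Basis :: ('a \<times> real) set)" by (simp add: Basis_prod_def)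
  have D: "test_family ?D" by (rule test_family_dir_deriv[OF \<omega> b01])
  obtain K where K: "compact K" "\<And>p x. p \<in> cball s 1 \<Longrightarrow> x \<notin> K \<Longrightarrow> \<omega> (x, p) = 0"
    using test_familyE[OF \<omega> compact_cball] by blast
  obtain K' where K': "compact K'" "\<And>p x. p \<in> cball s 1 \<Longrightarrow> x \<notin> K' \<Longrightarrow> ?D (x, p) = 0"
    using test_familyE[OF D compact_cball] by blast
  obtain C N where C: "C \<ge> 0" and CN: "\<And>\<phi>. test_function \<phi> \<Longrightarrow> (\<And>x. x \<notin> K \<union> K' \<Longrightarrow> \<phi> x = 0) \<Longrightarrow> cmod (u \<phi>) \<le> C * test_norm N \<phi>"
    using distribution_bound[OF u compact_Un[OF K(1) K'(1)]] by blast
  define L where "L = {vs. set vs \<subseteq> (Basis::'a set) \<and> length vs \<le> N}"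
  define e' where "e' = e / (C * card L + 1)"
  have pos: "C * card L + 1 > 0" using C by (simp add: add_nonneg_pos)
  then have e': "e' > 0" using e by (simp add: e'_def)
  have "(C * card L + 1) * e' = e" using pos by (simp add: e'_def)
  then have le: "C * (card L * e') \<le> e" using e' by (simp add: algebra_simps)
  let ?i = "map (\<lambda>x::'a. (x, 0::real))"
  have i: "set (?i vs) \<subseteq> Basis" if "vs \<in> L" for vs using that inl_Basis by (auto simp: L_def)
  have "\<forall>\<^sub>F p in nhds s. \<forall>vs\<in>L. \<forall>x. cmod (iter_deriv (?i vs) ?D (x, p) - iter_deriv (?i vs) ?D (x, s)) \<le> e'"
    using i by (intro eventually_ball_finite ballI test_family_uniformly_close test_family_iter_deriv D e')
       (simp add: L_def finite_index_lists)
  then obtain d where d: "d > 0" "\<And>p vs x. dist p s < d \<Longrightarrow> vs \<in> L \<Longrightarrow>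
      cmod (iter_deriv (?i vs) ?D (x, p) - iter_deriv (?i vs) ?D (x, s)) \<le> e'"
    unfolding eventually_nhds_metric by blast
  show "\<exists>d>0. \<forall>y. norm (y - s) < d \<longrightarrow>
      norm (u (\<lambda>x. \<omega> (x, y)) - u (\<lambda>x. \<omega> (x, s)) - (y - s) *\<^sub>R u (\<lambda>x. ?D (x, s))) \<le> e * norm (y - s)"
  proof (intro exI[of _ "min d 1"] conjI allI impI)
    fix y assume y: "norm (y - s) < min d 1"
    let ?f = "\<lambda>x. \<omega> (x, y) - \<omega> (x, s)" and ?c = "of_real (y - s) :: complex"
    let ?g = "\<lambda>x. 1 * ?f x + (- ?c) * ?D (x, s)"
    have tf: "test_function ?f" by (intro test_function_diff test_function_slice \<omega>)
    have tg: "test_function ?g" by (rule test_function_lincomb[OF tf test_function_slice[OF D]])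
    have "u ?g = 1 * u ?f + (- ?c) * u (\<lambda>x. ?D (x, s))"
      by (rule distribution_lincomb[OF u tf test_function_slice[OF D]])
    also have "\<dots> = u (\<lambda>x. \<omega> (x, y)) - u (\<lambda>x. \<omega> (x, s)) - (y - s) *\<^sub>R u (\<lambda>x. ?D (x, s))"
      by (simp add: distribution_diff[OF u test_function_slice[OF \<omega>] test_function_slice[OF \<omega>]]
          scaleR_conv_of_real algebra_simps)
    finally have ug: "u ?g = u (\<lambda>x. \<omega> (x, y)) - u (\<lambda>x. \<omega> (x, s)) - (y - s) *\<^sub>R u (\<lambda>x. ?D (x, s))" .
    have "test_norm N ?g \<le> card L * (e' * norm (y - s))"
      unfolding L_def
    proof (rule test_norm_le)
      fix vs x assume vs: "set vs \<subseteq> (Basis::'a set)" "length vs \<le> N"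
      then have vL: "vs \<in> L" by (simp add: L_def)
      let ?h = "iter_deriv (?i vs) \<omega>"
      have sh: "smooth ?h" by (intro smooth_iter_deriv test_family_smooth \<omega> i vL)
      have "iter_deriv vs ?g x = 1 * iter_deriv vs ?f x + (- ?c) * iter_deriv vs (\<lambda>x. ?D (x, s)) x"
        by (subst iter_deriv_lincomb) (auto intro!: test_function_smooth tf test_function_slice D vs)
      \<comment> \<open>Moving the parameter derivative outside the spatial ones reduces the
        estimate to a function \<open>?h (x, t)\<close> of \<open>t\<close> and its own
        derivative.\<close>
      also have "iter_deriv vs (\<lambda>x. ?D (x, s)) x = dir_deriv (0, 1) ?h (x, s)"
        using iter_deriv_slice[OF test_family_smooth[OF D] vs(1)]
          iter_deriv_dir_deriv_commute[OF test_family_smooth[OF \<omega>] b01 i[OF vL]] by simp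
      also have "iter_deriv vs ?f x = ?h (x, y) - ?h (x, s)"
        by (simp add: iter_deriv_diff[OF smooth_slice smooth_slice, OF test_family_smooth[OF \<omega>] test_family_smooth[OF \<omega>] vs(1)]
          iter_deriv_slice[OF test_family_smooth[OF \<omega>] vs(1)])
      finally have eq: "iter_deriv vs ?g x = ?h (x, y) - ?h (x, s) - (y - s) *\<^sub>R dir_deriv (0, 1) ?h (x, s)"
        by (simp add: scaleR_conv_of_real algebra_simps)
      have "norm (?h (x, y) - ?h (x, s) - (y - s) *\<^sub>R dir_deriv (0, 1) ?h (x, s)) \<le> norm (y - s) * e'"
      proof (rule vector_differentiable_bound_linearization)
        show "((\<lambda>t. ?h (x, t)) has_vector_derivative dir_deriv (0, 1) ?h (x, t)) (at t within closed_segment s y)" for t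
          using smooth_has_vector_derivative_line[OF sh, of "(x, 0)" "(0, 1)" t "closed_segment s y"] by simp
        show "norm (dir_deriv (0, 1) ?h (x, t) - dir_deriv (0, 1) ?h (x, s)) \<le> e'" if "t \<in> closed_segment s y" for t
        proof -
          have "\<bar>t - s\<bar> \<le> \<bar>s - y\<bar>" using dist_in_closed_segment[OF that] by (simp add: dist_real_def)
          moreover have "\<bar>y - s\<bar> < d" using y by simp
          ultimately have "dist t s < d" unfolding dist_real_def by linarith
          from d(2)[OF this vL, of x] show ?thesis
            by (simp add: iter_deriv_dir_deriv_commute[OF test_family_smooth[OF \<omega>] b01 i[OF vL]])
        qed
      qed auto
      then show "cmod (iter_deriv vs ?g x) \<le> e' * norm (y - s)" unfolding eq by (simp add: mult.commute)
    qed
    then have "C * test_norm N ?g \<le> C * (card L * (e' * norm (y - s)))" using C by (rule mult_left_mono)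
    also have "\<dots> = (C * (card L * e')) * norm (y - s)" by simp
    also have "\<dots> \<le> e * norm (y - s)" using le by (rule mult_right_mono) simp
    also have "cmod (u ?g) \<le> C * test_norm N ?g"
    proof (rule CN[OF tg])
      fix x assume "x \<notin> K \<union> K'"
      then show "?g x = 0" using K(2)[of y x] K(2)[of s x] K'(2)[of s x] y
        by (simp add: dist_real_def abs_minus_commute[of s y])
    qed
    ultimately show "norm (u (\<lambda>x. \<omega> (x, y)) - u (\<lambda>x. \<omega> (x, s)) - (y - s) *\<^sub>R u (\<lambda>x. ?D (x, s))) \<le> e * norm (y - s)"
      unfolding ug by linarith
  qed (use d in auto)
qed

text \<open>Weak continuity bounds \<open>F r \<phi>\<close> for each \<phi> over the compact set
  \<open>T\<close>; uniform boundedness then makes the order and the constant independent of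
  \<open>r\<close>.\<close>

lemma smooth_distr_family_bound:
  assumes F: "smooth_distr_family F" and K: "compact K" and T: "compact T"
  obtains C N where "C \<ge> 0"
    "\<And>r \<phi>. r \<in> T \<Longrightarrow> test_function \<phi> \<Longrightarrow> (\<And>x. x \<notin> K \<Longrightarrow> \<phi> x = 0) \<Longrightarrow> cmod (F r \<phi>) \<le> C * test_norm N \<phi>"
proof (rule distribution_uniform_bound[of T F K])
  show "\<exists>B. \<forall>i\<in>T. cmod (F i \<phi>) \<le> B" if "test_function \<phi>" for \<phi>
  proof -
    have "compact ((\<lambda>r. F r \<phi>) ` T)" using F that T unfolding smooth_distr_family_def
      by (intro compact_continuous_image smooth_continuous_on) auto
    then obtain B where "\<forall>x\<in>(\<lambda>r. F r \<phi>) ` T. cmod x \<le> B" using compact_imp_bounded bounded_iff by metis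
    then show ?thesis by auto
  qed
qed (use assms that in \<open>auto simp: smooth_distr_family_def\<close>)

text \<open>Weak continuity in \<open>r\<close> settles the case of a fixed test function. Moving
  \<open>p\<close> perturbs the test function by little in the seminorm, and the uniform bound makes
  this perturbation harmless for all nearby \<open>r\<close> at once.\<close>

lemma smooth_distr_family_continuous:
  fixes \<omega> :: "'a::euclidean_space \<times> 'p::euclidean_space \<Rightarrow> complex"
  assumes F: "smooth_distr_family F" and \<omega>: "test_family \<omega>"
  shows "continuous_on S (\<lambda>(r, p). F r (\<lambda>x. \<omega> (x, p)))"
proof -
  have "isCont (\<lambda>(r, p). F r (\<lambda>x. \<omega> (x, p))) (r0, p0)" for r0 p0
    unfolding isCont_def
  proof (rule tendsto_at_iff_tendsto_nhds[THEN iffD2], rule tendstoI)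
    fix e :: real assume e: "e > 0"
    obtain K where K: "compact K" "\<And>p x. p \<in> cball p0 1 \<Longrightarrow> x \<notin> K \<Longrightarrow> \<omega> (x, p) = 0"
      using test_familyE[OF \<omega> compact_cball] by blast
    obtain C N where C: "C \<ge> 0" and CN: "\<And>r \<phi>. r \<in> cball r0 1 \<Longrightarrow> test_function \<phi> \<Longrightarrow> (\<And>x. x \<notin> K \<Longrightarrow> \<phi> x = 0) \<Longrightarrow> cmod (F r \<phi>) \<le> C * test_norm N \<phi>"
      using smooth_distr_family_bound[OF F K(1) compact_cball] by blast
    have e': "e / (2 * (C + 1)) > 0" using e C by simp
    have le: "C * (e / (2 * (C + 1))) \<le> e / 2" using C e by (simp add: field_simps)
    have "\<forall>\<^sub>F p in nhds p0. test_norm N (\<lambda>x. \<omega> (x, p) - \<omega> (x, p0)) \<le> e / (2 * (C + 1))"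
      by (rule test_family_test_norm_close[OF \<omega> e'])
    moreover have "\<forall>\<^sub>F p in nhds p0. p \<in> cball p0 1"
      by (rule eventually_nhds_in_nhd) simp
    ultimately have ev1: "\<forall>\<^sub>F p in nhds p0. p \<in> cball p0 1 \<and> C * test_norm N (\<lambda>x. \<omega> (x, p) - \<omega> (x, p0)) \<le> e / 2"
    proof eventually_elim
      case (elim p)
      then show ?case using mult_left_mono[OF elim(1) C] le by linarith
    qed
    have "continuous_on UNIV (\<lambda>r. F r (\<lambda>x. \<omega> (x, p0)))"
      using F test_function_slice[OF \<omega>] unfolding smooth_distr_family_def
      by (intro smooth_continuous_on) simp
    then have "isCont (\<lambda>r. F r (\<lambda>x. \<omega> (x, p0))) r0"
      by (simp add: continuous_on_eq_continuous_at)
    then have "((\<lambda>r. F r (\<lambda>x. \<omega> (x, p0))) \<longlongrightarrow> F r0 (\<lambda>x. \<omega> (x, p0))) (nhds r0)"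
      by (simp add: isCont_def tendsto_nhds_iff)
    from tendstoD[OF this, of "e / 2"]
    have "\<forall>\<^sub>F r in nhds r0. dist (F r (\<lambda>x. \<omega> (x, p0))) (F r0 (\<lambda>x. \<omega> (x, p0))) < e / 2"
      using e by simp
    moreover have "\<forall>\<^sub>F r in nhds r0. r \<in> cball r0 1"
      by (rule eventually_nhds_in_nhd) simp
    ultimately have ev2: "\<forall>\<^sub>F r in nhds r0. r \<in> cball r0 1 \<and> dist (F r (\<lambda>x. \<omega> (x, p0))) (F r0 (\<lambda>x. \<omega> (x, p0))) < e / 2"
      by eventually_elim simp
    have "\<forall>\<^sub>F z in nhds (r0, p0). dist (F (fst z) (\<lambda>x. \<omega> (x, snd z))) (F r0 (\<lambda>x. \<omega> (x, p0))) < e"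
      unfolding nhds_prod
    proof (rule eventually_mono[OF eventually_prodI[OF ev2 ev1]], goal_cases)
      case (1 z)
      obtain r p where z: "z = (r, p)" by fastforce
      have "F r (\<lambda>x. \<omega> (x, p) - \<omega> (x, p0)) = F r (\<lambda>x. \<omega> (x, p)) - F r (\<lambda>x. \<omega> (x, p0))"
        using F by (intro distribution_diff test_function_slice \<omega>) (auto simp: smooth_distr_family_def)
      moreover have "cmod (F r (\<lambda>x. \<omega> (x, p) - \<omega> (x, p0))) \<le> C * test_norm N (\<lambda>x. \<omega> (x, p) - \<omega> (x, p0))"
        using 1 K(2) z by (intro CN test_function_diff test_function_slice \<omega>) auto
      ultimately have "dist (F r (\<lambda>x. \<omega> (x, p))) (F r (\<lambda>x. \<omega> (x, p0))) \<le> e / 2"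
        using 1 z by (simp add: dist_norm)
      moreover have "dist (F r (\<lambda>x. \<omega> (x, p0))) (F r0 (\<lambda>x. \<omega> (x, p0))) < e / 2" using 1 z by simp
      ultimately show ?case unfolding z fst_conv snd_conv by metric
    qed
    then show "\<forall>\<^sub>F z in nhds (r0, p0). dist (case z of (r, p) \<Rightarrow> F r (\<lambda>x. \<omega> (x, p))) (case (r0, p0) of (r, p) \<Rightarrow> F r (\<lambda>x. \<omega> (x, p))) < e"
      by (simp add: split_beta)
  qed
  then show ?thesis
    by (intro continuous_at_imp_continuous_on) auto
qed

section \<open>The fundamental solution of the wave equation\<close>

text \<open>Rescaling \<open>s\<close> to the fixed interval \<open>{0..1}\<close> turns the
  variable limit into a parameter of the integrand.\<close>

lemma integral_upto_continuous:
  fixes f :: "real \<Rightarrow> 'b::topological_space \<Rightarrow> 'c::banach"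
  assumes "continuous_on UNIV (\<lambda>(s, y). f s y)"
  shows "continuous_on {z. fst z \<ge> 0} (\<lambda>(t, y). integral {0..t} (\<lambda>s. f s y))"
proof -
  have "integral {0..t} (\<lambda>s. f s y) = t *\<^sub>R integral {0..1} (\<lambda>s. f (t * s) y)" if "t \<ge> 0" for t y
  proof (cases "t = 0")
    case False
    then have t: "t > 0" using that by simp
    have "continuous_on {0..t} (\<lambda>s. f s y)"
      using continuous_on_compose2[OF assms continuous_on_Pair[OF continuous_on_id continuous_on_const[of _ y]], of "{0..t}"]
      by simp
    then have "((\<lambda>s. f s y) has_integral integral {0..t} (\<lambda>s. f s y)) (cbox 0 t)"
      by (simp add: integrable_continuous_real integrable_integral)
    from has_integral_affinity'[OF this t, of 0]
    have "((\<lambda>s. f (t * s) y) has_integral integral {0..t} (\<lambda>s. f s y) /\<^sub>R t) {0..1}" using t by simp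
    then have "integral {0..1} (\<lambda>s. f (t * s) y) = integral {0..t} (\<lambda>s. f s y) /\<^sub>R t" by (rule integral_unique)
    then show ?thesis using t by simp
  qed simp
  note eq = this
  have "continuous_on UNIV (\<lambda>z. integral (cbox 0 1) (\<lambda>s. f (fst z * s) (snd z)))"
  proof (rule integral_continuous_on_param)
    show "continuous_on (UNIV \<times> cbox 0 1) (\<lambda>(z, s). f (fst z * s) (snd z))"
    proof -
      have "continuous_on (UNIV \<times> cbox 0 1) (\<lambda>z :: (real \<times> 'b) \<times> real. (fst (fst z) * snd z, snd (fst z)))"
        by (intro continuous_intros)
      from continuous_on_compose2[OF assms this] show ?thesis by (simp add: case_prod_unfold)
    qed
  qed
  then have "continuous_on {z. fst z \<ge> 0} (\<lambda>z. fst z *\<^sub>R integral {0..1} (\<lambda>s. f (fst z * s) (snd z)))"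
    by (auto intro!: continuous_intros intro: continuous_on_subset)
  then show ?thesis by (rule continuous_on_eq) (auto simp: eq)
qed

lemma test_function_translate:
  "test_function \<psi> \<Longrightarrow> test_function (\<lambda>y. \<psi> (y + x))"
  using test_function_slice[OF test_family_translates] by fastforce

lemma dir_deriv_translate:
  assumes "smooth \<psi>" "b \<in> Basis"
  shows "dir_deriv b (\<lambda>y. \<psi> (y + x)) = (\<lambda>y. dir_deriv b \<psi> (y + x))"
  using iter_deriv_affine[OF assms(1) linear_id, of "[b]" x] assms(2) by simp

text \<open>Regarding the motion along \<open>b\<close> as a one-parameter family turns a spatial
  derivative into a parameter derivative, to which \<open>distribution_has_vector_derivative\<close>
  applies.\<close>

lemma
  fixes \<psi> :: "'a::euclidean_space \<Rightarrow> complex"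
  assumes \<psi>: "test_function \<psi>" and b: "b \<in> Basis"
  shows test_family_line: "test_family (\<lambda>z. \<psi> (fst z + snd z *\<^sub>R b + x))" (is "test_family ?g")
    and dir_deriv_line: "dir_deriv (0, 1) (\<lambda>z. \<psi> (fst z + snd z *\<^sub>R b + x)) (y, s) = dir_deriv b \<psi> (y + s *\<^sub>R b + x)"
proof -
  define L where "L = (\<lambda>z::'a \<times> real. fst z + snd z *\<^sub>R b)"
  have L: "linear L" unfolding L_def by (auto simp: linear_iff algebra_simps)
  have LB: "L ` Basis \<subseteq> Basis" using b by (auto simp: L_def Basis_prod_def)
  have sm: "smooth ?g" using smooth_affine[OF test_function_smooth[OF \<psi>] L LB, of x] by (simp add: L_def)
  show "dir_deriv (0, 1) ?g (y, s) = dir_deriv b \<psi> (y + s *\<^sub>R b + x)"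
    using iter_deriv_affine[OF test_function_smooth[OF \<psi>] L LB, of "[(0, 1)]" x]
    by (simp add: L_def Basis_prod_def)
  show "test_family ?g"
    unfolding test_family_def
  proof (intro conjI allI impI sm)
    fix P :: "real set" assume "compact P"
    then have "compact ((\<lambda>s. s *\<^sub>R b + x) ` P)"
      by (intro compact_continuous_image continuous_intros)
    then obtain K where K: "compact K" "\<And>p y. p \<in> (\<lambda>s. s *\<^sub>R b + x) ` P \<Longrightarrow> y \<notin> K \<Longrightarrow> (\<lambda>(y, p). \<psi> (y + p)) (y, p) = 0"
      using test_familyE[OF test_family_translates[OF \<psi>]] by metis
    then show "\<exists>K. compact K \<and> (\<forall>s\<in>P. \<forall>y. y \<notin> K \<longrightarrow> \<psi> (fst (y, s) + snd (y, s) *\<^sub>R b + x) = 0)"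
      by (intro exI[of _ K]) (auto simp: add.assoc)
  qed
qed

section \<open>Classical solutions of the wave equation obtained from the distributional one\<close>

locale wave =
  fixes E :: "real \<Rightarrow> (real ^ 'n) distr"
  assumes E: "wave_fundamental_solution E"
begin

abbreviation "E' \<equiv> family_deriv E"

lemma E_family: "smooth_distr_family E"
  using E by (simp add: wave_fundamental_solution_def)

lemma E_distribution: "distribution (E r)"
  using E_family by (simp add: smooth_distr_family_def)

lemma E_0: "test_function \<psi> \<Longrightarrow> E 0 \<psi> = \<psi> 0"
  using E by (simp add: wave_fundamental_solution_def distr_eq_def dirac_def)

lemma E'_0: "test_function \<psi> \<Longrightarrow> E' 0 \<psi> = 0"
  using E by (simp add: wave_fundamental_solution_def distr_eq_def)

lemma E'_eq:
  assumes "test_function \<psi>"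
  shows "(\<lambda>r. E' r \<psi>) = dir_deriv 1 (\<lambda>r. E r \<psi>)" and "smooth (\<lambda>r. E' r \<psi>)"
    and "((\<lambda>r. E r \<psi>) has_vector_derivative E' r \<psi>) (at r within S)"
proof -
  have sm: "smooth (\<lambda>r. E r \<psi>)" using E_family assms by (simp add: smooth_distr_family_def)
  have D: "((\<lambda>r. E r \<psi>) has_vector_derivative dir_deriv 1 (\<lambda>r. E r \<psi>) r) (at r within S)" for r S
    using smooth_has_vector_derivative_line[OF sm, of 0 1 r S] by simp
  show eq: "(\<lambda>r. E' r \<psi>) = dir_deriv 1 (\<lambda>r. E r \<psi>)"
    using vector_derivative_at[OF D] by (auto simp: family_deriv_def)
  show "((\<lambda>r. E r \<psi>) has_vector_derivative E' r \<psi>) (at r within S)"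
    using D fun_cong[OF eq] by simp
  show "smooth (\<lambda>r. E' r \<psi>)" unfolding eq by (rule smooth_dir_deriv[OF sm]) simp
qed

lemma E'_has_vector_derivative:
  assumes "test_function \<psi>"
  shows "((\<lambda>r. E' r \<psi>) has_vector_derivative (\<Sum>b\<in>Basis. E r (dir_deriv b (dir_deriv b \<psi>)))) (at r within S)"
proof -
  have D: "((\<lambda>r. E' r \<psi>) has_vector_derivative dir_deriv 1 (\<lambda>r. E' r \<psi>) r) (at r within S)" for S
    using smooth_has_vector_derivative_line[OF E'_eq(2)[OF assms], of 0 1 r S] by simp
  have "dir_deriv 1 (\<lambda>r. E' r \<psi>) r = family_deriv E' r \<psi>"
    unfolding family_deriv_def[of E'] using vector_derivative_at[OF D] by simp
  also have "\<dots> = distr_laplacian (E r) \<psi>"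
    using E assms by (simp add: wave_fundamental_solution_def distr_eq_def)
  also have "\<dots> = (\<Sum>b\<in>Basis. E r (dir_deriv b (dir_deriv b \<psi>)))"
    by (simp add: distr_laplacian_def distr_deriv_def)
  finally show ?thesis using D by simp
qed

text \<open>\<open>E' r\<close> is a mere pointwise limit of distributions. Expressing it through
  the distributions \<open>E s\<close>, which have uniform seminorm bounds, is what makes
  \<open>w'\<close> jointly continuous and differentiable in space.\<close>

lemma E'_integral:
  assumes "test_function \<psi>" "r \<ge> 0"
  shows "E' r \<psi> = integral {0..r} (\<lambda>s. \<Sum>b\<in>Basis. E s (dir_deriv b (dir_deriv b \<psi>)))"
proof -
  have "((\<lambda>s. \<Sum>b\<in>Basis. E s (dir_deriv b (dir_deriv b \<psi>))) has_integral E' r \<psi> - E' 0 \<psi>) {0..r}"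
    by (rule fundamental_theorem_of_calculus[OF assms(2)]) (rule E'_has_vector_derivative[OF assms(1)])
  then show ?thesis using E'_0[OF assms(1)] by (simp add: integral_unique)
qed

text \<open>Up to a reflection in \<open>x\<close>, the convolution of \<open>E t\<close> with a
  test function: a classical solution of the wave equation with initial value \<psi> and initial
  velocity 0.\<close>

definition w :: "(real ^ 'n \<Rightarrow> complex) \<Rightarrow> real \<Rightarrow> real ^ 'n \<Rightarrow> complex" where
  "w \<psi> t x = E t (\<lambda>y. \<psi> (y + x))"

definition w' :: "(real ^ 'n \<Rightarrow> complex) \<Rightarrow> real \<Rightarrow> real ^ 'n \<Rightarrow> complex" where
  "w' \<psi> t x = E' t (\<lambda>y. \<psi> (y + x))"

abbreviation DD :: "real ^ 'n \<Rightarrow> (real ^ 'n \<Rightarrow> complex) \<Rightarrow> real ^ 'n \<Rightarrow> complex" where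
  "DD b \<psi> \<equiv> dir_deriv b (dir_deriv b \<psi>)"

lemma DD_translate:
  "test_function \<psi> \<Longrightarrow> b \<in> Basis \<Longrightarrow> DD b (\<lambda>y. \<psi> (y + x)) = (\<lambda>y. DD b \<psi> (y + x))"
  by (simp add: dir_deriv_translate test_function_smooth smooth_dir_deriv)

lemma test_function_DD: "test_function \<psi> \<Longrightarrow> b \<in> Basis \<Longrightarrow> test_function (DD b \<psi>)"
  by (intro test_function_dir_deriv)

lemma w_continuous:
  assumes "test_function \<psi>"
  shows "continuous_on S (\<lambda>(t, x). w \<psi> t x)"
  using smooth_distr_family_continuous[OF E_family test_family_translates[OF assms]]
  by (simp add: w_def)

lemma w'_integral:
  assumes "test_function \<psi>" "t \<ge> 0"
  shows "w' \<psi> t x = integral {0..t} (\<lambda>s. \<Sum>b\<in>Basis. w (DD b \<psi>) s x)"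
  unfolding w'_def w_def using E'_integral[OF test_function_translate[OF assms(1)] assms(2), of x]
  by (simp add: DD_translate[OF assms(1)])

lemma w_sum_continuous:
  assumes "test_function \<psi>"
  shows "continuous_on S (\<lambda>(t, x). \<Sum>b\<in>Basis. w (DD b \<psi>) t x)"
  unfolding case_prod_unfold
  using w_continuous[OF test_function_DD[OF assms]] by (intro continuous_on_sum) (simp add: case_prod_unfold)

lemma w'_continuous:
  assumes "test_function \<psi>"
  shows "continuous_on {z. fst z \<ge> 0} (\<lambda>(t, x). w' \<psi> t x)"
  by (rule continuous_on_eq[OF integral_upto_continuous[OF w_sum_continuous[OF assms]]])
     (auto simp: w'_integral[OF assms])

lemma w_has_vector_derivative_time:
  "test_function \<psi> \<Longrightarrow> ((\<lambda>t. w \<psi> t x) has_vector_derivative w' \<psi> t x) (at t within S)"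
  unfolding w_def w'_def by (intro E'_eq(3) test_function_translate)

lemma w'_has_vector_derivative_time:
  assumes "test_function \<psi>"
  shows "((\<lambda>t. w' \<psi> t x) has_vector_derivative (\<Sum>b\<in>Basis. w (DD b \<psi>) t x)) (at t within S)"
  unfolding w_def w'_def using E'_has_vector_derivative[OF test_function_translate[OF assms], of x]
  by (simp add: DD_translate[OF assms])

lemma w_has_vector_derivative_space:
  assumes "test_function \<psi>" "b \<in> Basis"
  shows "((\<lambda>h. w \<psi> t (x + h *\<^sub>R b)) has_vector_derivative w (dir_deriv b \<psi>) t (x + h *\<^sub>R b)) (at h)"
proof -
  have eq: "y + (x + h *\<^sub>R b) = y + h *\<^sub>R b + x" for y h by simp
  show ?thesis
    using distribution_has_vector_derivative[OF E_distribution[of t] test_family_line[OF assms, of x], of h]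
    by (simp only: w_def dir_deriv_line[OF assms] eq fst_conv snd_conv)
qed

text \<open>The derivative is taken under the time integral that represents \<open>w'\<close>.
  Differentiation along \<open>b\<close> commutes with each \<open>DD c\<close>, so the new integral
  represents \<open>w'\<close> for \<open>dir_deriv b \<psi>\<close>.\<close>

lemma w'_has_vector_derivative_space:
  assumes \<psi>: "test_function \<psi>" and b: "b \<in> Basis" and t: "t \<ge> 0"
  shows "((\<lambda>h. w' \<psi> t (x + h *\<^sub>R b)) has_vector_derivative w' (dir_deriv b \<psi>) t (x + h *\<^sub>R b)) (at h)"
proof -
  have db: "test_function (dir_deriv b \<psi>)" by (rule test_function_dir_deriv[OF \<psi> b])
  have comm: "dir_deriv b (DD c \<psi>) = DD c (dir_deriv b \<psi>)" if "c \<in> Basis" for c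
    using that b \<psi> by (simp add: dir_deriv_commute[of _ b c] test_function_smooth smooth_dir_deriv)
  have cont: "continuous_on S (\<lambda>z. \<Sum>c\<in>Basis. w (DD c \<phi>) (f z) (g z))"
    if "test_function \<phi>" "continuous_on S f" "continuous_on S g" for \<phi> f g and S :: "'z::topological_space set"
    using continuous_on_compose2[OF w_sum_continuous[OF that(1), of UNIV] continuous_on_Pair[OF that(2,3)]] by simp
  have "((\<lambda>h. integral (cbox 0 t) (\<lambda>s. \<Sum>c\<in>Basis. w (DD c \<psi>) s (x + h *\<^sub>R b))) has_vector_derivative
     integral (cbox 0 t) (\<lambda>s. \<Sum>c\<in>Basis. w (DD c (dir_deriv b \<psi>)) s (x + h *\<^sub>R b))) (at h within UNIV)"
  proof (rule leibniz_rule_vector_derivative)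
    show "((\<lambda>h. \<Sum>c\<in>Basis. w (DD c \<psi>) s (x + h *\<^sub>R b)) has_vector_derivative
      (\<Sum>c\<in>Basis. w (DD c (dir_deriv b \<psi>)) s (x + h *\<^sub>R b))) (at h within UNIV)" for h s
      using w_has_vector_derivative_space[OF test_function_DD[OF \<psi>] b]
      by (intro has_vector_derivative_sum) (simp add: comm[symmetric])
    show "(\<lambda>s. \<Sum>c\<in>Basis. w (DD c \<psi>) s (x + h *\<^sub>R b)) integrable_on cbox 0 t" for h
      by (intro integrable_continuous cont \<psi> continuous_intros)
    show "continuous_on (UNIV \<times> cbox 0 t) (\<lambda>(h, s). \<Sum>c\<in>Basis. w (DD c (dir_deriv b \<psi>)) s (x + h *\<^sub>R b))"
      unfolding case_prod_unfold by (intro cont db continuous_intros)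
  qed auto
  then show ?thesis by (simp add: w'_integral[OF \<psi> t] w'_integral[OF db t])
qed

end

section \<open>Finite speed of propagation\<close>

lemma has_integral_translate_UNIV:
  fixes g :: "'a::euclidean_space \<Rightarrow> real"
  assumes "continuous_on UNIV g" and g0: "\<And>x. x \<notin> cbox a b \<Longrightarrow> g x = 0"
  shows "((\<lambda>x. g (x + c)) has_integral integral (cbox a b) g) UNIV"
proof -
  have "(g has_integral integral (cbox a b) g) (cbox a b)"
    by (intro integrable_integral integrable_continuous continuous_on_subset[OF assms(1)]) auto
  from has_integral_affinity[OF this, of 1 c]
  have "((\<lambda>x. g (x + c)) has_integral integral (cbox a b) g) ((\<lambda>x. x - c) ` cbox a b)" by simp
  then show ?thesis
  proof (rule has_integral_on_superset)
    fix x assume "x \<notin> (\<lambda>x. x - c) ` cbox a b"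
    then have "x + c \<notin> cbox a b" by (metis add_diff_cancel_right' image_eqI)
    then show "g (x + c) = 0" by (rule g0)
  qed simp
qed

text \<open>Plays the part of the divergence theorem. By translation invariance the integral of
  \<open>g (x + h *\<^sub>R v)\<close> does not depend on \<open>h\<close>, while its derivative at
  \<open>h = 0\<close> is the integral of \<open>g'\<close>. The box from \<open>c\<close> to
  \<open>d\<close> has to contain the shifted supports for all \<open>h\<close> in
  \<open>{0..1}\<close>.\<close>

lemma integral_line_derivative_eq_0:
  fixes g g' :: "'a::euclidean_space \<Rightarrow> real"
  assumes g: "continuous_on UNIV g" and g': "continuous_on UNIV g'"
    and deriv: "\<And>x h. ((\<lambda>h. g (x + h *\<^sub>R v)) has_vector_derivative g' (x + h *\<^sub>R v)) (at h)"
    and g0: "\<And>x. x \<notin> cbox a b \<Longrightarrow> g x = 0"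
    and ab: "\<And>x h. h \<in> {0..1} \<Longrightarrow> x + h *\<^sub>R v \<in> cbox a b \<Longrightarrow> x \<in> cbox c d"
  shows "integral (cbox c d) g' = 0"
proof -
  have cont: "continuous_on S (\<lambda>z. f (p z + q z *\<^sub>R v))"
    if "continuous_on UNIV f" "continuous_on S p" "continuous_on S q" for f :: "'a \<Rightarrow> real" and p q and S :: "'z::topological_space set"
    by (rule continuous_on_compose2[OF that(1) continuous_on_add[OF that(2) continuous_on_scaleR[OF that(3) continuous_on_const]]]) simp
  have const: "integral (cbox c d) (\<lambda>x. g (x + h *\<^sub>R v)) = integral (cbox a b) g" if h: "h \<in> {0..1}" for h
  proof -
    have "((\<lambda>x. g (x + h *\<^sub>R v)) has_integral integral (cbox c d) (\<lambda>x. g (x + h *\<^sub>R v))) (cbox c d)"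
      by (intro integrable_integral integrable_continuous cont[OF g continuous_on_id continuous_on_const])
    then have "((\<lambda>x. g (x + h *\<^sub>R v)) has_integral integral (cbox c d) (\<lambda>x. g (x + h *\<^sub>R v))) UNIV"
    proof (rule has_integral_on_superset)
      fix x assume "x \<notin> cbox c d"
      then have "x + h *\<^sub>R v \<notin> cbox a b" using ab[OF h] by auto
      then show "g (x + h *\<^sub>R v) = 0" by (rule g0)
    qed simp
    from has_integral_unique[OF this has_integral_translate_UNIV[OF g g0]] show ?thesis .
  qed
  have "((\<lambda>h. integral (cbox c d) (\<lambda>x. g (x + h *\<^sub>R v))) has_vector_derivative
      integral (cbox c d) (\<lambda>x. g' (x + 0 *\<^sub>R v))) (at 0 within {0..1})"
  proof (rule leibniz_rule_vector_derivative)
    show "((\<lambda>h. g (x + h *\<^sub>R v)) has_vector_derivative g' (x + h *\<^sub>R v)) (at h within {0..1})" for x h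
      using deriv has_vector_derivative_at_within by blast
    show "(\<lambda>x. g (x + h *\<^sub>R v)) integrable_on cbox c d" for h
      by (intro integrable_continuous cont[OF g continuous_on_id continuous_on_const])
    show "continuous_on ({0..1} \<times> cbox c d) (\<lambda>(h, x). g' (x + h *\<^sub>R v))"
      unfolding case_prod_unfold by (rule cont[OF g' continuous_on_snd[OF continuous_on_id] continuous_on_fst[OF continuous_on_id]])
  qed auto
  then have "((\<lambda>h. integral (cbox c d) (\<lambda>x. g (x + h *\<^sub>R v))) has_vector_derivative
      integral (cbox c d) g') (at 0 within {0..1})"
    by simp
  then have 1: "((\<lambda>h. integral (cbox a b) g) has_vector_derivative integral (cbox c d) g') (at 0 within {0..1::real})"
    by (rule has_vector_derivative_transform[rotated 2]) (simp_all add: const)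
  have "at (0::real) within {0..1} \<noteq> bot" by (simp add: trivial_limit_within islimpt_Icc)
  from vector_derivative_unique_within[OF this 1 has_vector_derivative_const] show ?thesis .
qed

text \<open>Makes the weight of the energy estimate differentiable across the boundary of the cone,
  so that all integrals can run over one fixed box instead of shrinking balls.\<close>

lemma has_real_derivative_max_0_squared:
  "((\<lambda>z::real. (max 0 z)\<^sup>2) has_real_derivative 2 * max 0 z) (at z within S)"
proof -
  have "((\<lambda>z::real. (max 0 z)\<^sup>2) has_real_derivative 2 * max 0 z) (at z)"
  proof (cases z "0 :: real" rule: linorder_cases)
    case less
    have "((\<lambda>z::real. 0) has_real_derivative 2 * max 0 z) (at z)" using less by simp
    then show ?thesis
      by (rule has_field_derivative_transform_within_open[of _ _ _ "{..<0}"]) (use less in auto)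
  next
    case greater
    have "((\<lambda>z::real. z\<^sup>2) has_real_derivative 2 * max 0 z) (at z)"
      using greater by (auto intro!: derivative_eq_intros)
    then show ?thesis
      by (rule has_field_derivative_transform_within_open[of _ _ _ "{0<..}"]) (use greater in auto)
  next
    case equal
    have "((\<lambda>h. (max 0 h)\<^sup>2 / h) \<longlongrightarrow> (0::real)) (at 0)"
    proof (rule Lim_null_comparison[of _ "\<lambda>h. \<bar>h\<bar>"])
      show "\<forall>\<^sub>F h in at 0. norm ((max 0 h)\<^sup>2 / h) \<le> \<bar>h :: real\<bar>"
        by (rule always_eventually) (auto simp: max_def power2_eq_square abs_mult)
      show "((\<lambda>h::real. \<bar>h\<bar>) \<longlongrightarrow> 0) (at 0)" by (rule tendsto_eq_intros | simp)+
    qed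
    then show ?thesis using equal by (simp add: DERIV_def)
  qed
  then show ?thesis by (rule has_field_derivative_at_within)
qed

context wave
begin

text \<open>The energy inside the backward cone with apex \<open>(0, R)\<close>, made differentiable by a weight that
  vanishes to second order on its boundary, does not increase: the flux is controlled because
  \<open>\<nabla>weight = weight\<^sub>t \<cdot> x / (R - t)\<close> and \<open>|x| \<le> R - t\<close> where the weight is positive.\<close>
lemma E'_vanishes:
  assumes \<psi>: "test_function \<psi>" and \<psi>0: "\<And>x. norm x \<le> R \<Longrightarrow> \<psi> x = 0" and t: "0 \<le> t" "t < R"
  shows "E' t \<psi> = 0"
proof -
  have R: "R > 0" using t by simp
  define m where "m t x = max 0 ((R - t)\<^sup>2 - x \<bullet> x)" for t :: real and x :: "real ^ 'n"
  define W where "W t x = (m t x)\<^sup>2" for t x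
  \<comment> \<open>For times in \<open>{0..R}\<close> the weight vanishes outside the cube of
    half-side \<open>R\<close>; the extra 1 leaves room for the shifts by up to one basis vector in
    \<open>integral_line_derivative_eq_0\<close>.\<close>
  define B where "B = cbox (- (R + 1) *\<^sub>R One) ((R + 1) *\<^sub>R One :: real ^ 'n)"
  let ?D = "\<lambda>b. dir_deriv b \<psi>"
  let ?A = "\<lambda>t x. \<Sum>b\<in>Basis. w (DD b \<psi>) t x"
  define e where "e t x = w' \<psi> t x \<bullet> w' \<psi> t x + (\<Sum>b\<in>Basis. w (?D b) t x \<bullet> w (?D b) t x)" for t x
  define e' where "e' t x = 2 * (w' \<psi> t x \<bullet> ?A t x) + (\<Sum>b\<in>Basis. 2 * (w (?D b) t x \<bullet> w' (?D b) t x))" for t x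
  \<comment> \<open>The derivative along \<open>b\<close> of the weighted flux
    \<open>(w' \<psi> t x \<bullet> w (?D b) t x) * W t x\<close>; the factor
    \<open>- 4 * m t x * (x \<bullet> b)\<close> is that of the weight.\<close>
  define dv where "dv b t x = (w' (?D b) t x \<bullet> w (?D b) t x + w' \<psi> t x \<bullet> w (DD b \<psi>) t x) * W t x
     + (w' \<psi> t x \<bullet> w (?D b) t x) * (- 4 * m t x * (x \<bullet> b))" for b t x
  define I where "I t = integral B (\<lambda>x. e t x * W t x)" for t
  have tD: "test_function (?D b)" if "b \<in> Basis" for b by (rule test_function_dir_deriv[OF \<psi> that])
  have contw: "continuous_on S (\<lambda>z. w \<phi> (f z) (g z))"
    if "test_function \<phi>" "continuous_on S f" "continuous_on S g" for \<phi> f g and S :: "'z::topological_space set"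
    using continuous_on_compose2[OF w_continuous[OF that(1), of UNIV] continuous_on_Pair[OF that(2,3)]] by simp
  have contw': "continuous_on S (\<lambda>z. w' \<phi> (f z) (g z))"
    if "test_function \<phi>" "continuous_on S f" "continuous_on S g" "\<And>z. z \<in> S \<Longrightarrow> f z \<ge> 0" for \<phi> f g and S :: "'z::topological_space set"
  proof -
    have "(\<lambda>z. (f z, g z)) ` S \<subseteq> {z. 0 \<le> fst z}" using that(4) by auto
    from continuous_on_compose2[OF w'_continuous[OF that(1)] continuous_on_Pair[OF that(2,3)] this]
    show ?thesis by simp
  qed
  have contm: "continuous_on S (\<lambda>z. m (f z) (g z))"
    if "continuous_on S f" "continuous_on S g" for f g and S :: "'z::topological_space set"
    unfolding m_def by (intro continuous_intros that)
  note cont = contw contw' contm \<psi> tD test_function_DD continuous_intros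
  have eW_deriv: "((\<lambda>t. e t x * W t x) has_vector_derivative e' t x * W t x + e t x * (- 4 * m t x * (R - t))) (at t within S)" for t x S
  proof -
    have "((\<lambda>t. w' \<psi> t x \<bullet> w' \<psi> t x) has_vector_derivative w' \<psi> t x \<bullet> ?A t x + ?A t x \<bullet> w' \<psi> t x) (at t within S)"
      by (intro bounded_bilinear.has_vector_derivative[OF bounded_bilinear_inner] w'_has_vector_derivative_time \<psi>)
    moreover have "((\<lambda>t. w (?D b) t x \<bullet> w (?D b) t x) has_vector_derivative w (?D b) t x \<bullet> w' (?D b) t x + w' (?D b) t x \<bullet> w (?D b) t x) (at t within S)"
      if "b \<in> Basis" for b
      by (intro bounded_bilinear.has_vector_derivative[OF bounded_bilinear_inner] w_has_vector_derivative_time tD that)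
    ultimately have e: "((\<lambda>t. e t x) has_real_derivative e' t x) (at t within S)"
      unfolding e_def e'_def has_real_derivative_iff_has_vector_derivative
      by (intro has_vector_derivative_add has_vector_derivative_sum) (simp_all add: inner_commute)
    have "((\<lambda>t. (R - t)\<^sup>2 - x \<bullet> x) has_real_derivative - 2 * (R - t)) (at t within S)"
      by (auto intro!: derivative_eq_intros)
    from DERIV_chain2[OF has_real_derivative_max_0_squared this]
    have "((\<lambda>t. W t x) has_real_derivative - 4 * m t x * (R - t)) (at t within S)"
      by (simp add: W_def m_def algebra_simps)
    from DERIV_mult[OF e this] show ?thesis
      by (simp add: has_real_derivative_iff_has_vector_derivative algebra_simps)
  qed
  have I_deriv: "(I has_vector_derivative integral B (\<lambda>x. e' t x * W t x + e t x * (- 4 * m t x * (R - t)))) (at t within {0..R})"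
    if "t \<in> {0..R}" for t
    unfolding I_def B_def
  proof (rule leibniz_rule_vector_derivative[OF eW_deriv])
    show "(\<lambda>x. e t x * W t x) integrable_on cbox (- (R + 1) *\<^sub>R One) ((R + 1) *\<^sub>R One)" if "t \<in> {0..R}" for t
      unfolding e_def W_def using that by (intro integrable_continuous cont) auto
    show "continuous_on ({0..R} \<times> cbox (- (R + 1) *\<^sub>R One) ((R + 1) *\<^sub>R One))
        (\<lambda>(t, x). e' t x * W t x + e t x * (- 4 * m t x * (R - t)))"
      unfolding e'_def e_def W_def case_prod_unfold by (intro cont) auto
  qed (use that in auto)
  have div0: "integral B (dv b t) = 0" if b: "b \<in> Basis" and t: "t \<in> {0..R}" for b t
    unfolding B_def
  proof (rule integral_line_derivative_eq_0[where g = "\<lambda>x. (w' \<psi> t x \<bullet> w (?D b) t x) * W t x" and v = b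
        and a = "- R *\<^sub>R One" and b = "R *\<^sub>R One"])
    show "continuous_on UNIV (\<lambda>x. (w' \<psi> t x \<bullet> w (?D b) t x) * W t x)"
      unfolding W_def using t b by (intro cont) auto
    show "continuous_on UNIV (dv b t)"
      unfolding dv_def W_def using t b by (intro cont) auto
    show "((\<lambda>h. (w' \<psi> t (x + h *\<^sub>R b) \<bullet> w (?D b) t (x + h *\<^sub>R b)) * W t (x + h *\<^sub>R b)) has_vector_derivative
        dv b t (x + h *\<^sub>R b)) (at h)" for x h
    proof -
      have 1: "((\<lambda>h. w' \<psi> t (x + h *\<^sub>R b) \<bullet> w (?D b) t (x + h *\<^sub>R b)) has_real_derivative
          (w' \<psi> t (x + h *\<^sub>R b) \<bullet> w (DD b \<psi>) t (x + h *\<^sub>R b) + w' (?D b) t (x + h *\<^sub>R b) \<bullet> w (?D b) t (x + h *\<^sub>R b))) (at h)"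
        unfolding has_real_derivative_iff_has_vector_derivative
        using t b by (intro bounded_bilinear.has_vector_derivative[OF bounded_bilinear_inner]
          w'_has_vector_derivative_space w_has_vector_derivative_space \<psi> tD) auto
      have "((\<lambda>h. (R - t)\<^sup>2 - (x + h *\<^sub>R b) \<bullet> (x + h *\<^sub>R b)) has_real_derivative - 2 * ((x + h *\<^sub>R b) \<bullet> b)) (at h)"
      proof -
        have eq: "(x + h *\<^sub>R b) \<bullet> (x + h *\<^sub>R b) = x \<bullet> x + 2 * h * (x \<bullet> b) + h\<^sup>2 * (b \<bullet> b)" for h
          by (simp add: inner_add_left inner_add_right inner_commute power2_eq_square)
        show ?thesis unfolding eq
          by (auto intro!: derivative_eq_intros simp: inner_add_left)
      qed
      from DERIV_chain2[OF has_real_derivative_max_0_squared this]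
      have "((\<lambda>h. W t (x + h *\<^sub>R b)) has_real_derivative - 4 * m t (x + h *\<^sub>R b) * ((x + h *\<^sub>R b) \<bullet> b)) (at h)"
        by (simp add: W_def m_def algebra_simps)
      from DERIV_mult[OF 1 this] show ?thesis
        by (simp add: has_real_derivative_iff_has_vector_derivative dv_def algebra_simps)
    qed
    show "w' \<psi> t x \<bullet> w (?D b) t x * W t x = 0" if "x \<notin> cbox (- R *\<^sub>R One) (R *\<^sub>R One)" for x
    proof -
      have "\<not> norm x \<le> R"
        using that Basis_le_norm[of _ x] by (auto simp: mem_box abs_le_iff) (smt (verit))+
      then have "R\<^sup>2 < (norm x)\<^sup>2" using R by (intro power_strict_mono) auto
      moreover have "(R - t)\<^sup>2 \<le> R\<^sup>2" using t by (intro power_mono) auto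
      ultimately show ?thesis by (simp add: W_def m_def power2_norm_eq_inner)
    qed
    show "x \<in> cbox (- (R + 1) *\<^sub>R One) ((R + 1) *\<^sub>R One)"
      if "h \<in> {0..1}" "x + h *\<^sub>R b \<in> cbox (- R *\<^sub>R One) (R *\<^sub>R One)" for x h
      unfolding mem_box
    proof (intro ballI)
      fix i :: "real ^ 'n" assume i: "i \<in> Basis"
      have "b \<bullet> i \<in> {0..1}" using b i by (auto simp: inner_Basis)
      then have "h * (b \<bullet> i) \<in> {0..1}" using that(1) by (auto intro: mult_le_one)
      moreover have "- R \<le> x \<bullet> i + h * (b \<bullet> i)" "x \<bullet> i + h * (b \<bullet> i) \<le> R"
        using that(2) i by (auto simp: mem_box inner_add_left)
      ultimately show "(- (R + 1) *\<^sub>R One) \<bullet> i \<le> x \<bullet> i \<and> x \<bullet> i \<le> ((R + 1) *\<^sub>R One) \<bullet> i"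
        using i by auto
    qed
  qed
  have decr: "integral B (\<lambda>x. e' t x * W t x + e t x * (- 4 * m t x * (R - t))) \<le> 0" if t: "t \<in> {0..R}" for t
  proof -
    let ?rest = "\<lambda>x. 4 * m t x * (2 * (\<Sum>b\<in>Basis. (w' \<psi> t x \<bullet> w (?D b) t x) * (x \<bullet> b)) - (R - t) * e t x)"
    \<comment> \<open>The time derivative of the weighted energy density is a divergence plus a
      remainder in which only derivatives of the weight occur; the wave equation enters through
      \<open>?A\<close>.\<close>
    have eq: "e' t x * W t x + e t x * (- 4 * m t x * (R - t)) = 2 * (\<Sum>b\<in>Basis. dv b t x) + ?rest x" for x
      unfolding e'_def dv_def
      by (simp add: sum.distrib inner_sum_right sum_distrib_left sum_distrib_right sum_negf algebra_simps inner_commute)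
         (simp add: sum.distrib sum_subtractf)
    have rest: "?rest x \<le> 0" for x
    proof (cases "m t x = 0")
      case False
      then have mx: "m t x > 0" "x \<bullet> x < (R - t)\<^sup>2" by (auto simp: m_def max_def split: if_splits)
      define \<rho> where "\<rho> = R - t"
      have "\<rho> \<noteq> 0" using le_less_trans[OF inner_ge_zero mx(2)] by (auto simp: \<rho>_def)
      then have \<rho>: "\<rho> > 0" using t by (simp add: \<rho>_def)
      \<comment> \<open>A Cauchy-Schwarz estimate of the flux as a completed square. Multiplying
        through by \<rho> allows the coefficient \<open>x \<bullet> x\<close> to be replaced by the
        larger \<open>\<rho>\<^sup>2\<close>.\<close>
      have "0 \<le> (\<Sum>b\<in>Basis. (\<rho> *\<^sub>R w (?D b) t x - (x \<bullet> b) *\<^sub>R w' \<psi> t x) \<bullet> (\<rho> *\<^sub>R w (?D b) t x - (x \<bullet> b) *\<^sub>R w' \<psi> t x))"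
        by (intro sum_nonneg) simp
      also have "\<dots> = \<rho>\<^sup>2 * (\<Sum>b\<in>Basis. w (?D b) t x \<bullet> w (?D b) t x)
          - 2 * \<rho> * (\<Sum>b\<in>Basis. (w' \<psi> t x \<bullet> w (?D b) t x) * (x \<bullet> b)) + (\<Sum>b\<in>Basis. (x \<bullet> b) * (x \<bullet> b)) * (w' \<psi> t x \<bullet> w' \<psi> t x)"
        by (simp add: inner_diff_left inner_diff_right sum.distrib sum_subtractf sum_distrib_left sum_distrib_right
            power2_eq_square algebra_simps inner_commute)
      also have "(\<Sum>b\<in>Basis. (x \<bullet> b) * (x \<bullet> b)) = x \<bullet> x" by (rule euclidean_inner[symmetric])
      also have "(x \<bullet> x) * (w' \<psi> t x \<bullet> w' \<psi> t x) \<le> \<rho>\<^sup>2 * (w' \<psi> t x \<bullet> w' \<psi> t x)"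
        using mx(2) by (intro mult_right_mono) (auto simp: \<rho>_def)
      finally have "\<rho> * (2 * (\<Sum>b\<in>Basis. (w' \<psi> t x \<bullet> w (?D b) t x) * (x \<bullet> b)) - \<rho> * e t x) \<le> 0"
        by (simp add: e_def power2_eq_square algebra_simps)
      then have "2 * (\<Sum>b\<in>Basis. (w' \<psi> t x \<bullet> w (?D b) t x) * (x \<bullet> b)) - \<rho> * e t x \<le> 0"
        using \<rho> by (simp add: mult_le_0_iff)
      then show ?thesis using mx(1) unfolding \<rho>_def by (intro mult_nonneg_nonpos) auto
    qed simp
    have "continuous_on B (dv b t)" if "b \<in> Basis" for b
      unfolding dv_def W_def using t that by (intro cont) auto
    then have int: "dv b t integrable_on B" if "b \<in> Basis" for b
      using that unfolding B_def by (intro integrable_continuous)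
    have "continuous_on B ?rest" unfolding e_def using t by (intro cont) auto
    then have intr: "?rest integrable_on B" unfolding B_def by (intro integrable_continuous)
    have "integral B (\<lambda>x. 2 * (\<Sum>b\<in>Basis. dv b t x) + ?rest x)
       = 2 * (\<Sum>b\<in>Basis. integral B (dv b t)) + integral B ?rest"
      using int intr by (subst integral_add) (auto intro!: integrable_on_cmult_left integrable_sum simp: integral_sum)
    also have "\<dots> = integral B ?rest" using div0 t by simp
    also have "\<dots> \<le> integral B (\<lambda>x. 0)" by (intro integral_le intr rest) (auto simp: B_def)
    finally show ?thesis unfolding eq by simp
  qed
  \<comment> \<open>At time 0 the weight is nonzero only in the open ball of radius
    \<open>R\<close>; there \<psi> vanishes, and with it all its derivatives.\<close>
  have eW0: "e 0 x * W 0 x = 0" for x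
  proof (cases "norm x < R")
    case True
    have "dir_deriv b \<psi> x = 0" if "b \<in> Basis" for b
      using iter_deriv_vanish[of "ball 0 R" \<psi> x "[b]"] \<psi>0 True by auto
    then have "w (?D b) 0 x = 0" if "b \<in> Basis" for b
      unfolding w_def using that by (simp add: E_0 test_function_translate tD)
    moreover have "w' \<psi> 0 x = 0" unfolding w'_def by (simp add: E'_0 test_function_translate \<psi>)
    ultimately show ?thesis by (simp add: e_def)
  next
    case False
    then have "R\<^sup>2 \<le> (norm x)\<^sup>2" using R by (intro power_mono) auto
    then show ?thesis by (simp add: W_def m_def power2_norm_eq_inner)
  qed
  have I0: "I 0 = 0" by (simp only: I_def eW0 integral_0)
  have I_le: "I t \<le> 0"
  proof (cases "t = 0")
    case False
    then have "0 < t" using t by simp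
    then obtain s where s: "s \<in> {0<..<t}" "I t - I 0 = (t - 0) *\<^sub>R integral B (\<lambda>x. e' s x * W s x + e s x * (- 4 * m s x * (R - s)))"
      using mvt_simple[of 0 t I "\<lambda>s h. h *\<^sub>R integral B (\<lambda>x. e' s x * W s x + e s x * (- 4 * m s x * (R - s)))"]
        I_deriv[unfolded has_vector_derivative_def] has_derivative_subset[where s = "{0..R}" and t = "{0..t}"] t by force
    then show ?thesis using decr[of s] t I0 by (simp add: mult_le_0_iff)
  qed (simp add: I0)
  have eWnn: "e t x * W t x \<ge> 0" for x
    unfolding e_def W_def by (intro mult_nonneg_nonneg add_nonneg_nonneg sum_nonneg) auto
  have "continuous_on B (\<lambda>x. e t x * W t x)"
    unfolding e_def W_def using t by (intro cont) auto
  moreover have "I t \<ge> 0"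
    unfolding I_def by (rule integral_nonneg[OF _ eWnn]) (use calculation in \<open>simp add: B_def integrable_continuous\<close>)
  moreover have "box (- (R + 1) *\<^sub>R One) ((R + 1) *\<^sub>R One :: real ^ 'n) \<noteq> {}"
    using R by (simp add: box_ne_empty)
  moreover have "(0 :: real ^ 'n) \<in> B" using R by (simp add: B_def mem_box)
  \<comment> \<open>A continuous nonnegative function with integral 0 vanishes everywhere. Only the
    centre is needed: the weight is positive there for \<open>t < R\<close>, and
    \<open>w' \<psi> t 0\<close> is \<open>E' t \<psi>\<close>.\<close>
  ultimately have "e t 0 * W t 0 = 0"
    using integral_cbox_eq_0_iff[of "- (R + 1) *\<^sub>R One" "(R + 1) *\<^sub>R One" "\<lambda>x. e t x * W t x"] I_le eWnn
    unfolding I_def B_def by force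
  moreover have "W t 0 \<noteq> 0" using t by (simp add: W_def m_def)
  ultimately have "e t 0 = 0" by simp
  moreover have "w' \<psi> t 0 \<bullet> w' \<psi> t 0 \<le> e t 0" unfolding e_def by (simp add: sum_nonneg)
  ultimately have "w' \<psi> t 0 \<bullet> w' \<psi> t 0 = 0" using inner_ge_zero[of "w' \<psi> t 0"] by linarith
  then show ?thesis by (simp add: w'_def)
qed

text \<open>\<open>E r \<psi>\<close> starts from \<open>\<psi> 0 = 0\<close> and has zero
  derivative before time \<open>R\<close>. The energy argument fails at \<open>R\<close> itself,
  where the cone has shrunk to its apex; continuity in \<open>r\<close> supplies this endpoint,
  which the closed light cone requires.\<close>

lemma finite_propagation:
  assumes \<psi>: "test_function \<psi>" and \<psi>0: "\<And>x. norm x \<le> R \<Longrightarrow> \<psi> x = 0" and r: "0 \<le> r" "r \<le> R"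
  shows "E r \<psi> = 0"
proof (cases "R = 0")
  case True
  then show ?thesis using r \<psi>0[of 0] by (simp add: E_0[OF \<psi>])
next
  case False
  then have "R > 0" using r by simp
  have "E r \<psi> = 0" if "r \<in> {0..R}" for r
  proof (rule has_derivative_zero_unique_strong_interval[of "{R}" 0 R "\<lambda>r. E r \<psi>" 0 r])
    show "continuous_on {0..R} (\<lambda>r. E r \<psi>)"
      using E_family \<psi> by (intro smooth_continuous_on) (simp add: smooth_distr_family_def)
    show "E 0 \<psi> = 0" using \<psi>0[of 0] \<open>R > 0\<close> by (simp add: E_0[OF \<psi>])
    show "((\<lambda>r. E r \<psi>) has_derivative (\<lambda>h. 0)) (at x within {0..R})" if "x \<in> {0..R} - {R}" for x
    proof -
      have "E' x \<psi> = 0" by (rule E'_vanishes[OF \<psi> \<psi>0]) (use that in auto)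
      then show ?thesis using E'_eq(3)[OF \<psi>, of x "{0..R}"] by (simp add: has_vector_derivative_def)
    qed
  qed (use that in auto)
  then show ?thesis using r by simp
qed

end

section \<open>The Bessel bessel_kernel\<close>

definition bessel_coeff :: "nat \<Rightarrow> real" where
  "bessel_coeff k = (- 1 / 4) ^ k / (fact k)\<^sup>2"

text \<open>\<open>bessel_fun z = J\<^sub>0(\<surd>z)\<close> for \<open>z \<ge> 0\<close> and \<open>I\<^sub>0(\<surd>-z)\<close> for \<open>z \<le> 0\<close>, as one entire function.\<close>
definition bessel_fun :: "real \<Rightarrow> real" where
  "bessel_fun z = (\<Sum>k. bessel_coeff k * z ^ k)"

definition bessel_fun' :: "real \<Rightarrow> real" where
  "bessel_fun' z = (\<Sum>k. diffs bessel_coeff k * z ^ k)"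

definition bessel_fun'' :: "real \<Rightarrow> real" where
  "bessel_fun'' z = (\<Sum>k. diffs (diffs bessel_coeff) k * z ^ k)"

lemma summable_bessel: "summable (\<lambda>k. bessel_coeff k * z ^ k)"
proof (rule summable_comparison_test)
  show "summable (\<lambda>k. \<bar>z / 4\<bar> ^ k / fact k)" using summable_exp[of "\<bar>z / 4\<bar>"] by (simp add: field_simps)
  have "norm (bessel_coeff k * z ^ k) \<le> \<bar>z / 4\<bar> ^ k / fact k" for k
  proof -
    have "norm (bessel_coeff k * z ^ k) = \<bar>z / 4\<bar> ^ k / (fact k)\<^sup>2"
      by (simp add: bessel_coeff_def abs_mult power_abs power_divide)
    also have "\<dots> \<le> \<bar>z / 4\<bar> ^ k / fact k"
      by (intro divide_left_mono) (auto simp: power2_eq_square fact_ge_1)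
    finally show ?thesis .
  qed
  then show "\<exists>N. \<forall>k\<ge>N. norm (bessel_coeff k * z ^ k) \<le> \<bar>z / 4\<bar> ^ k / fact k" by blast
qed

lemma summable_bessel': "summable (\<lambda>k. diffs bessel_coeff k * z ^ k)"
  by (rule termdiff_converges_all[OF summable_bessel])

lemma summable_bessel'': "summable (\<lambda>k. diffs (diffs bessel_coeff) k * z ^ k)"
  by (rule termdiff_converges_all[OF summable_bessel'])

lemma bessel_fun_deriv: "(bessel_fun has_real_derivative bessel_fun' z) (at z)"
  using termdiffs_strong_converges_everywhere[OF summable_bessel]
  by (simp add: bessel_fun_def[abs_def] bessel_fun'_def)

lemma bessel_fun'_deriv: "(bessel_fun' has_real_derivative bessel_fun'' z) (at z)"
  using termdiffs_strong_converges_everywhere[OF summable_bessel']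
  by (simp add: bessel_fun'_def[abs_def] bessel_fun''_def)

lemma bessel_fun''_continuous: "continuous_on S bessel_fun''"
  using termdiffs_strong_converges_everywhere[OF summable_bessel'']
  by (auto simp: bessel_fun''_def[abs_def] intro!: continuous_at_imp_continuous_on DERIV_isCont)

lemma bessel_fun_0: "bessel_fun 0 = 1"
  unfolding bessel_fun_def powser_zero by (simp add: bessel_coeff_def)

text \<open>Bessel's equation of order 0 in the variable \<open>z\<close>, the square of the usual
  argument. It amounts to the recurrence \<open>(n + 1)\<^sup>2 * c (n + 1) = - c n / 4\<close> of
  the coefficients.\<close>

lemma bessel_equation: "z * bessel_fun'' z + bessel_fun' z = - bessel_fun z / 4"
proof -
  let ?c = bessel_coeff
  have "(\<lambda>n. z * (real n * diffs ?c n * z ^ (n - Suc 0)) + diffs ?c n * z ^ n) sums (z * bessel_fun'' z + bessel_fun' z)"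
    unfolding bessel_fun''_def bessel_fun'_def
    by (intro sums_add sums_mult diffs_equiv summable_bessel'' summable_sums summable_bessel')
  moreover have "z * (real n * diffs ?c n * z ^ (n - Suc 0)) + diffs ?c n * z ^ n = - 1 / 4 * (?c n * z ^ n)" for n
  proof -
    have cancel: "x\<^sup>2 * (q * p / (x * f)\<^sup>2) = q * (p / f\<^sup>2)" if "x \<noteq> 0" for x q p f :: real
      using that by (simp add: power_mult_distrib)
    have "real (Suc n) \<noteq> 0" by simp
    then have "(real n + 1)\<^sup>2 * ?c (Suc n) = - 1 / 4 * ?c n"
      unfolding bessel_coeff_def power_Suc fact_Suc of_nat_Suc using cancel by (simp only: add.commute)
    moreover have "z * (real n * diffs ?c n * z ^ (n - Suc 0)) = real n * diffs ?c n * z ^ n"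
      by (cases n) auto
    ultimately have "z * (real n * diffs ?c n * z ^ (n - Suc 0)) + diffs ?c n * z ^ n = (- 1 / 4 * ?c n) * z ^ n"
      by (simp only: diffs_def flip: distrib_right) (simp add: power2_eq_square algebra_simps)
    then show ?thesis by simp
  qed
  ultimately have "(\<lambda>n. - 1 / 4 * (?c n * z ^ n)) sums (z * bessel_fun'' z + bessel_fun' z)" by simp
  moreover have "(\<lambda>n. - 1 / 4 * (?c n * z ^ n)) sums (- 1 / 4 * bessel_fun z)"
    unfolding bessel_fun_def by (intro sums_mult summable_sums summable_bessel)
  ultimately show ?thesis using sums_unique2 by fastforce
qed

lemma bessel_J0_eq:
  assumes "s \<ge> 0"
  shows "bessel_J0 (m * sqrt s) = bessel_fun (m\<^sup>2 * s)"
proof -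
  have "(m * sqrt s / 2) ^ (2 * k) = (m\<^sup>2 * s / 4) ^ k" for k
    using assms by (simp add: power_mult power_divide power_mult_distrib)
  moreover have "(- 1) ^ k * (m\<^sup>2 * s / 4) ^ k = (- 1 / 4) ^ k * (m\<^sup>2 * s) ^ k" for k
    by (simp flip: power_mult_distrib)
  then have "(- 1) ^ k / (fact k)\<^sup>2 * (m\<^sup>2 * s / 4) ^ k = (- 1 / 4) ^ k / (fact k)\<^sup>2 * (m\<^sup>2 * s) ^ k" for k
    by (metis times_divide_eq_left)
  ultimately show ?thesis unfolding bessel_J0_def bessel_fun_def bessel_coeff_def
    by simp
qed

lemma bessel_I0_eq:
  assumes "s \<ge> 0"
  shows "bessel_I0 (m * sqrt s) = bessel_fun (- m\<^sup>2 * s)"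
proof -
  have "(m * sqrt s / 2) ^ (2 * k) = (m\<^sup>2 * s / 4) ^ k" for k
    using assms by (simp add: power_mult power_divide power_mult_distrib)
  moreover have "(- 1 / 4) ^ k * (- m\<^sup>2 * s) ^ k = (m\<^sup>2 * s / 4) ^ k" for k
    by (simp flip: power_mult_distrib)
  then have "(- 1 / 4) ^ k / (fact k)\<^sup>2 * (- m\<^sup>2 * s) ^ k = (m\<^sup>2 * s / 4) ^ k / (fact k)\<^sup>2" for k
    by (metis times_divide_eq_left)
  ultimately show ?thesis unfolding bessel_I0_def bessel_fun_def bessel_coeff_def
    by simp
qed

text \<open>The Riemann function of \<open>\<partial>\<^sub>t\<^sup>2 - \<partial>\<^sub>r\<^sup>2 + l\<close> with pole at the origin.\<close>
definition bessel_kernel :: "real \<Rightarrow> real \<Rightarrow> real \<Rightarrow> real" where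
  "bessel_kernel l t r = bessel_fun (l * (t\<^sup>2 - r\<^sup>2))"

definition bessel_kernel_t :: "real \<Rightarrow> real \<Rightarrow> real \<Rightarrow> real" where
  "bessel_kernel_t l t r = 2 * l * t * bessel_fun' (l * (t\<^sup>2 - r\<^sup>2))"

definition bessel_kernel_r :: "real \<Rightarrow> real \<Rightarrow> real \<Rightarrow> real" where
  "bessel_kernel_r l t r = - 2 * l * r * bessel_fun' (l * (t\<^sup>2 - r\<^sup>2))"

definition bessel_kernel_tt :: "real \<Rightarrow> real \<Rightarrow> real \<Rightarrow> real" where
  "bessel_kernel_tt l t r = 2 * l * bessel_fun' (l * (t\<^sup>2 - r\<^sup>2)) + (2 * l * t)\<^sup>2 * bessel_fun'' (l * (t\<^sup>2 - r\<^sup>2))"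

definition bessel_kernel_rr :: "real \<Rightarrow> real \<Rightarrow> real \<Rightarrow> real" where
  "bessel_kernel_rr l t r = - 2 * l * bessel_fun' (l * (t\<^sup>2 - r\<^sup>2)) + (2 * l * r)\<^sup>2 * bessel_fun'' (l * (t\<^sup>2 - r\<^sup>2))"

lemma
  shows bessel_kernel_deriv_t: "((\<lambda>t. bessel_kernel l t r) has_real_derivative bessel_kernel_t l t r) (at t within S)"
    and bessel_kernel_deriv_r: "((\<lambda>r. bessel_kernel l t r) has_real_derivative bessel_kernel_r l t r) (at r within S)"
    and bessel_kernel_t_deriv_t: "((\<lambda>t. bessel_kernel_t l t r) has_real_derivative bessel_kernel_tt l t r) (at t within S)"
    and bessel_kernel_r_deriv_r: "((\<lambda>r. bessel_kernel_r l t r) has_real_derivative bessel_kernel_rr l t r) (at r within S)"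
proof -
  have t: "((\<lambda>t. l * (t\<^sup>2 - r\<^sup>2)) has_real_derivative 2 * l * t) (at t within S)"
    by (auto intro!: derivative_eq_intros)
  have r: "((\<lambda>r. l * (t\<^sup>2 - r\<^sup>2)) has_real_derivative - 2 * l * r) (at r within S)"
    by (auto intro!: derivative_eq_intros)
  show "((\<lambda>t. bessel_kernel l t r) has_real_derivative bessel_kernel_t l t r) (at t within S)"
    using DERIV_chain2[OF bessel_fun_deriv t] by (simp add: bessel_kernel_def bessel_kernel_t_def mult.commute)
  show "((\<lambda>r. bessel_kernel l t r) has_real_derivative bessel_kernel_r l t r) (at r within S)"
    using DERIV_chain2[OF bessel_fun_deriv r] by (simp add: bessel_kernel_def bessel_kernel_r_def mult.commute)
  show "((\<lambda>t. bessel_kernel_t l t r) has_real_derivative bessel_kernel_tt l t r) (at t within S)"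
    unfolding bessel_kernel_t_def bessel_kernel_tt_def
    by (rule derivative_eq_intros DERIV_chain2[OF bessel_fun'_deriv t] refl)+ (simp add: power2_eq_square)
  show "((\<lambda>r. bessel_kernel_r l t r) has_real_derivative bessel_kernel_rr l t r) (at r within S)"
    unfolding bessel_kernel_r_def bessel_kernel_rr_def
    by (rule derivative_eq_intros DERIV_chain2[OF bessel_fun'_deriv r] refl)+ (simp add: power2_eq_square)
qed

text \<open>In terms of \<open>z = l * (t\<^sup>2 - r\<^sup>2)\<close> the two second derivatives
  combine to \<open>4 * l * (z * bessel_fun'' z + bessel_fun' z)\<close>, which Bessel's equation
  evaluates.\<close>

lemma bessel_kernel_equation: "bessel_kernel_tt l t r - bessel_kernel_rr l t r + l * bessel_kernel l t r = 0"
proof -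
  define z where "z = l * (t\<^sup>2 - r\<^sup>2)"
  have "bessel_kernel_tt l t r - bessel_kernel_rr l t r = 4 * l * (z * bessel_fun'' z + bessel_fun' z)"
    unfolding bessel_kernel_tt_def bessel_kernel_rr_def z_def[symmetric]
    by (simp add: z_def power2_eq_square algebra_simps)
  then show ?thesis unfolding bessel_equation by (simp add: bessel_kernel_def z_def)
qed

lemma bessel_kernel_diag: "bessel_kernel l t t = 1" "bessel_kernel_t l t t + bessel_kernel_r l t t = 0"
  by (simp_all add: bessel_kernel_def bessel_fun_0 bessel_kernel_t_def bessel_kernel_r_def)

lemma bessel_kernel_r_0: "bessel_kernel_r l t 0 = 0"
  by (simp add: bessel_kernel_r_def)

lemma
  fixes f g :: "'z::topological_space \<Rightarrow> real"
  assumes "continuous_on S f" "continuous_on S g"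
  shows bessel_kernel_continuous: "continuous_on S (\<lambda>z. bessel_kernel l (f z) (g z))"
    and bessel_kernel_t_continuous: "continuous_on S (\<lambda>z. bessel_kernel_t l (f z) (g z))"
    and bessel_kernel_tt_continuous: "continuous_on S (\<lambda>z. bessel_kernel_tt l (f z) (g z))"
proof -
  have 0: "continuous_on UNIV bessel_fun" and 1: "continuous_on UNIV bessel_fun'"
    using bessel_fun_deriv bessel_fun'_deriv by (auto intro!: continuous_at_imp_continuous_on DERIV_isCont)
  have c: "continuous_on S (\<lambda>z. l * ((f z)\<^sup>2 - (g z)\<^sup>2))" by (intro continuous_intros assms)
  note c0 = continuous_on_compose2[OF 0 c] and c1 = continuous_on_compose2[OF 1 c]
    and c2 = continuous_on_compose2[OF bessel_fun''_continuous[of UNIV] c]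
  show "continuous_on S (\<lambda>z. bessel_kernel l (f z) (g z))" unfolding bessel_kernel_def by (rule c0) simp
  show "continuous_on S (\<lambda>z. bessel_kernel_t l (f z) (g z))" unfolding bessel_kernel_t_def
    by (intro continuous_intros assms c1) simp
  show "continuous_on S (\<lambda>z. bessel_kernel_tt l (f z) (g z))" unfolding bessel_kernel_tt_def
    by (intro continuous_intros assms c1 c2) simp_all
qed

section \<open>Riemann's method in the triangle \<open>0 \<le> r \<le> t\<close>\<close>

text \<open>The chain rule along \<open>(t, t)\<close>, shaped for integrals with upper limit
  \<open>x\<close> and parameter \<open>y\<close>. The limit is confined to an interval, so its
  derivative may be one-sided and is asked for at a single point; the joint continuity is put on the
  \<open>y\<close>-derivative.\<close>

lemma has_vector_derivative_diagonal:
  fixes f :: "real \<Rightarrow> real \<Rightarrow> 'c::real_normed_vector"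
  assumes fx: "((\<lambda>x. f x s) has_vector_derivative fx) (at s within X)"
    and fy: "\<And>x y. x \<in> X \<Longrightarrow> ((\<lambda>y. f x y) has_vector_derivative fy x y) (at y)"
    and cont: "continuous_on (X \<times> UNIV) (\<lambda>(x, y). fy x y)" and s: "s \<in> X"
  shows "((\<lambda>t. f t t) has_vector_derivative fx + fy s s) (at s within X)"
proof -
  have "((\<lambda>(x, y). f x y) has_derivative (\<lambda>(tx, ty). tx *\<^sub>R fx + blinfun_scaleR_left (fy s s) ty)) (at (s, s) within X \<times> UNIV)"
  proof (rule has_derivative_partialsI[where fx = "\<lambda>tx. tx *\<^sub>R fx" and fy = "\<lambda>x y. blinfun_scaleR_left (fy x y)"])
    show "((\<lambda>x. f x s) has_derivative (\<lambda>tx. tx *\<^sub>R fx)) (at s within X)"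
      using fx by (simp add: has_vector_derivative_def)
    show "((\<lambda>y. f x y) has_derivative blinfun_apply (blinfun_scaleR_left (fy x y))) (at y within UNIV)" if "x \<in> X" for x y
      using fy[OF that] by (simp add: has_vector_derivative_def)
    have "continuous (at (s, s) within X \<times> UNIV) (\<lambda>z. fy (fst z) (snd z))"
      using cont s by (simp add: continuous_on_eq_continuous_within case_prod_unfold)
    then show "continuous (at (s, s) within X \<times> UNIV) (\<lambda>(x, y). blinfun_scaleR_left (fy x y))"
      unfolding case_prod_unfold by (intro continuous_intros)
  qed auto
  then have "((\<lambda>(x, y). f x y) has_derivative (\<lambda>(tx, ty). tx *\<^sub>R fx + blinfun_scaleR_left (fy s s) ty))
      (at (s, s) within (\<lambda>t. (t, t)) ` X)"
    by (rule has_derivative_subset) auto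
  moreover have "((\<lambda>t. (t, t)) has_derivative (\<lambda>h. (h, h))) (at s within X)"
    by (auto intro!: derivative_eq_intros)
  ultimately have "((\<lambda>t. f t t) has_derivative (\<lambda>h. h *\<^sub>R fx + blinfun_scaleR_left (fy s s) h)) (at s within X)"
    using has_derivative_in_compose[of "\<lambda>t. (t, t)" "\<lambda>h. (h, h)" s X "\<lambda>(x, y). f x y"
      "\<lambda>(tx, ty). tx *\<^sub>R fx + blinfun_scaleR_left (fy s s) ty"] by simp
  then show ?thesis by (simp add: has_vector_derivative_def scaleR_add_right)
qed

text \<open>The two occurrences of \<open>t\<close> are first treated as independent variables: the
  limit contributes the boundary value, the parameter the integral of \<open>F'\<close>.\<close>

lemma has_vector_derivative_integral_upto:
  fixes F F' :: "real \<Rightarrow> real \<Rightarrow> complex"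
  assumes F: "continuous_on UNIV (\<lambda>(t, r). F t r)" and F': "continuous_on UNIV (\<lambda>(t, r). F' t r)"
    and deriv: "\<And>t r. ((\<lambda>t. F t r) has_vector_derivative F' t r) (at t)" and s: "s \<in> {0..b}"
  shows "((\<lambda>t. integral {0..t} (F t)) has_vector_derivative F s s + integral {0..s} (F' s)) (at s within {0..b})"
proof (rule has_vector_derivative_diagonal[where f = "\<lambda>x y. integral {0..x} (F y)"
      and fy = "\<lambda>x y. integral {0..x} (F' y)"])
  have Fs: "continuous_on S (F t)" for S t
    using continuous_on_compose2[OF F continuous_on_Pair[OF continuous_on_const[of _ t] continuous_on_id]] by simp
  show "((\<lambda>x. integral {0..x} (F s)) has_vector_derivative F s s) (at s within {0..b})"
    by (rule integral_has_vector_derivative[OF Fs s])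
  show "((\<lambda>y. integral {0..x} (F y)) has_vector_derivative integral {0..x} (F' y)) (at y)" for x y
    using leibniz_rule_vector_derivative[of UNIV 0 x F F' y] deriv Fs F'
    by (auto intro!: integrable_continuous_real continuous_on_subset[OF F'])
  have "continuous_on UNIV (\<lambda>(r, t). F' t r)"
    using continuous_on_compose2[OF F' continuous_on_Pair[OF continuous_on_snd[OF continuous_on_id] continuous_on_fst[OF continuous_on_id]], of UNIV]
    by (simp add: case_prod_unfold)
  from integral_upto_continuous[OF this]
  show "continuous_on ({0..b} \<times> UNIV) (\<lambda>(x, y). integral {0..x} (F' y))"
    by (rule continuous_on_subset) auto
qed (rule s)

text \<open>The inner integral is the \<open>t\<close>-derivative of
  \<open>integral {0..t} (\<lambda>r. K a_t - K_t a) - a t t\<close>, where \<open>K\<close> is the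
  kernel. At \<open>t = T\<close> this quantity is 0 by the end conditions and at
  \<open>t = 0\<close> it is \<open>- a 0 0\<close>, so that its total increase is
  \<open>a 0 0\<close>.\<close>

lemma triangle_identity:
  fixes a a_t a_tt a_r a_rr :: "real \<Rightarrow> real \<Rightarrow> complex"
  assumes t: "\<And>t r. ((\<lambda>t. a t r) has_vector_derivative a_t t r) (at t)"
    and tt: "\<And>t r. ((\<lambda>t. a_t t r) has_vector_derivative a_tt t r) (at t)"
    and r: "\<And>t r S. ((\<lambda>r. a t r) has_vector_derivative a_r t r) (at r within S)"
    and rr: "\<And>t r S. ((\<lambda>r. a_r t r) has_vector_derivative a_rr t r) (at r within S)"
    and cont: "continuous_on UNIV (\<lambda>(t, r). a t r)" "continuous_on UNIV (\<lambda>(t, r). a_t t r)"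
      "continuous_on UNIV (\<lambda>(t, r). a_tt t r)" "continuous_on UNIV (\<lambda>(t, r). a_rr t r)"
    and r0: "\<And>t. a_r t 0 = 0" and T: "T \<ge> 0" "\<And>r. a T r = 0" "\<And>r. a_t T r = 0"
  shows "((\<lambda>t. integral {0..t} (\<lambda>r. bessel_kernel l t r *\<^sub>R (a_tt t r - a_rr t r + l *\<^sub>R a t r))) has_integral a 0 0) {0..T}"
proof -
  have swap: "continuous_on S (\<lambda>z. h (f z) (g z))"
    if "continuous_on UNIV (\<lambda>(t, r). h t r)" "continuous_on S f" "continuous_on S g"
    for h :: "real \<Rightarrow> real \<Rightarrow> complex" and f g and S :: "'z::topological_space set"
    using continuous_on_compose2[OF that(1) continuous_on_Pair[OF that(2,3)]] by simp
  note c = swap[OF cont(1)] swap[OF cont(2)] swap[OF cont(3)] swap[OF cont(4)]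
    bessel_kernel_continuous bessel_kernel_t_continuous bessel_kernel_tt_continuous continuous_intros
  define F where "F t r = bessel_kernel l t r *\<^sub>R a_t t r - bessel_kernel_t l t r *\<^sub>R a t r" for t r
  define F' where "F' t r = bessel_kernel l t r *\<^sub>R a_tt t r - bessel_kernel_tt l t r *\<^sub>R a t r" for t r
  define S where "S t = integral {0..t} (\<lambda>r. bessel_kernel l t r *\<^sub>R (a_tt t r - a_rr t r + l *\<^sub>R a t r))" for t
  note kv = bessel_kernel_deriv_t bessel_kernel_deriv_r bessel_kernel_t_deriv_t bessel_kernel_r_deriv_r
  \<comment> \<open>Green's identity in \<open>r\<close>: by the kernel equation \<open>F'\<close>
    is the integrand of \<open>S\<close> plus \<open>K a_rr - K_rr a\<close>, which is the
    \<open>r\<close>-derivative of \<open>K a_r - K_r a\<close>. At \<open>r = 0\<close> both terms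
    vanish, at \<open>r = s\<close> the kernel is 1.\<close>
  have F'_int: "integral {0..s} (F' s) = S s + a_r s s - bessel_kernel_r l s s *\<^sub>R a s s" if "s \<ge> 0" for s
  proof -
    have "((\<lambda>r. bessel_kernel l s r *\<^sub>R a_rr s r - bessel_kernel_rr l s r *\<^sub>R a s r) has_integral
       (bessel_kernel l s s *\<^sub>R a_r s s - bessel_kernel_r l s s *\<^sub>R a s s) - (bessel_kernel l s 0 *\<^sub>R a_r s 0 - bessel_kernel_r l s 0 *\<^sub>R a s 0)) {0..s}"
    proof (rule fundamental_theorem_of_calculus[OF that])
      fix x
      have "((\<lambda>r. bessel_kernel l s r *\<^sub>R a_r s r - bessel_kernel_r l s r *\<^sub>R a s r) has_vector_derivative
         (bessel_kernel l s x *\<^sub>R a_rr s x + bessel_kernel_r l s x *\<^sub>R a_r s x) - (bessel_kernel_r l s x *\<^sub>R a_r s x + bessel_kernel_rr l s x *\<^sub>R a s x)) (at x within {0..s})"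
        by (intro has_vector_derivative_diff has_vector_derivative_scaleR kv r rr)
      then show "((\<lambda>r. bessel_kernel l s r *\<^sub>R a_r s r - bessel_kernel_r l s r *\<^sub>R a s r) has_vector_derivative
         bessel_kernel l s x *\<^sub>R a_rr s x - bessel_kernel_rr l s x *\<^sub>R a s x) (at x within {0..s})" by simp
    qed
    then have 1: "((\<lambda>r. bessel_kernel l s r *\<^sub>R a_rr s r - bessel_kernel_rr l s r *\<^sub>R a s r) has_integral
       a_r s s - bessel_kernel_r l s s *\<^sub>R a s s) {0..s}"
      by (simp add: bessel_kernel_diag r0 bessel_kernel_r_0)
    have 2: "((\<lambda>r. bessel_kernel l s r *\<^sub>R (a_tt s r - a_rr s r + l *\<^sub>R a s r)) has_integral S s) {0..s}"
      unfolding S_def by (intro integrable_integral integrable_continuous_real c)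
    have eq: "bessel_kernel l s r *\<^sub>R (a_tt s r - a_rr s r + l *\<^sub>R a s r) + (bessel_kernel l s r *\<^sub>R a_rr s r - bessel_kernel_rr l s r *\<^sub>R a s r) = F' s r" for r
    proof -
      have "bessel_kernel_tt l s r = bessel_kernel_rr l s r - l * bessel_kernel l s r" using bessel_kernel_equation[of l s r] by simp
      then show ?thesis
        unfolding F'_def by (simp only: scaleR_left_diff_distrib) (simp add: algebra_simps)
    qed
    from integral_unique[OF has_integral_add[OF 2 1, unfolded eq]] show ?thesis by simp
  qed
  have "((\<lambda>t. integral {0..t} (F t) - a t t) has_vector_derivative S s) (at s within {0..T})" if s: "s \<in> {0..T}" for s
  proof -
    have "((\<lambda>t. integral {0..t} (F t)) has_vector_derivative F s s + integral {0..s} (F' s)) (at s within {0..T})"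
    proof (rule has_vector_derivative_integral_upto[OF _ _ _ s])
      show "continuous_on UNIV (\<lambda>(t, r). F t r)" "continuous_on UNIV (\<lambda>(t, r). F' t r)"
        unfolding F_def F'_def case_prod_unfold by (intro c)+
      show "((\<lambda>t. F t r) has_vector_derivative F' t r) (at t)" for t r
      proof -
        have "((\<lambda>t. F t r) has_vector_derivative (bessel_kernel l t r *\<^sub>R a_tt t r + bessel_kernel_t l t r *\<^sub>R a_t t r)
            - (bessel_kernel_t l t r *\<^sub>R a_t t r + bessel_kernel_tt l t r *\<^sub>R a t r)) (at t)"
          unfolding F_def by (intro has_vector_derivative_diff has_vector_derivative_scaleR kv t tt)
        then show ?thesis by (simp add: F'_def)
      qed
    qed
    moreover have "((\<lambda>t. a t t) has_vector_derivative a_r s s + a_t s s) (at s within {0..T})"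
    proof (rule has_vector_derivative_diagonal[where f = "\<lambda>r t. a t r" and fy = "\<lambda>r t. a_t t r"])
      show "continuous_on ({0..T} \<times> UNIV) (\<lambda>(r, t). a_t t r)"
        unfolding case_prod_unfold by (intro c)
    qed (use s r t in auto)
    ultimately have "((\<lambda>t. integral {0..t} (F t) - a t t) has_vector_derivative
        (F s s + integral {0..s} (F' s)) - (a_r s s + a_t s s)) (at s within {0..T})"
      by (rule has_vector_derivative_diff)
    \<comment> \<open>Subtracting the derivative of \<open>a t t\<close> cancels \<open>a_t\<close>
      and \<open>a_r\<close>. What remains on the diagonal is the tangential derivative of the
      kernel along the characteristic, where the kernel is constant.\<close>
    moreover have "(F s s + integral {0..s} (F' s)) - (a_r s s + a_t s s) = S s - (bessel_kernel_t l s s + bessel_kernel_r l s s) *\<^sub>R a s s"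
      using s by (simp add: F'_int F_def bessel_kernel_diag(1) algebra_simps)
    ultimately show ?thesis by (simp add: bessel_kernel_diag(2))
  qed
  from fundamental_theorem_of_calculus[OF T(1) this]
  have "(S has_integral (integral {0..T} (F T) - a T T) - (integral {0..0} (F 0) - a 0 0)) {0..T}" .
  moreover have "F T = (\<lambda>r. 0)" using T by (simp add: F_def fun_eq_iff)
  ultimately show ?thesis using T by (simp add: S_def[abs_def])
qed

section \<open>The Klein--Gordon fundamental solution\<close>

lemma sum_Basis_axis:
  fixes f :: "real ^ 'n \<Rightarrow> 'b::comm_monoid_add"
  shows "(\<Sum>b\<in>Basis. f b) = (\<Sum>i\<in>UNIV. f (axis i 1))"
proof -
  have inj: "inj (\<lambda>i :: 'n. axis i (1 :: real))" by (auto simp: inj_on_def axis_eq_axis)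
  have "(Basis :: (real ^ 'n) set) = (\<lambda>i :: 'n. axis i 1) ` UNIV" by (auto simp: Basis_vec_def)
  then have "(\<Sum>b\<in>Basis. f b) = sum f ((\<lambda>i :: 'n. axis i 1) ` UNIV)" by (rule arg_cong)
  also have "\<dots> = (\<Sum>i\<in>UNIV. f (axis i 1))" using sum.reindex[OF inj, of f] by (simp add: o_def)
  finally show ?thesis .
qed

text \<open>The transpose of the Klein-Gordon operator, acting on test functions. It has the same
  form as the operator because each second derivative is transferred by two sign changes.\<close>

definition kg_operator :: "complex \<Rightarrow> ((real ^ 'n) \<times> real \<Rightarrow> complex) \<Rightarrow> (real ^ 'n) \<times> real \<Rightarrow> complex" where
  "kg_operator c \<phi> z = dir_deriv (0, 1) (dir_deriv (0, 1) \<phi>) z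
     - (\<Sum>b\<in>Basis. dir_deriv (b, 0) (dir_deriv (b, 0) \<phi>) z) + c * \<phi> z"

lemma
  fixes \<phi> :: "(real ^ 'n) \<times> real \<Rightarrow> complex"
  assumes \<phi>: "test_function \<phi>"
  shows test_function_kg: "test_function (kg_operator c \<phi>)"
    and kg_operator_translate: "kg_operator c (\<lambda>z. \<phi> (z + p)) = (\<lambda>z. kg_operator c \<phi> (z + p))"
    and klein_gordon_eq: "distribution u \<Longrightarrow> klein_gordon M u \<phi> = u (kg_operator (M\<^sup>2) \<phi>)"
proof -
  let ?f = "\<lambda>b. dir_deriv b (dir_deriv b \<phi>)"
  have B: "(0, 1) \<in> (Basis :: ((real ^ 'n) \<times> real) set)" "\<And>b. b \<in> Basis \<Longrightarrow> (b, 0) \<in> (Basis :: ((real ^ 'n) \<times> real) set)"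
    by (auto simp: Basis_prod_def)
  have f: "test_function (?f b)" if "b \<in> Basis" for b using \<phi> that by (intro test_function_dir_deriv)
  have S: "test_function (\<lambda>z. \<Sum>b\<in>Basis. ?f (b, 0) z)" by (intro test_function_sum f B) simp_all
  have D: "test_function (\<lambda>z. ?f (0, 1) z - (\<Sum>b\<in>Basis. ?f (b, 0) z))" by (intro test_function_diff S f B)
  have eq: "kg_operator c \<phi> = (\<lambda>z. 1 * (?f (0, 1) z - (\<Sum>b\<in>Basis. ?f (b, 0) z)) + c * \<phi> z)" for c
    by (simp add: kg_operator_def fun_eq_iff)
  show "test_function (kg_operator c \<phi>)" unfolding eq by (intro test_function_lincomb D \<phi>)
  show "kg_operator c (\<lambda>z. \<phi> (z + p)) = (\<lambda>z. kg_operator c \<phi> (z + p))"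
    unfolding kg_operator_def
    by (simp add: dir_deriv_translate test_function_smooth[OF \<phi>] smooth_dir_deriv B cong: sum.cong)
  show "klein_gordon M u \<phi> = u (kg_operator (M\<^sup>2) \<phi>)" if u: "distribution u"
  proof -
    have "u (kg_operator (M\<^sup>2) \<phi>) = u (\<lambda>z. ?f (0, 1) z - (\<Sum>b\<in>Basis. ?f (b, 0) z)) + M\<^sup>2 * u \<phi>"
      unfolding eq by (subst distribution_lincomb[OF u D \<phi>]) simp
    also have "u (\<lambda>z. ?f (0, 1) z - (\<Sum>b\<in>Basis. ?f (b, 0) z)) = u (?f (0, 1)) - u (\<lambda>z. \<Sum>b\<in>Basis. ?f (b, 0) z)"
      by (rule distribution_diff[OF u f[OF B(1)] S])
    also have "u (\<lambda>z. \<Sum>b\<in>Basis. ?f (b, 0) z) = (\<Sum>b\<in>Basis. u (?f (b, 0)))"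
      by (rule distribution_sum[OF _ _ u]) (auto intro!: f B)
    finally show ?thesis
      unfolding sum_Basis_axis by (simp add: klein_gordon_def distr_deriv_def)
  qed
qed

context wave
begin

text \<open>The common form of \<open>E_Re\<close> (\<open>l = m\<^sup>2\<close>) and
  \<open>E_Im\<close> (\<open>l = - m\<^sup>2\<close>), which lets one argument treat both signs of
  the squared mass.\<close>

definition kg_solution :: "real \<Rightarrow> real ^ 'n \<Rightarrow> real \<Rightarrow> ((real ^ 'n) \<times> real) distr" where
  "kg_solution l x0 t0 = distr_of_family (\<lambda>t \<psi>.
     of_real (heaviside (t - t0)) *
     distr_integral 0 (t - t0) (\<lambda>r \<eta>. of_real (bessel_kernel l (t - t0) r) * distr_translate x0 (E r) \<eta>) \<psi>)"

lemma E_Re_eq: "E_Re E m x0 t0 = kg_solution (m\<^sup>2) x0 t0"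
  and E_Im_eq: "E_Im E m x0 t0 = kg_solution (- m\<^sup>2) x0 t0"
proof -
  \<comment> \<open>The passage from \<open>bessel_J0\<close> and \<open>bessel_I0\<close> to
    \<open>bessel_fun\<close> is valid for a nonnegative radicand, which the range of integration
    guarantees.\<close>
  have nn: "0 \<le> s\<^sup>2 - r\<^sup>2" if "r \<in> {0..s}" for r s :: real
    using that by (auto intro: power_mono)
  show "E_Re E m x0 t0 = kg_solution (m\<^sup>2) x0 t0"
    unfolding E_Re_def kg_solution_def distr_of_family_def distr_integral_def bessel_kernel_def
    by (intro ext Bochner_Integration.integral_cong refl arg_cong2[where f = "(*)"] set_lebesgue_integral_cong)
       (auto simp: bessel_J0_eq nn)
  show "E_Im E m x0 t0 = kg_solution (- m\<^sup>2) x0 t0"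
    unfolding E_Im_def kg_solution_def distr_of_family_def distr_integral_def bessel_kernel_def
    by (intro ext Bochner_Integration.integral_cong refl arg_cong2[where f = "(*)"] set_lebesgue_integral_cong)
       (auto simp: bessel_I0_eq nn)
qed

section \<open>Pairings with space-time test functions and integrals over the triangle\<close>

definition A :: "((real ^ 'n) \<times> real \<Rightarrow> complex) \<Rightarrow> real \<Rightarrow> real \<Rightarrow> complex" where
  "A \<phi> t r = E r (\<lambda>x. \<phi> (x, t))"

lemma A_continuous:
  assumes "test_function \<phi>" "continuous_on S f" "continuous_on S g"
  shows "continuous_on S (\<lambda>z. A \<phi> (f z) (g z))"
  using continuous_on_compose2[OF smooth_distr_family_continuous[OF E_family test_function_test_family[OF assms(1)], of UNIV]
      continuous_on_Pair[OF assms(3,2)]]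
  by (simp add: A_def)

lemma A_lincomb:
  assumes "test_function \<phi>" "test_function \<psi>"
  shows "A (\<lambda>z. a * \<phi> z + b * \<psi> z) t r = a * A \<phi> t r + b * A \<psi> t r"
  unfolding A_def
  by (rule distribution_lincomb[OF E_distribution]) (intro test_function_slice test_function_test_family assms)+

definition J :: "real \<Rightarrow> real \<Rightarrow> ((real ^ 'n) \<times> real \<Rightarrow> complex) \<Rightarrow> complex" where
  "J l T \<phi> = integral {0..T} (\<lambda>t. integral {0..t} (\<lambda>r. bessel_kernel l t r *\<^sub>R A \<phi> t r))"

text \<open>Continuity is proved with the upper limit and the parameter of the integrand as separate
  variables and then restricted to the diagonal.\<close>

lemma inner_integral_continuous:
  assumes "test_function \<phi>"
  shows "continuous_on {0..T} (\<lambda>t. integral {0..t} (\<lambda>r. bessel_kernel l t r *\<^sub>R A \<phi> t r))"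
proof -
  have "continuous_on UNIV (\<lambda>(r, t). bessel_kernel l t r *\<^sub>R A \<phi> t r)"
    unfolding case_prod_unfold by (intro continuous_intros bessel_kernel_continuous A_continuous assms)
  from integral_upto_continuous[OF this]
  have c: "continuous_on {z :: real \<times> real. 0 \<le> fst z} (\<lambda>(t, y). integral {0..t} (\<lambda>r. bessel_kernel l y r *\<^sub>R A \<phi> y r))" .
  have "(\<lambda>t. (t, t)) ` {0..T} \<subseteq> {z :: real \<times> real. 0 \<le> fst z}" by auto
  from continuous_on_compose2[OF c continuous_on_Pair[OF continuous_on_id continuous_on_id] this] show ?thesis by simp
qed

lemma integrand_continuous:
  "test_function \<phi> \<Longrightarrow> continuous_on S (\<lambda>r. bessel_kernel l t r *\<^sub>R A \<phi> t r)"
  by (intro continuous_intros bessel_kernel_continuous A_continuous)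

lemma J_lincomb:
  assumes \<phi>: "test_function \<phi>" and \<psi>: "test_function \<psi>"
  shows "J l T (\<lambda>z. a * \<phi> z + b * \<psi> z) = a * J l T \<phi> + b * J l T \<psi>"
proof -
  let ?I = "\<lambda>\<phi> t. integral {0..t} (\<lambda>r. bessel_kernel l t r *\<^sub>R A \<phi> t r)"
  have "?I (\<lambda>z. a * \<phi> z + b * \<psi> z) t = a * ?I \<phi> t + b * ?I \<psi> t" for t
  proof -
    have "((\<lambda>r. a * (bessel_kernel l t r *\<^sub>R A \<phi> t r) + b * (bessel_kernel l t r *\<^sub>R A \<psi> t r)) has_integral a * ?I \<phi> t + b * ?I \<psi> t) {0..t}"
      by (intro has_integral_add has_integral_mult_right integrable_integral integrable_continuous_real integrand_continuous \<phi> \<psi>)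
    then show ?thesis
      unfolding A_lincomb[OF \<phi> \<psi>] by (intro integral_unique) (simp add: scaleR_right_distrib)
  qed
  moreover have "((\<lambda>t. a * ?I \<phi> t + b * ?I \<psi> t) has_integral a * J l T \<phi> + b * J l T \<psi>) {0..T}"
    unfolding J_def
    by (intro has_integral_add has_integral_mult_right integrable_integral integrable_continuous_real inner_integral_continuous \<phi> \<psi>)
  ultimately show ?thesis unfolding J_def[of _ _ "\<lambda>z. a * \<phi> z + b * \<psi> z"] by (simp add: integral_unique)
qed

text \<open>The Heaviside factor cuts off negative times and the support of \<phi> late ones, so the
  Lebesgue integrals become integrals of continuous functions over a compact triangle. Any
  \<open>T\<close> beyond the support will do, which lets several test functions share one
  triangle.\<close>

lemma kg_solution_eq:
  assumes \<phi>: "test_function \<phi>" and T: "T \<ge> 0" "\<And>x t. t > T \<Longrightarrow> \<phi> (x + x0, t + t0) = 0"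
  shows "kg_solution l x0 t0 \<phi> = J l T (\<lambda>z. \<phi> (z + (x0, t0)))"
proof -
  let ?\<phi> = "\<lambda>z. \<phi> (z + (x0, t0))"
  have t\<phi>: "test_function ?\<phi>" by (rule test_function_translate[OF \<phi>])
  let ?I = "\<lambda>t. integral {0..t} (\<lambda>r. bessel_kernel l t r *\<^sub>R A ?\<phi> t r)"
  have "kg_solution l x0 t0 \<phi> = (LBINT t. of_real (heaviside (t - t0)) *
     (LBINT r:{0..t - t0}. of_real (bessel_kernel l (t - t0) r) * E r (\<lambda>x. \<phi> (x + x0, t))))"
    by (simp add: kg_solution_def distr_of_family_def distr_integral_def distr_translate_def)
  \<comment> \<open>Time is shifted by \<open>t0\<close>, which places the vertex of the triangle at
    the origin.\<close>
  also have "\<dots> = (LBINT t. of_real (heaviside t) *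
     (LBINT r:{0..t}. of_real (bessel_kernel l t r) * E r (\<lambda>x. \<phi> (x + x0, t0 + t))))"
    by (subst lborel_integral_real_affine[where c = 1 and t = t0]) simp_all
  also have "\<dots> = (LBINT t:{0..T}. ?I t)"
    unfolding set_lebesgue_integral_def[of lborel "{0..T}"]
  proof (intro Bochner_Integration.integral_cong refl)
    fix t :: real
    have I: "(LBINT r:{0..t}. of_real (bessel_kernel l t r) * E r (\<lambda>x. \<phi> (x + x0, t0 + t))) = ?I t"
    proof -
      have "(LBINT r:{0..t}. bessel_kernel l t r *\<^sub>R A ?\<phi> t r) = ?I t"
        by (intro set_borel_integral_eq_integral borel_integrable_atLeastAtMost' integrand_continuous t\<phi>)
      then show ?thesis by (simp add: A_def scaleR_conv_of_real add.commute)
    qed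
    have "?I t = 0" if "t > T"
      using T(2)[OF that] distribution_zero[OF E_distribution] by (simp add: A_def)
    then show "of_real (heaviside t) * (LBINT r:{0..t}. of_real (bessel_kernel l t r) * E r (\<lambda>x. \<phi> (x + x0, t0 + t)))
        = indicat_real {0..T} t *\<^sub>R ?I t"
      \<comment> \<open>The convention \<open>heaviside 0 = 1\<close> matches the closed left end of
        \<open>{0..T}\<close>.\<close>
      unfolding I by (auto simp: heaviside_def indicator_def)
  qed
  also have "\<dots> = J l T ?\<phi>"
    unfolding J_def
    by (intro set_borel_integral_eq_integral borel_integrable_atLeastAtMost' inner_integral_continuous t\<phi>)
  finally show ?thesis .
qed

lemma time_bound:
  assumes "compact (K :: ((real ^ 'n) \<times> real) set)"
  obtains T where "T \<ge> 0" "\<And>x t. t > T \<Longrightarrow> (x + x0, t + t0) \<notin> K"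
proof -
  have "bounded (snd ` K)" using assms by (intro bounded_snd compact_imp_bounded)
  then obtain B where B: "\<And>s. s \<in> snd ` K \<Longrightarrow> \<bar>s\<bar> \<le> B" by (auto simp: bounded_iff)
  have "(x + x0, t + t0) \<notin> K" if "t > \<bar>B\<bar> + \<bar>t0\<bar>" for x t
  proof
    assume "(x + x0, t + t0) \<in> K"
    then have "\<bar>t + t0\<bar> \<le> B" by (intro B) force
    then show False using that by linarith
  qed
  then show ?thesis by (intro that[of "\<bar>B\<bar> + \<bar>t0\<bar>"]) auto
qed

text \<open>All \<open>E r\<close> with \<open>r\<close> in \<open>{0..T}\<close> obey one seminorm
  bound on the spatial projection of \<open>K\<close>, the kernel is bounded on the compact square,
  and the two integrations cost at most a factor \<open>T\<close> each.\<close>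

lemma kg_solution_bound:
  assumes K: "compact K"
  shows "\<exists>C N. \<forall>\<phi>. test_function \<phi> \<and> fun_support \<phi> \<subseteq> K \<longrightarrow> cmod (kg_solution l x0 t0 \<phi>) \<le> C * test_norm N \<phi>"
proof -
  obtain T where T: "T \<ge> 0" "\<And>x t. t > T \<Longrightarrow> (x + x0, t + t0) \<notin> K" using time_bound[OF K] by blast
  \<comment> \<open>The spatial projection of \<open>K\<close>, recentred at \<open>x0\<close>: it
    contains the supports of all time slices of the translated test function.\<close>
  define K1 where "K1 = (\<lambda>z. fst z - x0) ` K"
  have "compact K1" unfolding K1_def using K by (intro compact_continuous_image continuous_intros)
  then obtain C N where C: "C \<ge> 0" and CN: "\<And>r \<psi>. r \<in> {0..T} \<Longrightarrow> test_function \<psi> \<Longrightarrow> (\<And>x. x \<notin> K1 \<Longrightarrow> \<psi> x = 0)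
      \<Longrightarrow> cmod (E r \<psi>) \<le> C * test_norm N \<psi>"
    using smooth_distr_family_bound[OF E_family _ compact_Icc] by metis
  have "compact ((\<lambda>z. bessel_kernel l (fst z) (snd z)) ` ({0..T} \<times> {0..T}))"
    by (intro compact_continuous_image bessel_kernel_continuous continuous_intros compact_Times compact_Icc)
  from compact_imp_bounded[OF this] obtain M where
    M: "\<forall>k\<in>(\<lambda>z. bessel_kernel l (fst z) (snd z)) ` ({0..T} \<times> {0..T}). norm k \<le> M"
    unfolding bounded_iff by blast
  have kb: "\<bar>bessel_kernel l t r\<bar> \<le> M" if "t \<in> {0..T}" "r \<in> {0..T}" for t r
  proof -
    have "(t, r) \<in> {0..T} \<times> {0..T}" using that by simp
    from M[rule_format, OF imageI[OF this]] show ?thesis by simp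
  qed
  \<comment> \<open>Spatial derivatives of a slice are among the space-time derivatives of \<phi>,
    so each of the \<open>L\<close> summands of the slice seminorm is at most
    \<open>test_norm N \<phi>\<close>.\<close>
  define L where "L = card {vs. set vs \<subseteq> (Basis :: (real ^ 'n) set) \<and> length vs \<le> N}"
  have "cmod (kg_solution l x0 t0 \<phi>) \<le> (M * (C * L) * T * T) * test_norm N \<phi>"
    if \<phi>: "test_function \<phi>" "fun_support \<phi> \<subseteq> K" for \<phi>
  proof -
    let ?\<phi> = "\<lambda>z. \<phi> (z + (x0, t0))"
    have t\<phi>: "test_function ?\<phi>" by (rule test_function_translate[OF \<phi>(1)])
    have supp: "\<phi> z = 0" if "z \<notin> K" for z
      using \<phi>(2) that fun_support_subset[OF compact_imp_closed[OF K]] by blast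
    have A: "cmod (A ?\<phi> t r) \<le> (C * L) * test_norm N \<phi>" if "r \<in> {0..T}" for t r
    proof -
      have "cmod (A ?\<phi> t r) \<le> C * test_norm N (\<lambda>x. ?\<phi> (x, t))"
        unfolding A_def
      proof (rule CN[OF that test_function_slice[OF test_function_test_family[OF t\<phi>]]])
        fix x assume x: "x \<notin> K1"
        have "(x + x0, t + t0) \<notin> K"
        proof
          assume "(x + x0, t + t0) \<in> K"
          then have "fst (x + x0, t + t0) - x0 \<in> K1" unfolding K1_def by (rule imageI)
          then show False using x by simp
        qed
        then show "?\<phi> (x, t) = 0" using supp by simp
      qed
      also have "test_norm N (\<lambda>x. ?\<phi> (x, t)) \<le> L * test_norm N \<phi>"
        unfolding L_def
      proof (rule test_norm_le)
        fix vs and x :: "real ^ 'n" assume vs: "set vs \<subseteq> (Basis :: (real ^ 'n) set)" "length vs \<le> N"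
        let ?i = "map (\<lambda>x :: real ^ 'n. (x, 0 :: real)) vs"
        have i: "set ?i \<subseteq> Basis" using vs(1) inl_Basis by fastforce
        have "iter_deriv vs (\<lambda>x. ?\<phi> (x, t)) x = iter_deriv ?i ?\<phi> (x, t)"
          by (simp only: iter_deriv_slice[OF test_function_smooth[OF t\<phi>] vs(1)])
        also have "\<dots> = iter_deriv ?i \<phi> ((x, t) + (x0, t0))"
          using iter_deriv_affine[OF test_function_smooth[OF \<phi>(1)] linear_id, of ?i "(x0, t0)"] i by simp
        finally show "cmod (iter_deriv vs (\<lambda>x. ?\<phi> (x, t)) x) \<le> test_norm N \<phi>"
          using norm_iter_deriv_le[OF \<phi>(1) i, of N] vs(2) by simp
      qed
      finally show ?thesis using C by (simp add: mult_left_mono mult.assoc)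
    qed
    have M0: "M \<ge> 0" using kb[of 0 0] T(1) by force
    have nn: "(C * L) * test_norm N \<phi> \<ge> 0" using C test_norm_nonneg[OF \<phi>(1)] by simp
    have I: "cmod (integral {0..t} (\<lambda>r. bessel_kernel l t r *\<^sub>R A ?\<phi> t r)) \<le> M * ((C * L) * test_norm N \<phi>) * T"
      if t: "t \<in> {0..T}" for t
    proof -
      have "cmod (integral {0..t} (\<lambda>r. bessel_kernel l t r *\<^sub>R A ?\<phi> t r)) \<le> (M * ((C * L) * test_norm N \<phi>)) * (t - 0)"
      proof (rule integral_bound)
        show "norm (bessel_kernel l t r *\<^sub>R A ?\<phi> t r) \<le> M * ((C * L) * test_norm N \<phi>)" if "r \<in> {0..t}" for r
          unfolding norm_scaleR using that t M0 by (intro mult_mono kb A) auto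
      qed (use t integrand_continuous[OF t\<phi>] in auto)
      also have "\<dots> \<le> M * ((C * L) * test_norm N \<phi>) * T"
        using t mult_nonneg_nonneg[OF M0 nn] by (intro mult_left_mono) auto
      finally show ?thesis .
    qed
    have "cmod (J l T ?\<phi>) \<le> (M * ((C * L) * test_norm N \<phi>) * T) * (T - 0)"
      unfolding J_def using T(1) by (intro integral_bound inner_integral_continuous t\<phi> I)
    moreover have "kg_solution l x0 t0 \<phi> = J l T ?\<phi>"
      by (rule kg_solution_eq[OF \<phi>(1) T(1)]) (use T(2) supp in blast)
    ultimately show ?thesis by (simp add: algebra_simps)
  qed
  then show ?thesis by blast
qed

lemma kg_solution_distribution: "distribution (kg_solution l x0 t0)"
  unfolding distribution_def
proof (intro conjI allI impI)
  fix \<phi> \<psi> :: "(real ^ 'n) \<times> real \<Rightarrow> complex" and a b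
  assume \<phi>: "test_function \<phi>" and \<psi>: "test_function \<psi>"
  obtain K where K: "compact K" "\<And>z. z \<notin> K \<Longrightarrow> \<phi> z = 0" using test_functionE[OF \<phi>] by blast
  obtain K' where K': "compact K'" "\<And>z. z \<notin> K' \<Longrightarrow> \<psi> z = 0" using test_functionE[OF \<psi>] by blast
  \<comment> \<open>A common \<open>T\<close> represents both functions and their combination by the
    same \<open>J l T\<close>, whose linearity then suffices.\<close>
  obtain T where T: "T \<ge> 0" "\<And>x t. t > T \<Longrightarrow> (x + x0, t + t0) \<notin> K \<union> K'"
    using time_bound[OF compact_Un[OF K(1) K'(1)]] by blast
  have 1: "kg_solution l x0 t0 \<phi> = J l T (\<lambda>z. \<phi> (z + (x0, t0)))"
    by (rule kg_solution_eq[OF \<phi> T(1)]) (use T(2) K(2) in blast)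
  have 2: "kg_solution l x0 t0 \<psi> = J l T (\<lambda>z. \<psi> (z + (x0, t0)))"
    by (rule kg_solution_eq[OF \<psi> T(1)]) (use T(2) K'(2) in blast)
  have "kg_solution l x0 t0 (\<lambda>z. a * \<phi> z + b * \<psi> z) = J l T (\<lambda>z. a * \<phi> (z + (x0, t0)) + b * \<psi> (z + (x0, t0)))"
  proof (rule kg_solution_eq[OF test_function_lincomb[OF \<phi> \<psi>] T(1)])
    fix x t assume "T < t"
    then have "(x + x0, t + t0) \<notin> K" "(x + x0, t + t0) \<notin> K'" using T(2) by auto
    then show "a * \<phi> (x + x0, t + t0) + b * \<psi> (x + x0, t + t0) = 0" by (simp add: K(2) K'(2))
  qed
  then show "kg_solution l x0 t0 (\<lambda>z. a * \<phi> z + b * \<psi> z) = a * kg_solution l x0 t0 \<phi> + b * kg_solution l x0 t0 \<psi>"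
    unfolding 1 2 by (simp add: J_lincomb[OF test_function_translate[OF \<phi>] test_function_translate[OF \<psi>]])
qed (use kg_solution_bound in \<open>simp add: test_norm_def\<close>)

text \<open>This is \<open>triangle_identity\<close> for \<open>A \<phi> t r\<close>: derivatives in
  \<open>t\<close> fall on \<phi>, those in \<open>r\<close> on the wave family, and the wave
  equation turns the second \<open>r\<close>-derivative into the spatial Laplacian of \<phi>. The
  conditions at \<open>T\<close> provide the end conditions, and the second datum the condition at
  \<open>r = 0\<close>.\<close>

lemma J_kg_operator:
  assumes \<phi>: "test_function \<phi>" and T: "T \<ge> 0" "\<And>x t. t \<ge> T \<Longrightarrow> \<phi> (x, t) = 0" "\<And>x. dir_deriv (0, 1) \<phi> (x, T) = 0"
  shows "J l T (kg_operator (of_real l) \<phi>) = \<phi> 0"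
proof -
  let ?D = "dir_deriv (0, 1)"
  let ?S = "\<lambda>b. dir_deriv (b, 0) (dir_deriv (b, 0) \<phi>)"
  have B: "(0, 1) \<in> (Basis :: ((real ^ 'n) \<times> real) set)" "\<And>b. b \<in> Basis \<Longrightarrow> (b, 0) \<in> (Basis :: ((real ^ 'n) \<times> real) set)"
    by (auto simp: Basis_prod_def)
  have D: "test_function (?D \<phi>)" by (rule test_function_dir_deriv[OF \<phi> B(1)])
  have DD: "test_function (?D (?D \<phi>))" by (rule test_function_dir_deriv[OF D B(1)])
  have S: "test_function (?S b)" if "b \<in> Basis" for b by (intro test_function_dir_deriv \<phi> B that)
  have slice: "test_function (\<lambda>x. \<psi> (x, t))" if "test_function \<psi>" for \<psi> and t :: real
    by (rule test_function_slice[OF test_function_test_family[OF that]])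
  have A_t: "((\<lambda>t. A \<psi> t r) has_vector_derivative A (?D \<psi>) t r) (at t)" if "test_function \<psi>" for \<psi> t r
    unfolding A_def by (rule distribution_has_vector_derivative[OF E_distribution test_function_test_family[OF that]])
  have DD_slice: "dir_deriv b (dir_deriv b (\<lambda>x. \<phi> (x, t))) = (\<lambda>x. ?S b (x, t))" if "b \<in> Basis" for b t
    using that B(2)[OF that] \<phi> by (simp add: dir_deriv_slice test_function_smooth smooth_dir_deriv)
  have A_sum: "A (kg_operator (of_real l) \<phi>) t r = A (?D (?D \<phi>)) t r - (\<Sum>b\<in>Basis. A (?S b) t r) + l *\<^sub>R A \<phi> t r" for t r
  proof -
    have sum: "test_function (\<lambda>x. \<Sum>b\<in>Basis. ?S b (x, t))" by (intro test_function_sum slice S) simp_all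
    have "A (kg_operator (of_real l) \<phi>) t r
        = E r (\<lambda>x. 1 * (?D (?D \<phi>) (x, t) - (\<Sum>b\<in>Basis. ?S b (x, t))) + of_real l * \<phi> (x, t))"
      by (simp add: A_def kg_operator_def)
    also have "\<dots> = E r (\<lambda>x. ?D (?D \<phi>) (x, t) - (\<Sum>b\<in>Basis. ?S b (x, t))) + l *\<^sub>R A \<phi> t r"
      by (subst distribution_lincomb[OF E_distribution test_function_diff[OF slice[OF DD] sum] slice[OF \<phi>]])
         (simp add: A_def scaleR_conv_of_real)
    also have "E r (\<lambda>x. ?D (?D \<phi>) (x, t) - (\<Sum>b\<in>Basis. ?S b (x, t))) = A (?D (?D \<phi>)) t r - E r (\<lambda>x. \<Sum>b\<in>Basis. ?S b (x, t))"
      unfolding A_def by (rule distribution_diff[OF E_distribution slice[OF DD] sum])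
    also have "E r (\<lambda>x. \<Sum>b\<in>Basis. ?S b (x, t)) = (\<Sum>b\<in>Basis. A (?S b) t r)"
      unfolding A_def by (rule distribution_sum[OF _ _ E_distribution]) (auto intro!: slice S)
    finally show ?thesis .
  qed
  have "((\<lambda>t. integral {0..t} (\<lambda>r. bessel_kernel l t r *\<^sub>R (A (?D (?D \<phi>)) t r - (\<Sum>b\<in>Basis. A (?S b) t r) + l *\<^sub>R A \<phi> t r)))
      has_integral A \<phi> 0 0) {0..T}"
  proof (rule triangle_identity[where a_t = "A (?D \<phi>)" and a_r = "\<lambda>t r. E' r (\<lambda>x. \<phi> (x, t))"])
    show "((\<lambda>t. A \<phi> t r) has_vector_derivative A (?D \<phi>) t r) (at t)"
      "((\<lambda>t. A (?D \<phi>) t r) has_vector_derivative A (?D (?D \<phi>)) t r) (at t)" for t r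
      by (rule A_t[OF \<phi>], rule A_t[OF D])
    show "((\<lambda>r. A \<phi> t r) has_vector_derivative E' r (\<lambda>x. \<phi> (x, t))) (at r within S)" for t r S
      unfolding A_def by (rule E'_eq(3)[OF slice[OF \<phi>]])
    show "((\<lambda>r. E' r (\<lambda>x. \<phi> (x, t))) has_vector_derivative (\<Sum>b\<in>Basis. A (?S b) t r)) (at r within S)" for t r S
      using E'_has_vector_derivative[OF slice[OF \<phi>], of t r S] by (simp add: DD_slice A_def)
    show "continuous_on UNIV (\<lambda>(t, r). A \<phi> t r)" "continuous_on UNIV (\<lambda>(t, r). A (?D \<phi>) t r)"
      "continuous_on UNIV (\<lambda>(t, r). A (?D (?D \<phi>)) t r)" "continuous_on UNIV (\<lambda>(t, r). \<Sum>b\<in>Basis. A (?S b) t r)"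
      unfolding case_prod_unfold by (intro A_continuous continuous_intros \<phi> D DD S)+
    show "E' 0 (\<lambda>x. \<phi> (x, t)) = 0" for t by (rule E'_0[OF slice[OF \<phi>]])
    show "A \<phi> T r = 0" for r using T(2) distribution_zero[OF E_distribution] by (simp add: A_def)
    show "A (?D \<phi>) T r = 0" for r using T(3) distribution_zero[OF E_distribution] by (simp add: A_def)
  qed (rule T(1))
  then have "J l T (kg_operator (of_real l) \<phi>) = A \<phi> 0 0"
    unfolding J_def A_sum by (rule integral_unique)
  also have "\<dots> = \<phi> 0" unfolding A_def by (simp add: E_0[OF slice[OF \<phi>]] zero_prod_def)
  finally show ?thesis .
qed

lemma kg_solution_fundamental:
  assumes M: "M\<^sup>2 = of_real l"
  shows "forward_fundamental_solution M x0 t0 (kg_solution l x0 t0)"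
  unfolding forward_fundamental_solution_def
proof (intro conjI kg_solution_distribution)
  show "distr_eq (klein_gordon M (kg_solution l x0 t0)) (distr_tensor (dirac x0) (dirac t0))"
    unfolding distr_eq_def
  proof (intro allI impI)
    fix \<phi> :: "(real ^ 'n) \<times> real \<Rightarrow> complex" assume \<phi>: "test_function \<phi>"
    let ?\<phi> = "\<lambda>z. \<phi> (z + (x0, t0))"
    have t\<phi>: "test_function ?\<phi>" by (rule test_function_translate[OF \<phi>])
    obtain K where K: "compact K" "\<And>z. z \<notin> K \<Longrightarrow> \<phi> z = 0" using test_functionE[OF \<phi>] by blast
    obtain T where T: "T \<ge> 0" "\<And>x t. t > T \<Longrightarrow> (x + x0, t + t0) \<notin> K" using time_bound[OF K(1)] by blast
    have zero: "?\<phi> (x, t) = 0" if "t > T" for x t using T(2)[OF that] K(2) by simp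
    have vanish: "iter_deriv vs ?\<phi> (x, t) = 0" if "t > T" for vs x t
    proof (rule iter_deriv_vanish[of "UNIV \<times> {T<..}"])
      show "open (UNIV \<times> {T<..} :: ((real ^ 'n) \<times> real) set)" by (intro open_Times) auto
    qed (use zero that in auto)
    have kg0: "kg_operator (M\<^sup>2) ?\<phi> (x, t) = 0" if "t > T" for x t
      using vanish[OF that, of "[(0, 1), (0, 1)]" x] vanish[OF that, of "[(b, 0), (b, 0)]" x for b] zero[OF that]
      by (simp add: kg_operator_def)
    have "klein_gordon M (kg_solution l x0 t0) \<phi> = kg_solution l x0 t0 (kg_operator (M\<^sup>2) \<phi>)"
      by (rule klein_gordon_eq[OF \<phi> kg_solution_distribution])
    \<comment> \<open>The function is known to vanish for times strictly after \<open>T\<close>. At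
      \<open>T + 1\<close> it vanishes in a whole neighbourhood, hence together with its time
      derivative.\<close>
    also have "\<dots> = J l (T + 1) (\<lambda>z. kg_operator (M\<^sup>2) \<phi> (z + (x0, t0)))"
    proof (rule kg_solution_eq[OF test_function_kg[OF \<phi>]])
      show "kg_operator (M\<^sup>2) \<phi> (x + x0, t + t0) = 0" if "t > T + 1" for x t
        using kg0[of t x] that unfolding kg_operator_translate[OF \<phi>] by simp
    qed (use T in simp)
    also have "\<dots> = J l (T + 1) (kg_operator (of_real l) ?\<phi>)"
      unfolding kg_operator_translate[OF \<phi>] M ..
    also have "\<dots> = ?\<phi> 0"
      by (rule J_kg_operator[OF t\<phi>]) (use T(1) zero vanish[of "T + 1" "[(0, 1)]"] in auto)
    finally show "klein_gordon M (kg_solution l x0 t0) \<phi> = distr_tensor (dirac x0) (dirac t0) \<phi>"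
      by (simp add: distr_tensor_def dirac_def)
  qed
  \<comment> \<open>Closedness makes the complement of the cone one of the open sets that
    \<open>distr_support\<close> removes, provided the solution vanishes on test functions supported
    there.\<close>
  have "closed (forward_light_cone x0 t0)"
    unfolding forward_light_cone_def case_prod_unfold by (intro closed_Collect_le continuous_intros)
  moreover have "kg_solution l x0 t0 \<phi> = 0"
    if \<phi>: "test_function \<phi>" "fun_support \<phi> \<subseteq> - forward_light_cone x0 t0" for \<phi>
  proof -
    have cone: "\<phi> (x + x0, t + t0) = 0" if "norm x \<le> t" for x t
    proof (rule ccontr)
      assume "\<phi> (x + x0, t + t0) \<noteq> 0"
      then have "(x + x0, t + t0) \<in> fun_support \<phi>"
        unfolding fun_support_def using closure_subset[of "{x. \<phi> x \<noteq> 0}"] by blast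
      then have "(x + x0, t + t0) \<notin> forward_light_cone x0 t0" using \<phi>(2) by blast
      then show False using that by (simp add: forward_light_cone_def)
    qed
    obtain K where K: "compact K" "\<And>z. z \<notin> K \<Longrightarrow> \<phi> z = 0" using test_functionE[OF \<phi>(1)] by blast
    obtain T where T: "T \<ge> 0" "\<And>x t. t > T \<Longrightarrow> (x + x0, t + t0) \<notin> K" using time_bound[OF K(1)] by blast
    \<comment> \<open>Finite propagation is used with radius \<open>R = t\<close>: the slice at time
      \<open>t\<close> vanishes on the closed ball of radius \<open>t\<close>, and \<open>r\<close>
      runs only up to \<open>t\<close>.\<close>
    have "A (\<lambda>z. \<phi> (z + (x0, t0))) t r = 0" if "r \<in> {0..t}" for t r
      unfolding A_def
    proof (rule finite_propagation)
      show "test_function (\<lambda>x. \<phi> ((x, t) + (x0, t0)))"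
        by (rule test_function_slice[OF test_function_test_family[OF test_function_translate[OF \<phi>(1)]]])
    qed (use that cone in auto)
    then have "integral {0..t} (\<lambda>r. bessel_kernel l t r *\<^sub>R A (\<lambda>z. \<phi> (z + (x0, t0))) t r) = 0" for t
      by (intro integral_unique has_integral_is_0) auto
    then have "J l T (\<lambda>z. \<phi> (z + (x0, t0))) = 0" by (simp add: J_def)
    moreover have "kg_solution l x0 t0 \<phi> = J l T (\<lambda>z. \<phi> (z + (x0, t0)))"
      by (rule kg_solution_eq[OF \<phi>(1) T(1)]) (use T(2) K(2) in blast)
    ultimately show ?thesis by simp
  qed
  ultimately show "distr_support (kg_solution l x0 t0) \<subseteq> forward_light_cone x0 t0"
    unfolding distr_support_def by (auto simp: open_Compl)
qed

end

theorem theorem2p1: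
  fixes M :: complex and m :: real
    and x0 :: "real ^ 'n" and t0 :: real
    and Ewave :: "real \<Rightarrow> (real ^ 'n) distr"
  assumes "M\<^sup>2 \<in> \<real> - {0}"
    and "m = cmod M"
    and "wave_fundamental_solution Ewave"
  shows "(Re (M\<^sup>2) > 0 \<longrightarrow> forward_fundamental_solution M x0 t0 (E_Re Ewave m x0 t0)) \<and>
         (Re (M\<^sup>2) < 0 \<longrightarrow> forward_fundamental_solution M x0 t0 (E_Im Ewave m x0 t0))"
proof -
  interpret wave Ewave by unfold_locales (rule assms(3))
  have real: "M\<^sup>2 = of_real (Re (M\<^sup>2))" using assms(1) by (simp add: complex_is_Real_iff complex_eq_iff)
  have "m\<^sup>2 = cmod (M\<^sup>2)" by (simp add: assms(2) norm_power)
  also have "\<dots> = \<bar>Re (M\<^sup>2)\<bar>" by (subst real) (simp only: norm_of_real)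
  finally have m: "m\<^sup>2 = \<bar>Re (M\<^sup>2)\<bar>" .
  \<comment> \<open>Since \<open>m\<^sup>2\<close> is the absolute value of the real number
    \<open>M\<^sup>2\<close>, the sign of \<open>M\<^sup>2\<close> decides between the parameters
    \<open>m\<^sup>2\<close> and \<open>- m\<^sup>2\<close> of the common kernel.\<close>
  have "M\<^sup>2 = of_real (m\<^sup>2)" if "Re (M\<^sup>2) > 0" using real m that by (metis abs_of_pos)
  moreover have "M\<^sup>2 = of_real (- m\<^sup>2)" if "Re (M\<^sup>2) < 0" using real m that by (metis abs_of_neg minus_minus)
  ultimately show ?thesis
    unfolding E_Re_eq E_Im_eq using kg_solution_fundamental by blast
qed

end
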